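(* Let $2\le d<\infty$ and let $\mathcal D$ be the Dirichlet module on the unit ball $\mathbb B_d$. Then the only nonzero submodule of $\mathcal D$ with finite defect is the whole module $\mathcal D$.
   Context: $\mathbb B_d$ is the open unit ball of $\mathbb C^d$. The Dirichlet module $\mathcal D$ is the reproducing kernel Hilbert space on $\mathbb B_d$ with kernel $\mathbf K(z,w)=\sum_{n\ge0}\frac{1}{n+1}\langle z,w\rangle^n=\frac{1}{\langle z,w\rangle}\log\frac{1}{1-\langle z,w\rangle}$, viewed as a module over $\mathbb C[z_1,\dots,z_d]$ by multiplication. Write $1-1/\mathbf K(z,w)=\sum_{n\ge1}b_n\langle z,w\rangle^n$ (here $b_n\ge0$ and $\sum_n b_n=1$), and $b_\alpha=\frac{|\alpha|!}{\alpha!}b_{|\alpha|}$ for $\alpha\in\mathbb N^d\setminus\{0\}$. A submodule is a closed subspace $\mathcal M$ of $\mathcal D$ invariant under multiplication by polynomials. Its defect operator is the operator on $\mathcal M$ given by $\Delta_{\mathcal M}=\bigl(I_{\mathcal M}-\sum_{\alpha\in\mathbb N^d\setminus\{0\}}b_\alpha R^\alpha(R^\alpha)^*\bigr)^{1/2}$, where $R^\alpha=M_{z^\alpha}|_{\mathcal M}$ (strong operator convergence). $\mathcal M$ has finite defect if $\Delta_{\mathcal M}$ has finite rank. *)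

theory Defs
  imports
    "HOL-Analysis.Analysis"
    "HOL-Library.Function_Algebras"
    "HOL-Computational_Algebra.Formal_Power_Series"
begin

section \<open>Reproducing kernel Hilbert spaces of complex-valued functions\<close>

text \<open>
  A Hilbert function space is a set \<open>H\<close> of functions together with its inner product \<open>ip\<close>.
  Functions on \<open>X\<close> are total functions vanishing outside \<open>X\<close>, so that equality of
  elements of \<open>H\<close> is equality on \<open>X\<close>. Sums and products of functions are pointwise.
\<close>

global_interpretation cfun:
  vector_space "\<lambda>(c :: complex) (f :: 'a \<Rightarrow> complex). (\<lambda>x. c * f x)"
  by unfold_locales (auto simp: fun_eq_iff algebra_simps)

definition ip_norm :: "(('a \<Rightarrow> complex) \<Rightarrow> ('a \<Rightarrow> complex) \<Rightarrow> complex) \<Rightarrow> ('a \<Rightarrow> complex) \<Rightarrow> real" where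
  "ip_norm ip f = sqrt (Re (ip f f))"

definition ip_tendsto ::
  "(('a \<Rightarrow> complex) \<Rightarrow> ('a \<Rightarrow> complex) \<Rightarrow> complex) \<Rightarrow> ('b \<Rightarrow> 'a \<Rightarrow> complex) \<Rightarrow> ('a \<Rightarrow> complex) \<Rightarrow> 'b filter \<Rightarrow> bool" where
  "ip_tendsto ip f l F \<longleftrightarrow> ((\<lambda>n. ip_norm ip (f n - l)) \<longlongrightarrow> 0) F"

text \<open>Unconditional summation in norm.\<close>

definition ip_has_sum ::
  "(('a \<Rightarrow> complex) \<Rightarrow> ('a \<Rightarrow> complex) \<Rightarrow> complex) \<Rightarrow> ('i \<Rightarrow> 'a \<Rightarrow> complex) \<Rightarrow> ('a \<Rightarrow> complex) \<Rightarrow> 'i set \<Rightarrow> bool" where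
  "ip_has_sum ip f s A \<longleftrightarrow> ip_tendsto ip (sum f) s (finite_subsets_at_top A)"

locale rkhs =
  fixes X :: "'a set"
    and K :: "'a \<Rightarrow> 'a \<Rightarrow> complex"
    and H :: "('a \<Rightarrow> complex) set"
    and ip :: "('a \<Rightarrow> complex) \<Rightarrow> ('a \<Rightarrow> complex) \<Rightarrow> complex"
  assumes subspace: "cfun.subspace H"
    and vanishes_outside: "\<And>f x. f \<in> H \<Longrightarrow> x \<notin> X \<Longrightarrow> f x = 0"
    and ip_add: "\<And>f g h. f \<in> H \<Longrightarrow> g \<in> H \<Longrightarrow> h \<in> H \<Longrightarrow> ip (f + g) h = ip f h + ip g h"
    and ip_scale: "\<And>c f g. f \<in> H \<Longrightarrow> g \<in> H \<Longrightarrow> ip (\<lambda>x. c * f x) g = c * ip f g"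
    and ip_commute: "\<And>f g. f \<in> H \<Longrightarrow> g \<in> H \<Longrightarrow> ip g f = cnj (ip f g)"
    and ip_pos: "\<And>f. f \<in> H \<Longrightarrow> f \<noteq> 0 \<Longrightarrow> Re (ip f f) > 0"
    and complete: "\<And>f :: nat \<Rightarrow> 'a \<Rightarrow> complex. (\<And>n. f n \<in> H) \<Longrightarrow>
      (\<And>e. e > 0 \<Longrightarrow> \<exists>N. \<forall>m\<ge>N. \<forall>n\<ge>N. ip_norm ip (f m - f n) < e) \<Longrightarrow>
      \<exists>g\<in>H. ip_tendsto ip f g sequentially"
    and kernel_mem: "\<And>w. w \<in> X \<Longrightarrow> (\<lambda>z. if z \<in> X then K z w else 0) \<in> H"
    and reproducing: "\<And>f w. f \<in> H \<Longrightarrow> w \<in> X \<Longrightarrow> ip f (\<lambda>z. if z \<in> X then K z w else 0) = f w"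

section \<open>Operators on a closed subspace\<close>

definition bounded_op_on ::
  "(('a \<Rightarrow> complex) \<Rightarrow> ('a \<Rightarrow> complex) \<Rightarrow> complex) \<Rightarrow> ('a \<Rightarrow> complex) set \<Rightarrow>
   (('a \<Rightarrow> complex) \<Rightarrow> 'a \<Rightarrow> complex) \<Rightarrow> bool" where
  "bounded_op_on ip M T \<longleftrightarrow>
     (\<forall>f\<in>M. T f \<in> M) \<and>
     (\<forall>f\<in>M. \<forall>g\<in>M. T (f + g) = T f + T g) \<and>
     (\<forall>c. \<forall>f\<in>M. T (\<lambda>x. c * f x) = (\<lambda>x. c * T f x)) \<and>
     (\<exists>C. \<forall>f\<in>M. ip_norm ip (T f) \<le> C * ip_norm ip f)"

definition positive_op_on ::
  "(('a \<Rightarrow> complex) \<Rightarrow> ('a \<Rightarrow> complex) \<Rightarrow> complex) \<Rightarrow> ('a \<Rightarrow> complex) set \<Rightarrow>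
   (('a \<Rightarrow> complex) \<Rightarrow> 'a \<Rightarrow> complex) \<Rightarrow> bool" where
  "positive_op_on ip M T \<longleftrightarrow> bounded_op_on ip M T \<and> (\<forall>f\<in>M. ip (T f) f \<in> \<real>\<^sub>\<ge>\<^sub>0)"

definition adjoint_on ::
  "(('a \<Rightarrow> complex) \<Rightarrow> ('a \<Rightarrow> complex) \<Rightarrow> complex) \<Rightarrow> ('a \<Rightarrow> complex) set \<Rightarrow>
   (('a \<Rightarrow> complex) \<Rightarrow> 'a \<Rightarrow> complex) \<Rightarrow> ('a \<Rightarrow> complex) \<Rightarrow> 'a \<Rightarrow> complex" where
  "adjoint_on ip M T g = (THE h. h \<in> M \<and> (\<forall>f\<in>M. ip (T f) g = ip f h))"

definition finite_rank_on ::
  "('a \<Rightarrow> complex) set \<Rightarrow> (('a \<Rightarrow> complex) \<Rightarrow> 'a \<Rightarrow> complex) \<Rightarrow> bool" where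
  "finite_rank_on M T \<longleftrightarrow> (\<exists>B. finite B \<and> T ` M \<subseteq> cfun.span B)"

section \<open>The Dirichlet kernel\<close>

definition hdot :: "complex ^ 'd \<Rightarrow> complex ^ 'd \<Rightarrow> complex" where
  "hdot z w = (\<Sum>i\<in>UNIV. z $ i * cnj (w $ i))"

definition dirichlet_kernel :: "complex ^ 'd \<Rightarrow> complex ^ 'd \<Rightarrow> complex" where
  "dirichlet_kernel z w = (\<Sum>n. of_real (1 / (real n + 1)) * hdot z w ^ n)"

text \<open>
  The coefficients of \<open>1 - 1/K\<close> as a power series in \<open>t = \<langle>z,w\<rangle>\<close>, where
  \<open>K = (\<Sum>n. t\<^sup>n / (n + 1))\<close> has constant term 1 and is inverted as a formal power series.
\<close>

definition dirichlet_b :: "nat \<Rightarrow> real" where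
  "dirichlet_b n = fps_nth (1 - inverse (Abs_fps (\<lambda>k. 1 / (real k + 1)))) n"

definition mi_size :: "nat ^ 'd \<Rightarrow> nat" where
  "mi_size \<alpha> = (\<Sum>i\<in>UNIV. \<alpha> $ i)"

definition mi_fact :: "nat ^ 'd \<Rightarrow> nat" where
  "mi_fact \<alpha> = (\<Prod>i\<in>UNIV. fact (\<alpha> $ i))"

definition mi_monom :: "nat ^ 'd \<Rightarrow> complex ^ 'd \<Rightarrow> complex" where
  "mi_monom \<alpha> z = (\<Prod>i\<in>UNIV. (z $ i) ^ (\<alpha> $ i))"

definition dirichlet_b_mi :: "nat ^ 'd \<Rightarrow> real" where
  "dirichlet_b_mi \<alpha> = fact (mi_size \<alpha>) / real (mi_fact \<alpha>) * dirichlet_b (mi_size \<alpha>)"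

section \<open>Submodules and their defect\<close>

definition polynomials :: "(complex ^ 'd \<Rightarrow> complex) set" where
  "polynomials = {p. \<exists>F c. finite F \<and> p = (\<lambda>z. \<Sum>\<alpha>\<in>F. c \<alpha> * mi_monom \<alpha> z)}"

definition poly_submodule ::
  "(complex ^ 'd \<Rightarrow> complex) set \<Rightarrow>
   ((complex ^ 'd \<Rightarrow> complex) \<Rightarrow> (complex ^ 'd \<Rightarrow> complex) \<Rightarrow> complex) \<Rightarrow>
   (complex ^ 'd \<Rightarrow> complex) set \<Rightarrow> bool" where
  "poly_submodule H ip M \<longleftrightarrow>
     M \<subseteq> H \<and> cfun.subspace M \<and>
     (\<forall>f g. (\<forall>n :: nat. f n \<in> M) \<and> g \<in> H \<and> ip_tendsto ip f g sequentially \<longrightarrow> g \<in> M) \<and>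
     (\<forall>p\<in>polynomials. \<forall>f\<in>M. p * f \<in> M)"

text \<open>
  \<open>\<Delta>\<close> is the positive square root of \<open>I - (\<Sum>\<alpha>\<noteq>0. b\<^sub>\<alpha> R\<^sup>\<alpha> (R\<^sup>\<alpha>)\<^sup>*)\<close> on \<open>M\<close>, the sum converging in the
  strong operator topology; positive square roots are unique. \<open>R\<^sup>\<alpha>\<close> is \<open>\<lambda>f. mi_monom \<alpha> * f\<close> on \<open>M\<close>.
\<close>

definition is_defect_operator ::
  "((complex ^ 'd \<Rightarrow> complex) \<Rightarrow> (complex ^ 'd \<Rightarrow> complex) \<Rightarrow> complex) \<Rightarrow>
   (complex ^ 'd \<Rightarrow> complex) set \<Rightarrow>
   ((complex ^ 'd \<Rightarrow> complex) \<Rightarrow> complex ^ 'd \<Rightarrow> complex) \<Rightarrow> bool" where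
  "is_defect_operator ip M \<Delta> \<longleftrightarrow>
     positive_op_on ip M \<Delta> \<and>
     (\<forall>f\<in>M. ip_has_sum ip
        (\<lambda>\<alpha> z. of_real (dirichlet_b_mi \<alpha>) *
           (mi_monom \<alpha> * adjoint_on ip M (\<lambda>g. mi_monom \<alpha> * g) f) z)
        (f - \<Delta> (\<Delta> f)) (- {0}))"

definition finite_defect ::
  "((complex ^ 'd \<Rightarrow> complex) \<Rightarrow> (complex ^ 'd \<Rightarrow> complex) \<Rightarrow> complex) \<Rightarrow>
   (complex ^ 'd \<Rightarrow> complex) set \<Rightarrow> bool" where
  "finite_defect ip M \<longleftrightarrow> (\<exists>\<Delta>. is_defect_operator ip M \<Delta> \<and> finite_rank_on M \<Delta>)"

end

theory Submission
  imports Defs "HOL-Complex_Analysis.Cauchy_Integral_Formula"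
begin

text \<open>
  Let \<open>D\<close> be the Dirichlet module, \<open>K\<close> its kernel and \<open>M\<close> a submodule.

  \<^bold>\<open>The whole module has finite defect.\<close> The monomials are orthogonal in \<open>D\<close>, with
  \<open>\<parallel>z\<^sup>\<alpha>\<parallel>\<^sup>2 = (|\<alpha>| + 1) \<alpha>! / |\<alpha>|!\<close> (\<open>wt\<close>), and they diagonalise every \<open>b\<^sub>\<alpha> M\<^sup>\<alpha> (M\<^sup>\<alpha>)\<^sup>*\<close>. Since the
  \<open>b\<^sub>n\<close> are the coefficients of \<open>1 - 1/K\<close>, the eigenvalues on a nonconstant monomial add up to 1
  (\<open>dirichlet_b_weight_sum\<close>), and on constants they vanish. They are nonnegative by Kaluza's lemma
  (\<open>dirichlet_b_nonneg\<close>), so the partial sums are contractions that converge strongly, and the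
  defect operator is the projection onto the constants (\<open>whole_finite_defect\<close>).

  \<^bold>\<open>The kernel of a submodule with finite defect.\<close> Let \<open>M \<noteq> 0\<close> have finite defect and let \<open>k\<^sub>w\<close> be
  the projection of \<open>K\<^sub>w\<close> to \<open>M\<close>. Applied to \<open>k\<^sub>w\<close>, the defect identity reads
  \<open>\<Delta>\<^sup>2 k\<^sub>w (z) = k\<^sub>w(z) / K(z,w)\<close>. As \<open>\<Delta>\<close> has finite rank, \<open>k\<^sub>z(z) = K(z,z) G(z)\<close> where
  \<open>G = \<Sum>\<^sub>e |\<phi>\<^sub>e|\<^sup>2\<close> is a finite sum with \<open>\<phi>\<^sub>e \<in> D\<close> (\<open>finite_defect_kernel\<close>). Always \<open>0 \<le> G \<le> 1\<close>.

  Choose a disc through the origin on which some \<open>f \<in> M\<close> does not vanish identically, and let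
  \<open>u\<close> be the linear coordinate of that disc. Two facts about \<open>G\<close> on this disc collide.

  \<^item> \<open>G\<close> has boundary values 1 (\<open>inner_on_slice\<close>). The estimate \<open>|h(z)|\<^sup>2 \<le> \<parallel>h\<parallel>\<^sup>2 K(z,z) G(z)\<close> for
    \<open>h \<in> M\<close>, applied to \<open>f\<close> times a truncation of \<open>K\<^sub>z\<close>, gives \<open>(1 - G) |f|\<^sup>2 \<rightarrow> 0\<close> in the mean over
    circles: \<open>\<parallel>u\<^sup>n f\<parallel>\<^sup>2 / (n + 1)\<close> tends to the Hardy space norm of the restriction of \<open>f\<close>
    (\<open>shift_norm_growth\<close>). Hence the column of the \<open>\<phi>\<^sub>e\<close> acts isometrically on the restrictions
    of elements of \<open>M\<close>. These form a nonzero shift invariant space, whose closure contains a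
    wandering vector as in Beurling's theorem. The products of this vector with the powers of \<open>u\<close>
    are orthogonal, so the isometry on it gives \<open>\<Sum>\<^sub>e \<parallel>\<phi>\<^sub>e\<parallel>\<^sup>2 \<ge> 1\<close> in the Hardy space
    (\<open>inner_column\<close>): the mean of \<open>G\<close> over the boundary circle is 1.

  \<^item> The \<open>\<phi>\<^sub>e\<close> are smoother than general Hardy space functions: their Taylor coefficients on the disc
    satisfy \<open>\<Sum> (n + 1) |\<phi>\<^sub>e\<^sub>,\<^sub>n|\<^sup>2 < \<infinity>\<close>. So the mean of \<open>1 - G\<close> over the circle of radius \<open>r\<close> is
    \<open>O(1 - r\<^sup>2)\<close>.

  The function \<open>h = 1 - k\<^sub>0\<close> is orthogonal to \<open>M\<close>, whence \<open>|h(z)|\<^sup>2 \<le> \<parallel>h\<parallel>\<^sup>2 K(z,z) (1 - G(z))\<close>. Here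
  \<open>K(z,z)\<close> grows only logarithmically, so the circle means of \<open>|h|\<^sup>2\<close> tend to 0. They are at least
  \<open>|h(0)|\<^sup>2 = \<parallel>h\<parallel>\<^sup>4\<close>. So \<open>h = 0\<close>, which means \<open>1 \<in> M\<close> (\<open>constants_in_M\<close>), and \<open>M\<close> is everything
  because polynomials are dense.

  All computations are done on a coordinate disc. This is enough because a space with reproducing
  kernel is determined by its kernel (\<open>rkhs_unique\<close>), so that unitary changes of variables act
  unitarily on \<open>D\<close> (\<open>compose_householder\<close>). The same uniqueness identifies the abstract
  \<open>D\<close> with a space of power series (\<open>dirichlet_model\<close>).
\<close>

section \<open>Hilbert spaces of functions\<close>

text \<open>
  The Hilbert space axioms without a kernel. Besides spaces of functions on the ball, the
  instances are spaces of coefficient families, and then the domain \<open>'a\<close> is the index set.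
\<close>
locale hilbert_fun =
  fixes H :: "('a \<Rightarrow> complex) set"
    and ip :: "('a \<Rightarrow> complex) \<Rightarrow> ('a \<Rightarrow> complex) \<Rightarrow> complex"
  assumes subsp: "cfun.subspace H"
    and add_left: "\<And>f g h. f \<in> H \<Longrightarrow> g \<in> H \<Longrightarrow> h \<in> H \<Longrightarrow> ip (f + g) h = ip f h + ip g h"
    and scale_left: "\<And>c f g. f \<in> H \<Longrightarrow> g \<in> H \<Longrightarrow> ip (\<lambda>x. c * f x) g = c * ip f g"
    and commute: "\<And>f g. f \<in> H \<Longrightarrow> g \<in> H \<Longrightarrow> ip g f = cnj (ip f g)"
    and pos: "\<And>f. f \<in> H \<Longrightarrow> f \<noteq> 0 \<Longrightarrow> Re (ip f f) > 0"
    and Cauchy_converges: "\<And>f :: nat \<Rightarrow> 'a \<Rightarrow> complex. (\<And>n. f n \<in> H) \<Longrightarrow>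
      (\<And>e. e > 0 \<Longrightarrow> \<exists>N. \<forall>m\<ge>N. \<forall>n\<ge>N. ip_norm ip (f m - f n) < e) \<Longrightarrow>
      \<exists>g\<in>H. ip_tendsto ip f g sequentially"
begin

abbreviation nrm :: "('a \<Rightarrow> complex) \<Rightarrow> real" where "nrm \<equiv> ip_norm ip"

lemma mem_0 [simp]: "0 \<in> H"
  using cfun.subspace_0[OF subsp] .
lemma mem_add [intro]: "f \<in> H \<Longrightarrow> g \<in> H \<Longrightarrow> f + g \<in> H"
  using cfun.subspace_add[OF subsp] by blast
lemma mem_scale [intro]: "f \<in> H \<Longrightarrow> (\<lambda>x. c * f x) \<in> H"
  using cfun.subspace_scale[OF subsp] by blast
lemma mem_diff [intro]: "f \<in> H \<Longrightarrow> g \<in> H \<Longrightarrow> f - g \<in> H"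
  using cfun.subspace_diff[OF subsp] by blast
lemma mem_sum [intro]: "(\<And>i. i \<in> A \<Longrightarrow> f i \<in> H) \<Longrightarrow> sum f A \<in> H"
  using cfun.subspace_sum[OF subsp] by blast

lemma add_right: "f \<in> H \<Longrightarrow> g \<in> H \<Longrightarrow> h \<in> H \<Longrightarrow> ip h (f + g) = ip h f + ip h g"
  using commute[of "f + g" h] commute[of f h] commute[of g h] add_left[of f g h]
    mem_add[of f g] by simp
lemma scale_right: "f \<in> H \<Longrightarrow> g \<in> H \<Longrightarrow> ip g (\<lambda>x. c * f x) = cnj c * ip g f"
  using commute[of "\<lambda>x. c * f x" g] commute[of f g] scale_left[of f g c] mem_scale[of f c] by simp

lemma diff_left: assumes "f \<in> H" "g \<in> H" "h \<in> H" shows "ip (f - g) h = ip f h - ip g h"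
proof -
  have "f - g = f + (\<lambda>x. (-1) * g x)" by (auto simp: fun_eq_iff)
  then have "ip (f - g) h = ip f h + ip (\<lambda>x. (-1) * g x) h"
    using add_left[OF assms(1) mem_scale[OF assms(2)] assms(3), of "-1"] by (simp only:)
  also have "ip (\<lambda>x. (-1) * g x) h = (-1) * ip g h" by (rule scale_left[OF assms(2,3)])
  also have "ip f h + (-1) * ip g h = ip f h - ip g h" by simp
  finally show ?thesis .
qed
lemma diff_right: "f \<in> H \<Longrightarrow> g \<in> H \<Longrightarrow> h \<in> H \<Longrightarrow> ip h (f - g) = ip h f - ip h g"
  using commute[of "f - g" h] commute[of f h] commute[of g h] diff_left[of f g h]
    mem_diff[of f g] by simp

lemma zero_left [simp]: "f \<in> H \<Longrightarrow> ip 0 f = 0"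
  using diff_left[of 0 0 f] by simp
lemma zero_right [simp]: "f \<in> H \<Longrightarrow> ip f 0 = 0"
  using diff_right[of 0 0 f] by simp

lemma sum_left: "(\<And>i. i \<in> A \<Longrightarrow> f i \<in> H) \<Longrightarrow> h \<in> H \<Longrightarrow> ip (sum f A) h = (\<Sum>i\<in>A. ip (f i) h)"
  by (induction A rule: infinite_finite_induct) (auto simp: add_left mem_sum)
lemma sum_right: "(\<And>i. i \<in> A \<Longrightarrow> f i \<in> H) \<Longrightarrow> h \<in> H \<Longrightarrow> ip h (sum f A) = (\<Sum>i\<in>A. ip h (f i))"
  by (induction A rule: infinite_finite_induct) (auto simp: add_right mem_sum)

lemma Re_ip_self_nonneg [simp]: "f \<in> H \<Longrightarrow> Re (ip f f) \<ge> 0"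
  using pos[of f] by (cases "f = 0") (auto)
lemma Im_ip_self [simp]: "f \<in> H \<Longrightarrow> Im (ip f f) = 0"
  using commute[of f f] by (simp add: complex_eq_iff)
lemma nrm_square: "f \<in> H \<Longrightarrow> (nrm f)\<^sup>2 = Re (ip f f)"
  by (simp add: ip_norm_def)
lemma ip_self: "f \<in> H \<Longrightarrow> ip f f = of_real ((nrm f)\<^sup>2)"
  by (simp add: nrm_square complex_eq_iff)
lemma nrm_nonneg [simp]: "f \<in> H \<Longrightarrow> nrm f \<ge> 0"
  by (simp add: ip_norm_def)
lemma nrm_0 [simp]: "nrm 0 = 0"
  by (simp add: ip_norm_def)
lemma nrm_eq_0: "f \<in> H \<Longrightarrow> nrm f = 0 \<longleftrightarrow> f = 0"
  using pos[of f] by (cases "f = 0") (auto simp: ip_norm_def)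
lemma nrm_scale: assumes "f \<in> H" shows "nrm (\<lambda>x. c * f x) = cmod c * nrm f"
proof (rule power2_eq_imp_eq)
  have "ip (\<lambda>x. c * f x) (\<lambda>x. c * f x) = (c * cnj c) * ip f f"
    using assms by (simp add: scale_left scale_right mem_scale)
  also have "\<dots> = of_real ((cmod c * nrm f)\<^sup>2)"
    using assms by (simp add: ip_self complex_norm_square[symmetric] power_mult_distrib)
  finally show "(nrm (\<lambda>x. c * f x))\<^sup>2 = (cmod c * nrm f)\<^sup>2"
    using assms by (simp add: nrm_square mem_scale)
qed (use assms in \<open>auto intro!: mult_nonneg_nonneg nrm_nonneg mem_scale\<close>)

lemma nrm_minus_commute: assumes "f \<in> H" "g \<in> H" shows "nrm (f - g) = nrm (g - f)"
proof -
  have "f - g = (\<lambda>x. (-1) * (g - f) x)" by (auto simp: fun_eq_iff)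
  then show ?thesis using nrm_scale[of "g - f" "-1"] assms by auto
qed

lemma nrm_add_square: assumes "f \<in> H" "g \<in> H"
  shows "(nrm (f + g))\<^sup>2 = (nrm f)\<^sup>2 + 2 * Re (ip f g) + (nrm g)\<^sup>2"
  using assms commute[of f g] by (simp add: nrm_square mem_add add_left add_right)
lemma nrm_diff_square: assumes "f \<in> H" "g \<in> H"
  shows "(nrm (f - g))\<^sup>2 = (nrm f)\<^sup>2 - 2 * Re (ip f g) + (nrm g)\<^sup>2"
  using assms commute[of f g] by (simp add: nrm_square mem_diff diff_left diff_right)

lemma Cauchy_Schwarz: assumes f: "f \<in> H" and g: "g \<in> H" shows "cmod (ip f g) \<le> nrm f * nrm g"
proof (cases "g = 0")
  case True then show ?thesis using f by simp
next
  case False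
  define N where "N = (nrm g)\<^sup>2"
  have N: "N > 0" using False g nrm_eq_0[OF g] by (simp add: N_def)
  define c where "c = ip f g / of_real N"
  have m: "(\<lambda>x. c * g x) \<in> H" using g by auto
  have "ip f (\<lambda>x. c * g x) = cnj c * ip f g" using f g by (rule_tac scale_right) auto
  also have "\<dots> = of_real ((cmod (ip f g))\<^sup>2 / N)"
    by (simp add: c_def complex_norm_square mult.commute del: of_real_power)
  finally have 1: "Re (ip f (\<lambda>x. c * g x)) = (cmod (ip f g))\<^sup>2 / N" by simp
  have 2: "(nrm (\<lambda>x. c * g x))\<^sup>2 = (cmod (ip f g))\<^sup>2 / N"
  proof -
    have "cmod c = cmod (ip f g) / N" using N by (simp add: c_def norm_divide)
    then have "(nrm (\<lambda>x. c * g x))\<^sup>2 = (cmod (ip f g) / N)\<^sup>2 * N"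
      by (simp only: nrm_scale[OF g] power_mult_distrib N_def)
    then show ?thesis using N by (simp add: power2_eq_square)
  qed
  have "0 \<le> (nrm (f - (\<lambda>x. c * g x)))\<^sup>2" by simp
  also have "\<dots> = (nrm f)\<^sup>2 - (cmod (ip f g))\<^sup>2 / N"
    using nrm_diff_square[OF f m] 1 2 by simp
  finally have "(cmod (ip f g))\<^sup>2 \<le> (nrm f)\<^sup>2 * N" using N by (simp add: field_simps)
  then have "(cmod (ip f g))\<^sup>2 \<le> (nrm f * nrm g)\<^sup>2" by (simp add: N_def power_mult_distrib)
  then show ?thesis using f g by (auto intro: power2_le_imp_le)
qed

lemma nrm_triangle: assumes "f \<in> H" "g \<in> H" shows "nrm (f + g) \<le> nrm f + nrm g"
proof (rule power2_le_imp_le)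
  have "Re (ip f g) \<le> nrm f * nrm g"
    using Cauchy_Schwarz[OF assms] complex_Re_le_cmod[of "ip f g"] by linarith
  then show "(nrm (f + g))\<^sup>2 \<le> (nrm f + nrm g)\<^sup>2"
    using nrm_add_square[OF assms] by (simp add: power2_sum)
qed (use assms in auto)

lemma nrm_triangle_diff: assumes "f \<in> H" "g \<in> H" "h \<in> H" shows "nrm (f - h) \<le> nrm (f - g) + nrm (g - h)"
  using nrm_triangle[of "f - g" "g - h"] assms by auto

lemma tendsto_nrm: assumes "ip_tendsto ip f l F" "\<And>n. f n \<in> H" "l \<in> H"
  shows "((\<lambda>n. nrm (f n)) \<longlongrightarrow> nrm l) F"
proof -
  have "\<bar>nrm (f n) - nrm l\<bar> \<le> nrm (f n - l)" for n
    using nrm_triangle[OF mem_diff[OF assms(2)[of n] assms(3)] assms(3)]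
      nrm_triangle[OF mem_diff[OF assms(3) assms(2)[of n]] assms(2)[of n]]
      nrm_minus_commute[OF assms(3) assms(2)[of n]] by auto
  then have "((\<lambda>n. nrm (f n) - nrm l) \<longlongrightarrow> 0) F"
    using assms(1) unfolding ip_tendsto_def
    by (intro Lim_null_comparison[of "\<lambda>n. nrm (f n) - nrm l" "\<lambda>n. nrm (f n - l)"]) auto
  then show ?thesis by (simp add: LIM_zero_iff)
qed

lemma tendsto_ip: assumes "ip_tendsto ip f l F" "\<And>n. f n \<in> H" "l \<in> H" "h \<in> H"
  shows "((\<lambda>n. ip (f n) h) \<longlongrightarrow> ip l h) F"
proof -
  have "norm (ip (f n) h - ip l h) \<le> nrm (f n - l) * nrm h" for n
    using Cauchy_Schwarz[of "f n - l" h] assms diff_left[of "f n" l h] by auto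
  moreover have "((\<lambda>n. nrm (f n - l) * nrm h) \<longlongrightarrow> 0) F"
    using tendsto_mult_right[of _ 0 F "nrm h"] assms(1) unfolding ip_tendsto_def by fastforce
  ultimately have "((\<lambda>n. ip (f n) h - ip l h) \<longlongrightarrow> 0) F"
    by (intro Lim_null_comparison[of "\<lambda>n. ip (f n) h - ip l h" "\<lambda>n. nrm (f n - l) * nrm h"]) auto
  then show ?thesis by (simp add: LIM_zero_iff)
qed

definition closed_subspace :: "('a \<Rightarrow> complex) set \<Rightarrow> bool" where
  "closed_subspace M \<longleftrightarrow> M \<subseteq> H \<and> cfun.subspace M \<and>
     (\<forall>f g. (\<forall>n :: nat. f n \<in> M) \<and> g \<in> H \<and> ip_tendsto ip f g sequentially \<longrightarrow> g \<in> M)"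

text \<open>
  The point of \<open>M\<close> nearest to \<open>x\<close> exists because a minimising sequence is Cauchy, by the
  parallelogram law; minimality against \<open>p + c m\<close> is orthogonality.
\<close>
lemma projection_exists:
  assumes M: "closed_subspace M" and x: "x \<in> H"
  shows "\<exists>p\<in>M. \<forall>m\<in>M. ip (x - p) m = 0"
proof -
  have MH: "M \<subseteq> H" and Ms: "cfun.subspace M" using M by (auto simp: closed_subspace_def)
  have M0: "0 \<in> M" using cfun.subspace_0[OF Ms] .
  have Msc: "(\<lambda>x. c * m x) \<in> M" if "m \<in> M" for c m using cfun.subspace_scale[OF Ms that] .
  have Madd: "m + n \<in> M" if "m \<in> M" "n \<in> M" for m n using cfun.subspace_add[OF Ms that] .
  define d where "d = (INF m\<in>M. (nrm (x - m))\<^sup>2)"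
  have bdd: "bdd_below ((\<lambda>m. (nrm (x - m))\<^sup>2) ` M)" by (rule bdd_belowI[of _ 0]) auto
  have dle: "d \<le> (nrm (x - m))\<^sup>2" if "m \<in> M" for m
    unfolding d_def by (rule cINF_lower[OF bdd that])
  have "\<exists>m\<in>M. (nrm (x - m))\<^sup>2 < d + 1 / (real n + 1)" for n
  proof -
    have "d < d + 1 / (real n + 1)" by simp
    then show ?thesis unfolding d_def using M0 bdd by (subst (asm) cINF_less_iff) auto
  qed
  then obtain f where f: "\<And>n. f n \<in> M" "\<And>n. (nrm (x - f n))\<^sup>2 < d + 1 / (real n + 1)"
    by metis
  have fH: "f n \<in> H" for n using f MH by auto
  \<comment> \<open>The midpoint of two almost nearest points lies in \<open>M\<close>, hence is no nearer than the infimum \<open>d\<close>.\<close>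
  have para: "(nrm (f m - f n))\<^sup>2 \<le> 2 / (real m + 1) + 2 / (real n + 1)" for m n
  proof -
    define u where "u = x - f m"
    define v where "v = x - f n"
    have uv: "u \<in> H" "v \<in> H" using x fH by (auto simp: u_def v_def)
    define q where "q = (\<lambda>y. (1/2) * (f m + f n) y)"
    have q: "q \<in> M" unfolding q_def by (intro Msc Madd f)
    have "u + v = (\<lambda>y. 2 * (x - q) y)" by (auto simp: u_def v_def q_def fun_eq_iff field_simps)
    then have "nrm (u + v) = 2 * nrm (x - q)"
      using nrm_scale[of "x - q" 2] x q MH by auto
    then have "(nrm (u + v))\<^sup>2 = 4 * (nrm (x - q))\<^sup>2" by (simp add: power_mult_distrib)
    then have "4 * d \<le> (nrm (u + v))\<^sup>2" using dle[OF q] by simp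
    moreover have "(nrm (u + v))\<^sup>2 + (nrm (u - v))\<^sup>2 = 2 * (nrm u)\<^sup>2 + 2 * (nrm v)\<^sup>2"
      using nrm_add_square[OF uv] nrm_diff_square[OF uv] by simp
    moreover have "f m - f n = v - u" by (simp add: u_def v_def)
    ultimately show ?thesis
      using f(2)[of m] f(2)[of n] nrm_minus_commute[OF uv] by (auto simp: u_def v_def)
  qed
  have cauchy: "\<exists>N. \<forall>m\<ge>N. \<forall>n\<ge>N. nrm (f m - f n) < e" if "e > 0" for e
  proof -
    obtain N where N: "4 / e\<^sup>2 < real N" using reals_Archimedean2 by blast
    have "nrm (f m - f n) < e" if "m \<ge> N" "n \<ge> N" for m n
    proof (rule power2_less_imp_less)
      have N1: "4 / (real N + 1) < e\<^sup>2"
        using N \<open>e > 0\<close> by (simp add: field_simps) (smt (verit) zero_less_power)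
      have "2 / (real m + 1) \<le> 2 / (real N + 1)" "2 / (real n + 1) \<le> 2 / (real N + 1)"
        using that by (auto intro!: divide_left_mono)
      moreover have "4 / (real N + 1) = 2 / (real N + 1) + 2 / (real N + 1)" by simp
      ultimately show "(nrm (f m - f n))\<^sup>2 < e\<^sup>2" using para[of m n] N1 by linarith
    qed (use \<open>e > 0\<close> in auto)
    then show ?thesis by blast
  qed
  obtain p where p: "p \<in> H" "ip_tendsto ip f p sequentially"
    using Cauchy_converges[of f] fH cauchy by blast
  have pM: "p \<in> M" using M p f unfolding closed_subspace_def by blast
  have "ip_tendsto ip (\<lambda>n. x - f n) (x - p) sequentially"
  proof -
    have "nrm ((x - f n) - (x - p)) = nrm (f n - p)" for n
      using nrm_minus_commute[of "f n" p] fH p by (simp add: algebra_simps)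
    then show ?thesis using p(2) unfolding ip_tendsto_def by presburger
  qed
  then have "(\<lambda>n. (nrm (x - f n))\<^sup>2) \<longlonglongrightarrow> (nrm (x - p))\<^sup>2"
    by (intro tendsto_power tendsto_nrm) (use x fH p in auto)
  moreover have "(\<lambda>n. d + 1 / (real n + 1)) \<longlonglongrightarrow> d + 0"
    using LIMSEQ_inverse_real_of_nat by (intro tendsto_add) (auto simp: inverse_eq_divide add.commute)
  ultimately have "(nrm (x - p))\<^sup>2 \<le> d"
    using f(2) by (intro tendsto_le[of sequentially]) (auto intro!: always_eventually less_imp_le)
  then have dp: "(nrm (x - p))\<^sup>2 \<le> (nrm (x - m))\<^sup>2" if "m \<in> M" for m using dle[OF that] by simp
  have "ip (x - p) m = 0" if m: "m \<in> M" for m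
  proof (cases "m = 0")
    case True then show ?thesis using x p by (simp add: mem_diff)
  next
    case False
    have mH: "m \<in> H" using m MH by auto
    define N where "N = (nrm m)\<^sup>2"
    have N: "N > 0" using False nrm_eq_0[OF mH] by (simp add: N_def)
    define c where "c = ip (x - p) m / of_real N"
    have xp: "x - p \<in> H" using x p by auto
    have sc: "(\<lambda>y. c * m y) \<in> M" using Msc m by auto
    have eq: "x - (p + (\<lambda>y. c * m y)) = (x - p) - (\<lambda>y. c * m y)" by simp
    \<comment> \<open>The coefficient \<open>c\<close> is the one for which \<open>c m\<close> is the component of \<open>x - p\<close> along \<open>m\<close>.\<close>
    have "(nrm (x - p))\<^sup>2 \<le> (nrm ((x - p) - (\<lambda>y. c * m y)))\<^sup>2"
      using dp[OF Madd[OF pM sc]] by (simp only: eq)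
    also have "\<dots> = (nrm (x - p))\<^sup>2 - 2 * Re (ip (x - p) (\<lambda>y. c * m y)) + (nrm (\<lambda>y. c * m y))\<^sup>2"
      using xp sc MH by (intro nrm_diff_square) auto
    also have "Re (ip (x - p) (\<lambda>y. c * m y)) = (cmod (ip (x - p) m))\<^sup>2 / N"
      using scale_right[OF mH xp, of c]
      by (simp add: c_def complex_norm_square[symmetric] mult.commute flip: of_real_divide)
    also have "(nrm (\<lambda>y. c * m y))\<^sup>2 = (cmod (ip (x - p) m))\<^sup>2 / N"
    proof -
      have "cmod c = cmod (ip (x - p) m) / N" using N by (simp add: c_def norm_divide)
      then have "(nrm (\<lambda>y. c * m y))\<^sup>2 = (cmod (ip (x - p) m) / N)\<^sup>2 * N"
        by (simp only: nrm_scale[OF mH] power_mult_distrib N_def)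
      then show ?thesis using N by (simp add: power2_eq_square)
    qed
    finally have "(cmod (ip (x - p) m))\<^sup>2 / N \<le> 0" by linarith
    then show ?thesis using N by (simp add: divide_le_0_iff)
  qed
  then show ?thesis using pM by blast
qed

lemma seq_closure_closed:
  assumes S: "S \<subseteq> H" "cfun.subspace S"
  shows "closed_subspace {g\<in>H. \<exists>f. (\<forall>n::nat. f n \<in> S) \<and> ip_tendsto ip f g sequentially}"
    (is "closed_subspace ?C")
proof -
  have char: "g \<in> ?C \<longleftrightarrow> g \<in> H \<and> (\<forall>e>0. \<exists>s\<in>S. nrm (s - g) < e)" for g
  proof
    assume "g \<in> ?C"
    then obtain f where f: "\<And>n. f n \<in> S" "(\<lambda>n. nrm (f n - g)) \<longlonglongrightarrow> 0" "g \<in> H"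
      by (auto simp: ip_tendsto_def)
    have "\<exists>s\<in>S. nrm (s - g) < e" if "e > 0" for e
    proof -
      have "eventually (\<lambda>n. nrm (f n - g) < e) sequentially"
        using f(2) that by (auto intro: order_tendstoD)
      then show ?thesis using f(1) by (auto simp: eventually_sequentially)
    qed
    then show "g \<in> H \<and> (\<forall>e>0. \<exists>s\<in>S. nrm (s - g) < e)" using f by auto
  next
    assume *: "g \<in> H \<and> (\<forall>e>0. \<exists>s\<in>S. nrm (s - g) < e)"
    then have "\<forall>n. \<exists>s\<in>S. nrm (s - g) < inverse (real (Suc n))" by auto
    then obtain f where f: "\<And>n. f n \<in> S" "\<And>n. nrm (f n - g) < inverse (real (Suc n))" by metis
    have "(\<lambda>n. nrm (f n - g)) \<longlonglongrightarrow> 0"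
      using LIMSEQ_inverse_real_of_nat
    proof (rule Lim_null_comparison[rotated])
      have "f n - g \<in> H" for n using f S * by auto
      then show "\<forall>\<^sub>F n in sequentially. norm (nrm (f n - g)) \<le> inverse (real (Suc n))"
        using f(2) by (auto intro!: always_eventually less_imp_le simp del: of_nat_Suc)
    qed
    then show "g \<in> ?C" using * f by (auto simp: ip_tendsto_def)
  qed
  show ?thesis
    unfolding closed_subspace_def
  proof (intro conjI allI impI)
    show "?C \<subseteq> H" by auto
    show "cfun.subspace ?C"
    proof (rule cfun.subspaceI)
      show "0 \<in> ?C"
      proof -
        have "0 \<in> S" using cfun.subspace_0[OF S(2)] .
        then have "\<exists>s\<in>S. nrm (s - 0) < e" if "e > 0" for e
          using that by (intro bexI[of _ 0]) simp_all
        then show ?thesis unfolding char by simp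
      qed
    next
      fix f g assume fg: "f \<in> ?C" "g \<in> ?C"
      then have H: "f \<in> H" "g \<in> H" by auto
      have "\<exists>s\<in>S. nrm (s - (f + g)) < e" if e: "e > 0" for e
      proof -
        obtain s t where st: "s \<in> S" "t \<in> S" "nrm (s - f) < e/2" "nrm (t - g) < e/2"
          using fg e unfolding char by (meson half_gt_zero)
        have eq: "(s + t) - (f + g) = (s - f) + (t - g)" by simp
        have "nrm ((s + t) - (f + g)) < e"
          using nrm_triangle[OF mem_diff[OF subsetD[OF S(1) st(1)] H(1)] mem_diff[OF subsetD[OF S(1) st(2)] H(2)]] st
          unfolding eq by linarith
        then show ?thesis using cfun.subspace_add[OF S(2) st(1,2)] by blast
      qed
      then show "f + g \<in> ?C" unfolding char using H by auto
    next
      fix c f assume fg: "f \<in> ?C"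
      then have H: "f \<in> H" by auto
      have "\<exists>s\<in>S. nrm (s - (\<lambda>x. c * f x)) < e" if e: "e > 0" for e
      proof -
        obtain s where st: "s \<in> S" "nrm (s - f) < e/(cmod c + 1)"
          using fg e unfolding char by (metis add_nonneg_pos norm_ge_zero zero_less_divide_iff zero_less_one)
        have "(\<lambda>x. c * s x) - (\<lambda>x. c * f x) = (\<lambda>x. c * (s - f) x)" by (auto simp: fun_eq_iff algebra_simps)
        then have "nrm ((\<lambda>x. c * s x) - (\<lambda>x. c * f x)) = cmod c * nrm (s - f)"
          using nrm_scale[of "s - f" c] st H S by auto
        also have "\<dots> \<le> cmod c * (e/(cmod c + 1))"
          using st by (intro mult_left_mono) auto
        also have "\<dots> < e"
          using e by (simp add: field_simps add_pos_nonneg)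
        finally show ?thesis using cfun.subspace_scale[OF S(2) st(1)] by blast
      qed
      then show "(\<lambda>x. c * f x) \<in> ?C" unfolding char using H by auto
    qed
  next
    fix f :: "nat \<Rightarrow> 'a \<Rightarrow> complex" and g
    assume *: "(\<forall>n. f n \<in> ?C) \<and> g \<in> H \<and> ip_tendsto ip f g sequentially"
    then have fC: "f n \<in> ?C" for n by blast
    have fH: "f n \<in> H" for n using fC[of n] by simp
    have "\<exists>s\<in>S. nrm (s - g) < e" if e: "e > 0" for e
    proof -
      have "(\<lambda>n. nrm (f n - g)) \<longlonglongrightarrow> 0" using * by (simp add: ip_tendsto_def)
      then have "eventually (\<lambda>n. nrm (f n - g) < e/2) sequentially"
        by (rule order_tendstoD(2)) (use e in simp)
      then obtain n where n: "nrm (f n - g) < e/2" by (auto simp: eventually_sequentially)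
      obtain s where s: "s \<in> S" "nrm (s - f n) < e/2"
        using fC[of n] e unfolding char by (meson half_gt_zero)
      have "nrm (s - g) < e"
        using nrm_triangle_diff[of s "f n" g] s n fH S * by auto
      then show ?thesis using s by blast
    qed
    then show "g \<in> ?C" unfolding char using * by auto
  qed
qed

lemma dense_if_trivial_complement:
  assumes S: "S \<subseteq> H" "cfun.subspace S"
    and perp: "\<And>f. f \<in> H \<Longrightarrow> (\<And>s. s \<in> S \<Longrightarrow> ip f s = 0) \<Longrightarrow> f = 0"
    and g: "g \<in> H"
  shows "\<exists>f. (\<forall>n::nat. f n \<in> S) \<and> ip_tendsto ip f g sequentially"
proof -
  let ?C = "{g\<in>H. \<exists>f. (\<forall>n::nat. f n \<in> S) \<and> ip_tendsto ip f g sequentially}"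
  obtain p where p: "p \<in> ?C" "\<And>m. m \<in> ?C \<Longrightarrow> ip (g - p) m = 0"
    using projection_exists[OF seq_closure_closed[OF S] g] by blast
  have "s \<in> ?C" if "s \<in> S" for s
    using that S(1) by (auto intro!: exI[of _ "\<lambda>_. s"] simp: ip_tendsto_def)
  then have "g - p = 0" using perp[of "g - p"] p g by auto
  then show ?thesis using p by auto
qed

end

text \<open>
  In a finite-dimensional space the cardinality of orthonormal sets is bounded, and one of
  maximal cardinality must be a basis.
\<close>
lemma (in hilbert_fun) finite_dim_parseval:
  assumes R: "cfun.subspace R" "R \<subseteq> H" and B: "finite B" "R \<subseteq> cfun.span B"
  shows "\<exists>E. finite E \<and> E \<subseteq> R \<and> (\<forall>r\<in>R. (nrm r)\<^sup>2 = (\<Sum>e\<in>E. (cmod (ip r e))\<^sup>2))"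
proof -
  define ON where "ON E \<longleftrightarrow> E \<subseteq> R \<and> (\<forall>e\<in>E. \<forall>e'\<in>E. ip e e' = (if e = e' then 1 else 0))" for E
  have bound: "finite E \<and> card E \<le> card B" if E: "ON E" for E
  proof (rule cfun.independent_span_bound[OF B(1)])
    show "E \<subseteq> cfun.span B" using E B by (auto simp: ON_def)
    show "cfun.independent E"
      unfolding cfun.dependent_def
    proof
      assume "\<exists>a\<in>E. a \<in> cfun.span (E - {a})"
      then obtain a where a: "a \<in> E" "a \<in> cfun.span (E - {a})" by blast
      have aH: "a \<in> H" using a E R by (auto simp: ON_def)
      have "cfun.span (E - {a}) \<subseteq> {x \<in> H. ip x a = 0}"
      proof (rule cfun.span_minimal)
        show "E - {a} \<subseteq> {x \<in> H. ip x a = 0}" using E a R by (auto simp: ON_def)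
        show "cfun.subspace {x \<in> H. ip x a = 0}"
        proof (rule cfun.subspaceI)
          show "0 \<in> {x \<in> H. ip x a = 0}" using aH by simp
        next
          fix x y assume "x \<in> {x \<in> H. ip x a = 0}" "y \<in> {x \<in> H. ip x a = 0}"
          then show "x + y \<in> {x \<in> H. ip x a = 0}" using aH by (auto simp: add_left)
        next
          fix c x assume "x \<in> {x \<in> H. ip x a = 0}"
          then show "(\<lambda>u. c * x u) \<in> {x \<in> H. ip x a = 0}" using aH by (auto simp: scale_left)
        qed
      qed
      then have "ip a a = 0" using a by auto
      moreover have "ip a a = 1" using a E by (auto simp: ON_def)
      ultimately show False by simp
    qed
  qed
  have "\<exists>E. ON E \<and> (\<forall>E'. ON E' \<longrightarrow> card E' \<le> card E)"
    by (rule ex_has_greatest_nat[of ON "{}" card "Suc (card B)"])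
      (use bound in \<open>auto simp: le_imp_less_Suc, auto simp: ON_def\<close>)
  then obtain E where E: "ON E" "\<And>E'. ON E' \<Longrightarrow> card E' \<le> card E" by blast
  have finE: "finite E" and ER: "E \<subseteq> R" using bound[OF E(1)] E(1) by (auto simp: ON_def)
  have EH: "e \<in> H" if "e \<in> E" for e using that ER R by auto
  have on: "ip e e' = (if e = e' then 1 else 0)" if "e \<in> E" "e' \<in> E" for e e' using E(1) that by (auto simp: ON_def)
  have "(nrm r)\<^sup>2 = (\<Sum>e\<in>E. (cmod (ip r e))\<^sup>2)" if r: "r \<in> R" for r
  proof -
    have rH: "r \<in> H" using r R by auto
    define p where "p = (\<Sum>e\<in>E. (\<lambda>x. ip r e * e x))"
    have pR: "p \<in> R" unfolding p_def by (intro cfun.subspace_sum[OF R(1)] cfun.subspace_scale[OF R(1)]) (use ER in auto)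
    then have pH: "p \<in> H" using R by auto
    have pe: "ip p e = ip r e" if e: "e \<in> E" for e
    proof -
      have "ip p e = (\<Sum>e'\<in>E. ip (\<lambda>x. ip r e' * e' x) e)" unfolding p_def by (rule sum_left) (use EH e in auto)
      also have "\<dots> = (\<Sum>e'\<in>E. if e' = e then ip r e' else 0)"
        by (intro sum.cong refl) (simp add: scale_left EH e on)
      finally show ?thesis using e finE by simp
    qed
    have sR: "r - p \<in> R" by (rule cfun.subspace_diff[OF R(1) r pR])
    then have sH: "r - p \<in> H" using R by auto
    have se: "ip (r - p) e = 0" if "e \<in> E" for e using diff_left[OF rH pH EH[OF that]] pe[OF that] by simp
    have "r - p = 0"
    proof (rule ccontr)
      assume nz: "r - p \<noteq> 0"
      define N where "N = nrm (r - p)"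
      have N: "N > 0" using nz nrm_eq_0[OF sH] nrm_nonneg[OF sH] unfolding N_def by linarith
      define q where "q = (\<lambda>x. of_real (1 / N) * (r - p) x)"
      have qR: "q \<in> R" unfolding q_def by (rule cfun.subspace_scale[OF R(1) sR])
      then have qH: "q \<in> H" using R by auto
      have qe: "ip q e = 0" if "e \<in> E" for e unfolding q_def scale_left[OF sH EH[OF that]] se[OF that] by (rule mult_zero_right)
      have "ip q q = of_real ((nrm q)\<^sup>2)" by (rule ip_self[OF qH])
      also have "nrm q = 1" unfolding q_def using nrm_scale[OF sH, of "of_real (1 / N)"] N by (simp add: N_def norm_divide)
      finally have qq: "ip q q = 1" by simp
      have "q \<notin> E" using qe qq by force
      have eq: "ip e q = 0" if "e \<in> E" for e using commute[OF qH EH[OF that]] qe[OF that] by simp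
      have "ON (insert q E)" unfolding ON_def using qR ER qq qe eq on \<open>q \<notin> E\<close> by auto
      then have "card (insert q E) \<le> card E" by (rule E(2))
      then show False using \<open>q \<notin> E\<close> finE by simp
    qed
    then have rp: "r = p" by simp
    have "ip r r = (\<Sum>e\<in>E. ip r (\<lambda>x. ip r e * e x))"
    proof -
      have "ip r p = (\<Sum>e\<in>E. ip r (\<lambda>x. ip r e * e x))" unfolding p_def by (rule sum_right) (use EH rH in auto)
      then show ?thesis using rp by simp
    qed
    also have "\<dots> = (\<Sum>e\<in>E. of_real ((cmod (ip r e))\<^sup>2))"
    proof (intro sum.cong refl)
      fix e assume "e \<in> E"
      have "ip r (\<lambda>x. ip r e * e x) = cnj (ip r e) * ip r e" by (rule scale_right[OF EH[OF \<open>e \<in> E\<close>] rH])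
      then show "ip r (\<lambda>x. ip r e * e x) = of_real ((cmod (ip r e))\<^sup>2)"
        by (simp add: complex_norm_square mult.commute del: of_real_power)
    qed
    finally show ?thesis using nrm_square[OF rH] by simp
  qed
  then show ?thesis using finE ER by blast
qed

lemma (in hilbert_fun) polarization:
  assumes "f \<in> H" "g \<in> H"
  shows "ip f g = of_real (((nrm (f + g))\<^sup>2 - (nrm (f - g))\<^sup>2) / 4) +
    \<i> * of_real (((nrm (f + (\<lambda>x. \<i> * g x)))\<^sup>2 - (nrm (f - (\<lambda>x. \<i> * g x)))\<^sup>2) / 4)"
proof -
  have ig: "(\<lambda>x. \<i> * g x) \<in> H" using assms by auto
  have "ip f (\<lambda>x. \<i> * g x) = - \<i> * ip f g" using scale_right[OF assms(2,1), of \<i>] by simp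
  then have "Re (ip f (\<lambda>x. \<i> * g x)) = Im (ip f g)" by simp
  then show ?thesis
    using nrm_add_square[OF assms] nrm_diff_square[OF assms] nrm_add_square[OF assms(1) ig] nrm_diff_square[OF assms(1) ig]
    by (simp add: complex_eq_iff)
qed

sublocale rkhs \<subseteq> hilb: hilbert_fun H ip
  by unfold_locales (fact subspace ip_add ip_scale ip_commute ip_pos complete)+

context rkhs
begin

definition kfun :: "'a \<Rightarrow> 'a \<Rightarrow> complex" where "kfun w = (\<lambda>z. if z \<in> X then K z w else 0)"

lemma kfun_mem: "w \<in> X \<Longrightarrow> kfun w \<in> H" using kernel_mem[of w] by (simp add: kfun_def)
lemma ip_kfun: "f \<in> H \<Longrightarrow> w \<in> X \<Longrightarrow> ip f (kfun w) = f w" using reproducing[of f w] by (simp add: kfun_def)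
lemma ip_kfun_left: "f \<in> H \<Longrightarrow> w \<in> X \<Longrightarrow> ip (kfun w) f = cnj (f w)" 
  using ip_kfun[of f w] ip_commute[of f "kfun w"] kfun_mem[of w] by simp

lemma tendsto_pointwise:
  assumes "ip_tendsto ip f g F" "\<And>n. f n \<in> H" "g \<in> H" 
  shows "((\<lambda>n. f n z) \<longlongrightarrow> g z) F"
proof (cases "z \<in> X")
  case True
  then have "((\<lambda>n. ip (f n) (kfun z)) \<longlongrightarrow> ip g (kfun z)) F"
    using assms kfun_mem by (intro hilb.tendsto_ip) auto
  then show ?thesis using True assms by (simp add: ip_kfun)
qed (simp add: vanishes_outside assms)

lemma kernel_span_dense:
  assumes "g \<in> H"
  shows "\<exists>f. (\<forall>n::nat. f n \<in> cfun.span (kfun ` X)) \<and> ip_tendsto ip f g sequentially"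
proof (rule hilb.dense_if_trivial_complement[OF _ _ _ assms])
  show "cfun.span (kfun ` X) \<subseteq> H" by (rule cfun.span_minimal) (use kfun_mem subspace in auto)
  show "cfun.subspace (cfun.span (kfun ` X))" by (rule cfun.subspace_span)
  fix f assume f: "f \<in> H" "\<And>s. s \<in> cfun.span (kfun ` X) \<Longrightarrow> ip f s = 0"
  have "f x = 0" for x
  proof (cases "x \<in> X")
    case True
    then have "ip f (kfun x) = 0" by (intro f(2) cfun.span_base) auto
    then show ?thesis using ip_kfun[OF f(1) True] by simp
  qed (use f vanishes_outside in auto)
  then show "f = 0" by (auto simp: fun_eq_iff)
qed

end

text \<open>
  On the span of the kernel functions the two inner products agree, being determined by \<open>K\<close>. A
  sequence from the span that converges to \<open>f\<close> in one space is therefore Cauchy in the other, and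
  point evaluations show that its limit there is again \<open>f\<close>.
\<close>
lemma rkhs_norm_unique:
  assumes "rkhs X K H1 ip1" "rkhs X K H2 ip2" and f: "f \<in> H1"
  shows "f \<in> H2 \<and> ip_norm ip1 f = ip_norm ip2 f"
proof -
  interpret R1: rkhs X K H1 ip1 by fact
  interpret R2: rkhs X K H2 ip2 by fact
  define S where "S = cfun.span (R1.kfun ` X)"
  have S1: "S \<subseteq> H1" unfolding S_def by (rule cfun.span_minimal) (use R1.kfun_mem R1.subspace in auto)
  have S2: "S \<subseteq> H2" unfolding S_def by (rule cfun.span_minimal) (use R2.kfun_mem R2.subspace in auto)
  have ip_eq: "ip1 s t = ip2 s t" if s: "s \<in> S" and t: "t \<in> S" for s t
  proof -
    let ?T = "{t. t \<in> H1 \<and> t \<in> H2 \<and> ip1 s t = ip2 s t}"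
    have s12: "s \<in> H1" "s \<in> H2" using s S1 S2 by auto
    have "S \<subseteq> ?T" unfolding S_def
    proof (rule cfun.span_minimal)
      show "R1.kfun ` X \<subseteq> ?T"
        using R1.kfun_mem R2.kfun_mem R1.ip_kfun[OF s12(1)] R2.ip_kfun[OF s12(2)] by auto
      show "cfun.subspace ?T"
      proof (rule cfun.subspaceI)
        show "0 \<in> ?T" using s12 by simp
      next
        fix x y assume "x \<in> ?T" "y \<in> ?T"
        then show "x + y \<in> ?T" using s12 by (auto simp: R1.hilb.add_right R2.hilb.add_right)
      next
        fix c x assume "x \<in> ?T"
        then show "(\<lambda>u. c * x u) \<in> ?T" using s12
          by (auto simp: R1.hilb.scale_right R2.hilb.scale_right)
      qed
    qed
    then show ?thesis using t by auto
  qed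
  then have nrm_eq: "ip_norm ip1 s = ip_norm ip2 s" if "s \<in> S" for s
    using that by (simp add: ip_norm_def)
  obtain s where s: "\<And>n::nat. s n \<in> S" "ip_tendsto ip1 s f sequentially"
    using R1.kernel_span_dense[OF f] unfolding S_def by blast
  have sH: "s n \<in> H1" "s n \<in> H2" for n using s S1 S2 by auto
  have "\<exists>N. \<forall>m\<ge>N. \<forall>n\<ge>N. ip_norm ip2 (s m - s n) < e" if e: "e > 0" for e
  proof -
    have "\<forall>\<^sub>F n in sequentially. ip_norm ip1 (s n - f) < e / 2"
      by (rule order_tendstoD(2)[OF s(2)[unfolded ip_tendsto_def]]) (use e in simp)
    then obtain N where N: "\<And>n. n \<ge> N \<Longrightarrow> ip_norm ip1 (s n - f) < e / 2"
      by (auto simp: eventually_sequentially)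
    have "ip_norm ip2 (s m - s n) < e" if "m \<ge> N" "n \<ge> N" for m n
    proof -
      have "s m - s n \<in> S" unfolding S_def using s by (intro cfun.span_diff) (auto simp: S_def)
      then have "ip_norm ip2 (s m - s n) = ip_norm ip1 (s m - s n)" using nrm_eq by simp
      also have "\<dots> \<le> ip_norm ip1 (s m - f) + ip_norm ip1 (f - s n)"
        by (rule R1.hilb.nrm_triangle_diff[OF sH(1) f sH(1)])
      also have "ip_norm ip1 (f - s n) = ip_norm ip1 (s n - f)"
        by (rule R1.hilb.nrm_minus_commute[OF f sH(1)])
      finally show ?thesis using N[OF that(1)] N[OF that(2)] by linarith
    qed
    then show ?thesis by blast
  qed
  then obtain g where g: "g \<in> H2" "ip_tendsto ip2 s g sequentially"
    using R2.complete[of s] sH by blast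
  have "f z = g z" for z
    using LIMSEQ_unique[OF R1.tendsto_pointwise[OF s(2) sH(1) f] R2.tendsto_pointwise[OF g(2) sH(2) g(1)]] .
  then have fg: "f = g" by auto
  have "(\<lambda>n. ip_norm ip1 (s n)) \<longlonglongrightarrow> ip_norm ip1 f" by (rule R1.hilb.tendsto_nrm[OF s(2) sH(1) f])
  moreover have "(\<lambda>n. ip_norm ip1 (s n)) \<longlonglongrightarrow> ip_norm ip2 f"
    using R2.hilb.tendsto_nrm[OF g(2) sH(2) g(1)] nrm_eq[OF s(1)] by (simp add: fg)
  ultimately show ?thesis using LIMSEQ_unique g fg by blast
qed

lemma rkhs_unique:
  assumes 1: "rkhs X K H1 ip1" and 2: "rkhs X K H2 ip2"
  shows "H1 = H2" and "f \<in> H1 \<Longrightarrow> g \<in> H1 \<Longrightarrow> ip1 f g = ip2 f g"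
proof -
  interpret R1: rkhs X K H1 ip1 by fact
  interpret R2: rkhs X K H2 ip2 by fact
  note a = rkhs_norm_unique[OF 1 2] and b = rkhs_norm_unique[OF 2 1]
  show "H1 = H2" using a b by auto
  assume f: "f \<in> H1" and g: "g \<in> H1"
  have ig: "(\<lambda>x. \<i> * g x) \<in> H1" using g by (rule R1.hilb.mem_scale)
  have n: "ip_norm ip1 h = ip_norm ip2 h" if "h \<in> H1" for h using a[OF that] by simp
  show "ip1 f g = ip2 f g"
    using R1.hilb.polarization[OF f g] R2.hilb.polarization[of f g] a[OF f] a[OF g]
      n[OF R1.hilb.mem_add[OF f g]] n[OF R1.hilb.mem_diff[OF f g]]
      n[OF R1.hilb.mem_add[OF f ig]] n[OF R1.hilb.mem_diff[OF f ig]] by simp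
qed

section \<open>Weighted square-summable families\<close>

lemma infsum_small_tail:
  fixes g :: "'i \<Rightarrow> real"
  assumes g: "g summable_on UNIV" and e: "e > 0"
  shows "\<exists>B. finite B \<and> infsum g (-B) < e"
proof -
  obtain B where B: "finite B" "dist (sum g B) (infsum g UNIV) \<le> e / 2"
    using infsum_finite_approximation[OF g, of "e/2"] e by auto
  have "infsum g (B \<union> - B) = infsum g B + infsum g (- B)"
    by (rule infsum_Un_disjoint) (auto intro: summable_on_subset_banach[OF g])
  then have "infsum g UNIV = sum g B + infsum g (- B)" using B(1) by simp
  then have "infsum g (- B) < e" using B(2) e by (simp add: dist_real_def)
  then show ?thesis using B(1) by blast
qed

definition wl2 :: "('i \<Rightarrow> real) \<Rightarrow> ('i \<Rightarrow> complex) set" where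
  "wl2 w = {c. (\<lambda>i. w i * (cmod (c i))\<^sup>2) summable_on UNIV}"

definition wip :: "('i \<Rightarrow> real) \<Rightarrow> ('i \<Rightarrow> complex) \<Rightarrow> ('i \<Rightarrow> complex) \<Rightarrow> complex" where
  "wip w c d = (\<Sum>\<^sub>\<infinity>i. of_real (w i) * (c i * cnj (d i)))"

lemma wl2_mult_summable:
  assumes w: "\<And>i. w i \<ge> 0" and c: "c \<in> wl2 w" and d: "d \<in> wl2 w"
  shows "(\<lambda>i. of_real (w i) * (c i * cnj (d i))) summable_on UNIV"
proof -
  have "(\<lambda>i. w i * (cmod (c i))\<^sup>2 + w i * (cmod (d i))\<^sup>2) summable_on UNIV"
    using c d by (intro summable_on_add) (auto simp: wl2_def)
  then have "(\<lambda>i. norm (of_real (w i) * (c i * cnj (d i)))) summable_on UNIV"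
  proof (rule summable_on_comparison_test)
    fix i
    have "2 * (cmod (c i) * cmod (d i)) \<le> (cmod (c i))\<^sup>2 + (cmod (d i))\<^sup>2"
      using sum_squares_bound[of "cmod (c i)" "cmod (d i)"] by simp
    then have "cmod (c i) * cmod (d i) \<le> (cmod (c i))\<^sup>2 + (cmod (d i))\<^sup>2"
      using zero_le_power2[of "cmod (c i)"] zero_le_power2[of "cmod (d i)"] mult_nonneg_nonneg[of "cmod (c i)" "cmod (d i)"]
      by linarith
    then show "norm (of_real (w i) * (c i * cnj (d i))) \<le> w i * (cmod (c i))\<^sup>2 + w i * (cmod (d i))\<^sup>2"
      using w[of i] mult_left_mono[of "cmod (c i) * cmod (d i)" "(cmod (c i))\<^sup>2 + (cmod (d i))\<^sup>2" "w i"]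
      by (simp add: norm_mult distrib_left)
  qed auto
  then show ?thesis by (rule abs_summable_summable)
qed

lemma wip_self: 
  assumes c: "c \<in> wl2 w"
  shows "wip w c c = of_real (\<Sum>\<^sub>\<infinity>i. w i * (cmod (c i))\<^sup>2)"
proof -
  have "wip w c c = (\<Sum>\<^sub>\<infinity>i. of_real (w i * (cmod (c i))\<^sup>2))"
    unfolding wip_def by (intro infsum_cong) (simp only: of_real_mult complex_norm_square)
  also have "\<dots> = of_real (\<Sum>\<^sub>\<infinity>i. w i * (cmod (c i))\<^sup>2)"
    by (rule infsumI, rule has_sum_of_real) (use c in \<open>simp add: wl2_def\<close>)
  finally show ?thesis .
qed

lemma wip_norm_square:
  assumes w: "\<And>i. w i \<ge> 0" and c: "c \<in> wl2 w"
  shows "(ip_norm (wip w) c)\<^sup>2 = (\<Sum>\<^sub>\<infinity>i. w i * (cmod (c i))\<^sup>2)"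
  using wip_self[OF c] infsum_nonneg[of UNIV "\<lambda>i. w i * (cmod (c i))\<^sup>2"] w
  by (simp add: ip_norm_def)

lemma wl2_scale: "c \<in> wl2 w \<Longrightarrow> (\<lambda>i. a * c i) \<in> wl2 w"
  using summable_on_cmult_right[of "\<lambda>i. w i * (cmod (c i))\<^sup>2" UNIV "(cmod a)\<^sup>2"]
  by (simp add: wl2_def norm_mult power_mult_distrib mult_ac)

lemma wl2_add:
  assumes w: "\<And>i. w i \<ge> 0" and c: "c \<in> wl2 w" and d: "d \<in> wl2 w"
  shows "c + d \<in> wl2 w"
proof -
  have "(\<lambda>i. 2 * (w i * (cmod (c i))\<^sup>2) + 2 * (w i * (cmod (d i))\<^sup>2)) summable_on UNIV"
    using c d by (intro summable_on_add summable_on_cmult_right) (auto simp: wl2_def)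
  then have "(\<lambda>i. w i * (cmod ((c + d) i))\<^sup>2) summable_on UNIV"
  proof (rule summable_on_comparison_test)
    fix i
    have "(cmod (c i + d i))\<^sup>2 \<le> (cmod (c i) + cmod (d i))\<^sup>2"
      by (intro power_mono norm_triangle_ineq) auto
    also have "\<dots> \<le> 2 * (cmod (c i))\<^sup>2 + 2 * (cmod (d i))\<^sup>2"
      using sum_squares_bound[of "cmod (c i)" "cmod (d i)"] by (simp add: power2_sum)
    finally show "w i * (cmod ((c + d) i))\<^sup>2 \<le> 2 * (w i * (cmod (c i))\<^sup>2) + 2 * (w i * (cmod (d i))\<^sup>2)"
      using w[of i] mult_left_mono[of "(cmod (c i + d i))\<^sup>2" _ "w i"] by (fastforce simp: distrib_left mult_ac)
  qed (use w in auto)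
  then show ?thesis by (simp add: wl2_def)
qed

lemma wl2_minus:
  assumes w: "\<And>i. w i \<ge> 0" and c: "c \<in> wl2 w" and d: "d \<in> wl2 w"
  shows "c - d \<in> wl2 w"
proof -
  have "c - d = c + (\<lambda>i. (-1) * d i)" by (auto simp: fun_eq_iff)
  then show ?thesis using wl2_add[OF w c wl2_scale[OF d, of "-1"]] by (simp only:)
qed

text \<open>
  Completeness: a Cauchy sequence converges coordinatewise, and bounds on finite partial sums
  pass to the limit.
\<close>
lemma hilbert_fun_wl2:
  assumes w: "\<And>i. w i > 0"
  shows "hilbert_fun (wl2 w) (wip w)"
proof -
  have w0: "w i \<ge> 0" for i using w[of i] by simp
  have le: "sqrt (w i) * cmod (c i) \<le> ip_norm (wip w) c" if "c \<in> wl2 w" for c i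
  proof -
    have "(\<Sum>j\<in>{i}. w j * (cmod (c j))\<^sup>2) \<le> (\<Sum>\<^sub>\<infinity>i. w i * (cmod (c i))\<^sup>2)"
      using that w0 by (intro finite_sum_le_infsum) (auto simp: wl2_def)
    then have "(sqrt (w i) * cmod (c i))\<^sup>2 \<le> (ip_norm (wip w) c)\<^sup>2"
      using w0 by (simp add: wip_norm_square[OF w0 that] power_mult_distrib)
    then show ?thesis
      by (rule power2_le_imp_le)
        (use wip_self[OF that] infsum_nonneg[of UNIV "\<lambda>i. w i * (cmod (c i))\<^sup>2"] w0 in \<open>simp add: ip_norm_def\<close>)
  qed
  show ?thesis
  proof
    show "cfun.subspace (wl2 w)"
    proof (rule cfun.subspaceI)
      show "0 \<in> wl2 w" by (simp add: wl2_def)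
    qed (fact wl2_add[OF w0] wl2_scale)+
  next
    fix f g h assume *: "f \<in> wl2 w" "g \<in> wl2 w" "h \<in> wl2 w"
    show "wip w (f + g) h = wip w f h + wip w g h"
      unfolding wip_def using wl2_mult_summable[OF w0 *(1,3)] wl2_mult_summable[OF w0 *(2,3)]
      by (subst infsum_add[symmetric]) (auto simp: algebra_simps)
  next
    fix c f g assume *: "f \<in> wl2 w" "g \<in> wl2 w"
    show "wip w (\<lambda>x. c * f x) g = c * wip w f g"
      unfolding wip_def by (subst infsum_cmult_right'[symmetric]) (auto simp: mult_ac)
  next
    fix f g
    show "wip w g f = cnj (wip w f g)"
      unfolding wip_def infsum_cnj[symmetric] by (simp add: mult_ac)
  next
    fix f assume *: "f \<in> wl2 w" "f \<noteq> 0"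
    then obtain i where i: "f i \<noteq> 0" by (auto simp: fun_eq_iff)
    then have "0 < (sqrt (w i) * cmod (f i))\<^sup>2" using w[of i] by simp
    also have "\<dots> \<le> (ip_norm (wip w) f)\<^sup>2" using le[OF *(1), of i] w0[of i] by (intro power_mono) auto
    finally show "0 < Re (wip w f f)"
      by (simp only: wip_norm_square[OF w0 *(1)] wip_self[OF *(1)] Re_complex_of_real)
  next
    fix f :: "nat \<Rightarrow> 'a \<Rightarrow> complex"
    assume f: "\<And>n. f n \<in> wl2 w"
      and cauchy: "\<And>e. e > 0 \<Longrightarrow> \<exists>N. \<forall>m\<ge>N. \<forall>n\<ge>N. ip_norm (wip w) (f m - f n) < e"
    have fd: "f m - f n \<in> wl2 w" for m n using wl2_minus[OF w0 f f] .
    have "Cauchy (\<lambda>n. f n i)" for i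
    proof (rule CauchyI)
      fix e :: real assume e: "e > 0"
      then obtain N where N: "\<And>m n. m \<ge> N \<Longrightarrow> n \<ge> N \<Longrightarrow> ip_norm (wip w) (f m - f n) < sqrt (w i) * e"
        using cauchy[of "sqrt (w i) * e"] w[of i] by auto
      have "norm (f m i - f n i) < e" if "m \<ge> N" "n \<ge> N" for m n
        using le[OF fd[of m n], of i] N[OF that] w[of i]
      proof -
        have "sqrt (w i) * cmod (f m i - f n i) < sqrt (w i) * e"
          using le[OF fd[of m n], of i] N[OF that] by simp
        then show ?thesis using w[of i] by simp
      qed
      then show "\<exists>M. \<forall>m\<ge>M. \<forall>n\<ge>M. norm (f m i - f n i) < e" by blast
    qed
    then obtain g where g: "\<And>i. (\<lambda>n. f n i) \<longlonglongrightarrow> g i"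
      unfolding Cauchy_convergent_iff convergent_def by metis
    have fin: "(\<Sum>i\<in>A. w i * (cmod (f m i - g i))\<^sup>2) \<le> e\<^sup>2"
      if "finite A" "\<And>n. n \<ge> N \<Longrightarrow> ip_norm (wip w) (f m - f n) < e" for A m N e
    proof (rule tendsto_le[OF _ tendsto_const])
      show "(\<lambda>n. \<Sum>i\<in>A. w i * (cmod (f m i - f n i))\<^sup>2) \<longlonglongrightarrow> (\<Sum>i\<in>A. w i * (cmod (f m i - g i))\<^sup>2)"
        by (intro tendsto_intros g)
      have "(\<Sum>i\<in>A. w i * (cmod (f m i - f n i))\<^sup>2) \<le> e\<^sup>2" if "n \<ge> N" for n
      proof -
        have "(\<Sum>i\<in>A. w i * (cmod ((f m - f n) i))\<^sup>2) \<le> (ip_norm (wip w) (f m - f n))\<^sup>2"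
          unfolding wip_norm_square[OF w0 fd]
          using fd[of m n] w0 \<open>finite A\<close> by (intro finite_sum_le_infsum) (auto simp: wl2_def)
        also have "\<dots> \<le> e\<^sup>2"
          using that(1) \<open>\<And>n. n \<ge> N \<Longrightarrow> ip_norm (wip w) (f m - f n) < e\<close>[of n] 
            wip_self[OF fd[of m n]] infsum_nonneg[of UNIV "\<lambda>i. w i * (cmod ((f m - f n) i))\<^sup>2"] w0
          by (intro power_mono) (auto simp: ip_norm_def)
        finally show ?thesis by simp
      qed
      then show "\<forall>\<^sub>F n in sequentially. (\<Sum>i\<in>A. w i * (cmod (f m i - f n i))\<^sup>2) \<le> e\<^sup>2"
        by (auto simp: eventually_sequentially)
    qed auto
    have summ: "f m - g \<in> wl2 w \<and> ip_norm (wip w) (f m - g) \<le> e"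
      if "\<And>n. n \<ge> N \<Longrightarrow> ip_norm (wip w) (f m - f n) < e" "e > 0" for m N e
    proof -
      have a: "f m - g \<in> wl2 w"
        unfolding wl2_def mem_Collect_eq
        by (rule nonneg_bdd_above_summable_on) (use fin[OF _ that(1)] w0 in \<open>auto intro!: bdd_aboveI[of _ "e\<^sup>2"]\<close>)
      then have "(ip_norm (wip w) (f m - g))\<^sup>2 \<le> e\<^sup>2"
        unfolding wip_norm_square[OF w0 a]
        by (intro infsum_le_finite_sums) (use fin[OF _ that(1)] a in \<open>auto simp: wl2_def\<close>)
      then show ?thesis using a that(2) by (auto intro: power2_le_imp_le)
    qed
    obtain N where "\<forall>m\<ge>N. \<forall>n\<ge>N. ip_norm (wip w) (f m - f n) < 1" using cauchy[of 1] by auto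
    then have "f N - g \<in> wl2 w" using summ[of N N 1] by auto
    then have gm: "g \<in> wl2 w" using wl2_minus[OF w0 f[of N], of "f N - g"] by simp
    have "(\<lambda>m. ip_norm (wip w) (f m - g)) \<longlonglongrightarrow> 0"
    proof (rule LIMSEQ_I)
      fix e :: real assume e: "e > 0"
      then obtain N where N: "\<forall>m\<ge>N. \<forall>n\<ge>N. ip_norm (wip w) (f m - f n) < e/2"
        using cauchy[of "e/2"] by auto
      have "norm (ip_norm (wip w) (f m - g) - 0) < e" if "m \<ge> N" for m
      proof -
        have "f m - g \<in> wl2 w" "ip_norm (wip w) (f m - g) \<le> e/2" using summ[of N m "e/2"] N that e by auto
        moreover have "0 \<le> ip_norm (wip w) (f m - g)"
          using wip_self[OF \<open>f m - g \<in> wl2 w\<close>] infsum_nonneg[of UNIV "\<lambda>i. w i * (cmod ((f m - g) i))\<^sup>2"] w0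
          by (simp add: ip_norm_def)
        ultimately show ?thesis using e by simp
      qed
      then show "\<exists>no. \<forall>m\<ge>no. norm (ip_norm (wip w) (f m - g) - 0) < e" by blast
    qed
    then show "\<exists>g\<in>wl2 w. ip_tendsto (wip w) f g sequentially"
      using gm by (auto simp: ip_tendsto_def)
  qed
qed

text \<open>
  The unit multi-indices are written \<open>axis i 1\<close>; this keeps the simplifier from changing that form.
\<close>
declare One_nat_def [simp del]

section \<open>The coefficients of the Dirichlet kernel\<close>

abbreviation (input) dir_a :: "nat \<Rightarrow> real" where "dir_a n \<equiv> 1 / (real n + 1)"

lemma dirichlet_b_0 [simp]: "dirichlet_b 0 = 0"
  by (simp add: dirichlet_b_def)

lemma dirichlet_b_conv: "(\<Sum>j\<le>n. dirichlet_b j * dir_a (n - j)) = dir_a n - (if n = 0 then 1 else 0)"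
proof -
  define A where "A = Abs_fps dir_a"
  have "fps_nth A 0 \<noteq> 0" by (simp add: A_def)
  then have "(1 - inverse A) * A = A - 1" by (simp add: left_diff_distrib inverse_mult_eq_1)
  then have "fps_nth ((1 - inverse A) * A) n = fps_nth (A - 1) n" by simp
  then show ?thesis
    unfolding fps_mult_nth by (simp add: A_def dirichlet_b_def atLeast0AtMost)
qed

text \<open>
  Kaluza's lemma: \<open>b\<^sub>n \<ge> 0\<close> because \<open>a\<^sub>n = 1/(n+1)\<close> is log-convex. Multiply the recursion for \<open>a\<^sub>m\<close> by
  \<open>a\<^sub>m\<^sub>+\<^sub>1 / a\<^sub>m\<close> and compare it termwise with the recursion for \<open>a\<^sub>m\<^sub>+\<^sub>1\<close>; the ratios \<open>a\<^sub>k\<^sub>+\<^sub>1 / a\<^sub>k\<close>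
  increase, so what is left over, which is \<open>b\<^sub>m\<^sub>+\<^sub>1\<close>, cannot be negative.
\<close>
lemma dirichlet_b_nonneg: "dirichlet_b n \<ge> 0"
proof (induction n rule: less_induct)
  case (less n)
  show ?case
  proof (cases n)
    case 0 then show ?thesis by simp
  next
    case (Suc m)
    show ?thesis
    proof (cases "m = 0")
      case True
      then show ?thesis using dirichlet_b_conv[of "Suc 0"] Suc by simp
    next
      case False
      have "(\<Sum>j\<le>m. dirichlet_b j * dir_a (Suc m - j)) \<le> (\<Sum>j\<le>m. dirichlet_b j * (dir_a (m - j) * ((real m + 1) / (real m + 2))))"
      proof (intro sum_mono mult_left_mono)
        fix j assume j: "j \<in> {..m}"
        define k where "k = m - j"
        have k: "Suc m - j = Suc k" "k \<le> m" using j by (auto simp: k_def Suc_diff_le)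
        have "(real k + 1) / (real k + 2) \<le> (real m + 1) / (real m + 2)"
          using k(2) by (simp add: field_simps)
        then have "dir_a k * ((real k + 1) / (real k + 2)) \<le> dir_a k * ((real m + 1) / (real m + 2))"
          by (intro mult_left_mono) auto
        then show "dir_a (Suc m - j) \<le> dir_a (m - j) * ((real m + 1) / (real m + 2))"
          unfolding k(1) k_def[symmetric] by (simp add: add_ac)
        show "0 \<le> dirichlet_b j" using less Suc j by simp
      qed
      also have "\<dots> = (\<Sum>j\<le>m. dirichlet_b j * dir_a (m - j)) * ((real m + 1) / (real m + 2))"
        by (simp only: sum_distrib_right mult.assoc)
      also have "\<dots> = dir_a m * ((real m + 1) / (real m + 2))"
        by (subst dirichlet_b_conv) (use False in simp)
      also have "\<dots> = dir_a (Suc m)" by (simp add: field_simps)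
      finally show ?thesis using dirichlet_b_conv[of "Suc m"] Suc by simp
    qed
  qed
qed

lemma dirichlet_b_le_1: "dirichlet_b n \<le> 1"
proof (cases "n = 0")
  case False
  have "dirichlet_b n * dir_a (n - n) \<le> (\<Sum>j\<le>n. dirichlet_b j * dir_a (n - j))"
    by (rule member_le_sum) (auto simp: dirichlet_b_nonneg)
  then have "dirichlet_b n \<le> dir_a n" using dirichlet_b_conv[of n] False by simp
  also have "\<dots> \<le> 1" by simp
  finally show ?thesis .
qed auto

section \<open>Multi-indices\<close>

lemma finite_bounded_mi: "finite {\<alpha> :: nat ^ 'd::finite. \<forall>i. \<alpha> $ i \<le> \<beta> $ i}"
proof (rule finite_subset)
  show "{\<alpha> :: nat ^ 'd. \<forall>i. \<alpha> $ i \<le> \<beta> $ i} \<subseteq> vec_lambda ` (PiE UNIV (\<lambda>i. {..\<beta> $ i}))"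
  proof
    fix \<alpha> :: "nat ^ 'd" assume "\<alpha> \<in> {\<alpha>. \<forall>i. \<alpha> $ i \<le> \<beta> $ i}"
    then have "(\<lambda>i. \<alpha> $ i) \<in> PiE UNIV (\<lambda>i. {..\<beta> $ i})" "\<alpha> = vec_lambda (\<lambda>i. \<alpha> $ i)" by auto
    then show "\<alpha> \<in> vec_lambda ` (PiE UNIV (\<lambda>i. {..\<beta> $ i}))" by blast
  qed
qed (auto intro!: finite_imageI finite_PiE)

lemma le_mi_size: "\<alpha> $ i \<le> mi_size (\<alpha> :: nat ^ 'd::finite)"
  unfolding mi_size_def by (rule member_le_sum) auto

lemma finite_mi_size [simp]: "finite {\<alpha> :: nat ^ 'd::finite. mi_size \<alpha> = n}"
  by (rule finite_subset[OF _ finite_bounded_mi[of "\<chi> i. n"]]) (auto simp: le_mi_size)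

lemma mi_size_add [simp]: "mi_size (\<alpha> + \<beta>) = mi_size \<alpha> + mi_size (\<beta> :: nat ^ 'd::finite)"
  by (simp add: mi_size_def sum.distrib)
lemma mi_size_axis [simp]: "mi_size (axis i n :: nat ^ 'd::finite) = n"
  by (simp add: mi_size_def axis_def)
lemma mi_size_0 [simp]: "mi_size (0 :: nat ^ 'd::finite) = 0"
  by (simp add: mi_size_def)
lemma mi_size_eq_0: "mi_size \<alpha> = 0 \<longleftrightarrow> \<alpha> = (0 :: nat ^ 'd::finite)"
  by (auto simp: mi_size_def vec_eq_iff)
lemma mi_fact_0 [simp]: "mi_fact (0 :: nat ^ 'd::finite) = 1"
  by (simp add: mi_fact_def)
lemma mi_fact_pos [simp]: "mi_fact (\<alpha> :: nat ^ 'd::finite) > 0"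
  by (simp add: mi_fact_def prod_pos)
lemma mi_fact_neq_0 [simp]: "mi_fact (\<alpha> :: nat ^ 'd::finite) \<noteq> 0"
  using mi_fact_pos[of \<alpha>] by linarith
lemma mi_monom_0 [simp]: "mi_monom (0 :: nat ^ 'd::finite) z = 1"
  by (simp add: mi_monom_def)
lemma mi_monom_add: "mi_monom (\<alpha> + \<beta>) z = mi_monom \<alpha> z * mi_monom (\<beta> :: nat ^ 'd::finite) z"
  by (simp add: mi_monom_def power_add prod.distrib)
lemma mi_monom_axis [simp]: "mi_monom (axis i n) z = (z :: complex ^ 'd::finite) $ i ^ n"
proof -
  have "mi_monom (axis i n) z = (\<Prod>j\<in>{i}. z $ j ^ n)"
    unfolding mi_monom_def by (rule prod.mono_neutral_cong_right) (auto simp: axis_def)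
  then show ?thesis by simp
qed

lemma mi_fact_add_axis: "mi_fact (\<alpha> + axis i 1) = (\<alpha> $ i + 1) * mi_fact (\<alpha> :: nat ^ 'd::finite)"
proof -
  have "mi_fact (\<alpha> + axis i 1) = fact (\<alpha> $ i + 1) * (\<Prod>j\<in>UNIV - {i}. fact (\<alpha> $ j))"
    unfolding mi_fact_def by (subst prod.remove[of _ i]) (auto simp: axis_def One_nat_def)
  moreover have "mi_fact \<alpha> = fact (\<alpha> $ i) * (\<Prod>j\<in>UNIV - {i}. fact (\<alpha> $ j))"
    unfolding mi_fact_def by (subst prod.remove[of _ i]) auto
  ultimately show ?thesis by (simp add: algebra_simps One_nat_def)
qed

definition multinom :: "nat ^ 'd::finite \<Rightarrow> real" where
  "multinom \<alpha> = fact (mi_size \<alpha>) / real (mi_fact \<alpha>)"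

lemma multinom_pos [simp]: "multinom (\<alpha> :: nat ^ 'd::finite) > 0"
  by (simp add: multinom_def)
lemma multinom_nonneg [simp]: "multinom (\<alpha> :: nat ^ 'd::finite) \<ge> 0"
  using multinom_pos[of \<alpha>] by (rule less_imp_le)
lemma multinom_0 [simp]: "multinom (0 :: nat ^ 'd::finite) = 1"
  by (simp add: multinom_def)
lemma multinom_add_axis: "(real (\<alpha> $ i) + 1) * multinom (\<alpha> + axis i 1) = (real (mi_size \<alpha>) + 1) * multinom (\<alpha> :: nat ^ 'd::finite)"
proof -
  have "(real (\<alpha> $ i) + 1) * multinom (\<alpha> + axis i 1) =
      (real (\<alpha> $ i) + 1) * (fact (mi_size \<alpha> + 1) / ((real (\<alpha> $ i) + 1) * real (mi_fact \<alpha>)))"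
    unfolding multinom_def mi_fact_add_axis by simp
  also have "\<dots> = fact (mi_size \<alpha> + 1) / real (mi_fact \<alpha>)" by simp
  also have "\<dots> = (real (mi_size \<alpha>) + 1) * multinom \<alpha>" by (simp add: multinom_def One_nat_def)
  finally show ?thesis .
qed

lemma axis_diff_add: "\<alpha> $ i > 0 \<Longrightarrow> \<alpha> - axis i 1 + axis i 1 = (\<alpha> :: nat ^ 'd::finite)"
  by (auto simp: vec_eq_iff axis_def)

text \<open>
  Pascal's rule for multinomial coefficients, summed against an arbitrary function: each
  coefficient of size \<open>n + 1\<close> is the sum of its predecessors of size \<open>n\<close>. The multinomial theorem and
  the Vandermonde convolution are both inductions on it.
\<close>
lemma sum_multinom_Suc:
  fixes f :: "nat ^ 'd::finite \<Rightarrow> 'b::real_algebra_1"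
  shows "(\<Sum>\<alpha> | mi_size \<alpha> = Suc n. of_real (multinom \<alpha>) * f \<alpha>) =
    (\<Sum>\<alpha> | mi_size \<alpha> = n. of_real (multinom \<alpha>) * (\<Sum>i\<in>UNIV. f (\<alpha> + axis i 1)))"
proof -
  have "(\<Sum>\<alpha> | mi_size \<alpha> = Suc n. of_real (multinom \<alpha>) * f \<alpha>) =
      (\<Sum>\<alpha> | mi_size \<alpha> = Suc n. \<Sum>i\<in>UNIV. of_real (real (\<alpha> $ i) / (real n + 1) * multinom \<alpha>) * f \<alpha>)"
  proof (intro sum.cong refl)
    fix \<alpha> :: "nat ^ 'd" assume "\<alpha> \<in> {\<alpha>. mi_size \<alpha> = Suc n}"
    then have "(\<Sum>i\<in>UNIV. real (\<alpha> $ i)) = real n + 1" by (simp add: mi_size_def flip: of_nat_sum)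
    then have "multinom \<alpha> = (\<Sum>i\<in>UNIV. real (\<alpha> $ i) / (real n + 1) * multinom \<alpha>)"
      by (simp flip: sum_distrib_right sum_divide_distrib)
    then show "of_real (multinom \<alpha>) * f \<alpha> = (\<Sum>i\<in>UNIV. of_real (real (\<alpha> $ i) / (real n + 1) * multinom \<alpha>) * f \<alpha>)"
      by (metis (no_types) of_real_sum sum_distrib_right)
  qed
  also have "\<dots> = (\<Sum>i\<in>UNIV. \<Sum>\<alpha> | mi_size \<alpha> = Suc n. of_real (real (\<alpha> $ i) / (real n + 1) * multinom \<alpha>) * f \<alpha>)"
    by (rule sum.swap)
  also have "\<dots> = (\<Sum>i\<in>UNIV. \<Sum>\<alpha> | mi_size \<alpha> = n. of_real (multinom \<alpha>) * f (\<alpha> + axis i 1))"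
  proof (rule sum.cong[OF refl])
    fix i :: 'd
    have "(\<Sum>\<alpha> | mi_size \<alpha> = Suc n. of_real (real (\<alpha> $ i) / (real n + 1) * multinom \<alpha>) * f \<alpha>) =
      (\<Sum>\<alpha> | mi_size \<alpha> = Suc n \<and> \<alpha> $ i > 0. of_real (real (\<alpha> $ i) / (real n + 1) * multinom \<alpha>) * f \<alpha>)"
      by (rule sum.mono_neutral_right) auto
    also have "\<dots> = (\<Sum>\<alpha> | mi_size \<alpha> = n. of_real (multinom \<alpha>) * f (\<alpha> + axis i 1))"
    proof (rule sum.reindex_bij_witness[of _ "\<lambda>\<alpha>. \<alpha> + axis i 1" "\<lambda>\<alpha>. \<alpha> - axis i 1"])
      fix \<alpha> :: "nat ^ 'd" assume a: "\<alpha> \<in> {\<alpha>. mi_size \<alpha> = Suc n \<and> \<alpha> $ i > 0}"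
      show eq: "\<alpha> - axis i 1 + axis i 1 = \<alpha>" using a by (simp add: axis_diff_add)
      have "mi_size (\<alpha> - axis i 1 + axis i 1) = Suc n" using a unfolding eq by simp
      then show s: "\<alpha> - axis i 1 \<in> {\<alpha>. mi_size \<alpha> = n}" by simp
      have "real ((\<alpha> - axis i 1) $ i) + 1 = real (\<alpha> $ i)" using a by (simp add: axis_def)
      then have "real (\<alpha> $ i) * multinom \<alpha> = (real n + 1) * multinom (\<alpha> - axis i 1)"
        using multinom_add_axis[of "\<alpha> - axis i 1" i] s unfolding eq by simp
      then have "real (\<alpha> $ i) / (real n + 1) * multinom \<alpha> = multinom (\<alpha> - axis i 1)" by (simp add: field_simps)
      then show "of_real (multinom (\<alpha> - axis i 1)) * f (\<alpha> - axis i 1 + axis i 1) =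
         of_real (real (\<alpha> $ i) / (real n + 1) * multinom \<alpha>) * f \<alpha>" unfolding eq by simp
    next
      fix \<alpha> :: "nat ^ 'd" assume "\<alpha> \<in> {\<alpha>. mi_size \<alpha> = n}"
      then show "\<alpha> + axis i 1 \<in> {\<alpha>. mi_size \<alpha> = Suc n \<and> 0 < \<alpha> $ i}"
        by simp
    qed (auto simp: vec_eq_iff)
    finally show "(\<Sum>\<alpha> | mi_size \<alpha> = Suc n. of_real (real (\<alpha> $ i) / (real n + 1) * multinom \<alpha>) * f \<alpha>) =
       (\<Sum>\<alpha> | mi_size \<alpha> = n. of_real (multinom \<alpha>) * f (\<alpha> + axis i 1))" .
  qed
  also have "\<dots> = (\<Sum>\<alpha> | mi_size \<alpha> = n. of_real (multinom \<alpha>) * (\<Sum>i\<in>UNIV. f (\<alpha> + axis i 1)))"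
    by (subst sum.swap) (simp add: sum_distrib_left)
  finally show ?thesis .
qed

lemma mi_size_0_set: "{\<alpha> :: nat ^ 'd::finite. mi_size \<alpha> = 0} = {0}"
  by (auto simp: mi_size_eq_0)

lemma multinomial_theorem:
  fixes x :: "'d::finite \<Rightarrow> 'b::{real_algebra_1,comm_ring_1}"
  shows "(\<Sum>i\<in>UNIV. x i) ^ n = (\<Sum>\<alpha> | mi_size \<alpha> = n. of_real (multinom \<alpha>) * (\<Prod>i\<in>UNIV. x i ^ (\<alpha> $ i)))"
proof (induction n)
  case 0 then show ?case by (simp add: mi_size_0_set)
next
  case (Suc n)
  have *: "(\<Prod>j\<in>UNIV. x j ^ ((\<alpha> + axis i 1) $ j)) = x i * (\<Prod>j\<in>UNIV. x j ^ (\<alpha> $ j))" for i and \<alpha> :: "nat ^ 'd"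
  proof -
    have "(\<Prod>j\<in>UNIV. x j ^ (axis i 1 $ j)) = (\<Prod>j\<in>{i}. x j)"
      by (rule prod.mono_neutral_cong_right) (auto simp: axis_def)
    then show ?thesis by (simp add: power_add prod.distrib)
  qed
  show ?case
    unfolding sum_multinom_Suc * sum_distrib_right[symmetric] power_Suc Suc
    by (simp add: sum_distrib_left mult_ac)
qed

lemma multinom_vandermonde:
  assumes "j + k = mi_size (\<beta> :: nat ^ 'd::finite)"
  shows "(\<Sum>\<alpha> | mi_size \<alpha> = j. multinom \<alpha> * (if \<forall>i. \<alpha> $ i \<le> \<beta> $ i then multinom (\<beta> - \<alpha>) else 0)) = multinom \<beta>"
  using assms
proof (induction j arbitrary: k)
  case 0 then show ?case by (simp add: mi_size_0_set)
next
  case (Suc j)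
  define f where "f \<alpha> = (if \<forall>i. \<alpha> $ i \<le> \<beta> $ i then multinom (\<beta> - \<alpha>) else 0)" for \<alpha>
  have "(\<Sum>\<alpha> | mi_size \<alpha> = Suc j. multinom \<alpha> * f \<alpha>) =
      (\<Sum>\<alpha> | mi_size \<alpha> = j. multinom \<alpha> * (\<Sum>i\<in>UNIV. f (\<alpha> + axis i 1)))"
    using sum_multinom_Suc[where n = j and f = f] by simp
  also have "\<dots> = (\<Sum>\<alpha> | mi_size \<alpha> = j. multinom \<alpha> * f \<alpha>)"
  proof (intro sum.cong refl arg_cong2[where f="(*)"])
    fix \<alpha> :: "nat ^ 'd" assume a: "\<alpha> \<in> {\<alpha>. mi_size \<alpha> = j}"
    show "(\<Sum>i\<in>UNIV. f (\<alpha> + axis i 1)) = f \<alpha>"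
    proof (cases "\<forall>i. \<alpha> $ i \<le> \<beta> $ i")
      case False
      then obtain i where i: "\<not> \<alpha> $ i \<le> \<beta> $ i" by blast
      have "f (\<alpha> + axis i' 1) = 0" for i'
      proof -
        have "\<not> (\<alpha> + axis i' 1) $ i \<le> \<beta> $ i" using i by simp
        then show ?thesis unfolding f_def by auto
      qed
      then have "(\<Sum>i\<in>UNIV. f (\<alpha> + axis i 1)) = 0" by simp
      moreover have "f \<alpha> = 0" using False unfolding f_def by auto
      ultimately show ?thesis by simp
    next
      case True
      define \<gamma> where "\<gamma> = \<beta> - \<alpha>"
      have b: "\<beta> = \<alpha> + \<gamma>" using True by (auto simp: \<gamma>_def vec_eq_iff)
      have "mi_size \<gamma> = Suc k" using Suc.prems a unfolding b by simp
      have "f (\<alpha> + axis i 1) = real (\<gamma> $ i) / (real k + 1) * multinom \<gamma>" for i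
      proof (cases "\<gamma> $ i = 0")
        case True
        then have "\<not> (\<alpha> + axis i 1) $ i \<le> \<beta> $ i" by (simp add: b)
        then have "\<not> (\<forall>l. (\<alpha> + axis i 1) $ l \<le> \<beta> $ l)" by blast
        then have "f (\<alpha> + axis i 1) = 0" unfolding f_def by (rule if_not_P)
        then show ?thesis using True by simp
      next
        case False
        have eq: "\<gamma> - axis i 1 + axis i 1 = \<gamma>" using False by (intro axis_diff_add) simp
        have "mi_size (\<gamma> - axis i 1 + axis i 1) = Suc k" unfolding eq by fact
        then have s: "mi_size (\<gamma> - axis i 1) = k" by simp
        have le: "\<forall>l. (\<alpha> + axis i 1) $ l \<le> \<beta> $ l" using False by (auto simp: b axis_def)
        have "\<beta> - (\<alpha> + axis i 1) = \<gamma> - axis i 1" by (auto simp: b vec_eq_iff)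
        then have "f (\<alpha> + axis i 1) = multinom (\<gamma> - axis i 1)" using le by (simp add: f_def)
        moreover have "real (\<gamma> $ i) * multinom \<gamma> = (real k + 1) * multinom (\<gamma> - axis i 1)"
          using multinom_add_axis[of "\<gamma> - axis i 1" i] s False unfolding eq by (simp add: axis_def)
        ultimately show ?thesis by (simp add: field_simps)
      qed
      then have "(\<Sum>i\<in>UNIV. f (\<alpha> + axis i 1)) = (\<Sum>i\<in>UNIV. real (\<gamma> $ i)) / (real k + 1) * multinom \<gamma>"
        by (simp add: sum_distrib_right sum_divide_distrib)
      also have "(\<Sum>i\<in>UNIV. real (\<gamma> $ i)) = real k + 1"
        using \<open>mi_size \<gamma> = Suc k\<close> by (simp add: mi_size_def flip: of_nat_sum)
      finally show ?thesis using True by (simp add: f_def \<gamma>_def)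
    qed
  qed
  also have "\<dots> = multinom \<beta>" unfolding f_def using Suc.IH[of "Suc k"] Suc.prems by simp
  finally show ?case unfolding f_def .
qed

section \<open>The weights of the Dirichlet module\<close>

text \<open>
  The squared norm of \<open>z\<^sup>\<alpha>\<close> in the Dirichlet module.
\<close>
definition wt :: "nat ^ 'd::finite \<Rightarrow> real" where
  "wt \<alpha> = (real (mi_size \<alpha>) + 1) / multinom \<alpha>"

lemma wt_pos [simp]: "wt (\<alpha> :: nat ^ 'd::finite) > 0"
  by (simp add: wt_def)
lemma wt_nonneg [simp]: "wt (\<alpha> :: nat ^ 'd::finite) \<ge> 0"
  using wt_pos[of \<alpha>] by linarith
lemma wt_neq_0 [simp]: "wt (\<alpha> :: nat ^ 'd::finite) \<noteq> 0"
  using wt_pos[of \<alpha>] by linarith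
lemma wt_0 [simp]: "wt (0 :: nat ^ 'd::finite) = 1"
  by (simp add: wt_def)

lemma multinom_add_axis_ge: "multinom \<alpha> \<le> multinom (\<alpha> + axis i 1 :: nat ^ 'd::finite)"
proof -
  have "(real (\<alpha> $ i) + 1) * multinom \<alpha> \<le> (real (mi_size \<alpha>) + 1) * multinom \<alpha>"
    using le_mi_size[of \<alpha> i] by (intro mult_right_mono) auto
  then show ?thesis unfolding multinom_add_axis[symmetric, of _ i] by (simp add: mult_le_cancel_left)
qed

lemma mi_induct [case_names zero add]:
  fixes \<alpha> :: "nat ^ 'd::finite"
  assumes "P 0" "\<And>\<alpha> i. P \<alpha> \<Longrightarrow> P (\<alpha> + axis i 1)"
  shows "P \<alpha>"
proof (induction "mi_size \<alpha>" arbitrary: \<alpha>)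
  case 0 then show ?case using assms(1) mi_size_eq_0[of \<alpha>] by simp
next
  case (Suc n)
  then have "\<alpha> \<noteq> 0" by auto
  then obtain i where "\<alpha> $ i > 0" by (auto simp: vec_eq_iff)
  then have eq: "\<alpha> - axis i 1 + axis i 1 = \<alpha>" by (rule axis_diff_add)
  then have "mi_size (\<alpha> - axis i 1 + axis i 1) = Suc n" using Suc by simp
  then have "n = mi_size (\<alpha> - axis i 1)" by simp
  then have "P (\<alpha> - axis i 1 + axis i 1)" by (intro assms(2) Suc.hyps(1))
  then show ?case unfolding eq .
qed

lemma multinom_add_ge: "multinom \<alpha> \<le> multinom (\<alpha> + \<beta> :: nat ^ 'd::finite)"
proof (induction \<beta> rule: mi_induct)
  case (add \<beta> i)
  then show ?case using multinom_add_axis_ge[of "\<alpha> + \<beta>" i] by (simp add: add.assoc)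
qed simp

text \<open>
  Boundedness of multiplication by \<open>z\<^sup>\<beta>\<close>, read off the weights.
\<close>
lemma wt_add_le: "wt (\<alpha> + \<beta> :: nat ^ 'd::finite) \<le> (real (mi_size \<beta>) + 1) * wt \<alpha>"
proof -
  have "wt (\<alpha> + \<beta>) \<le> (real (mi_size \<alpha> + mi_size \<beta>) + 1) / multinom \<alpha>"
    unfolding wt_def mi_size_add by (intro divide_left_mono multinom_add_ge) auto
  also have "real (mi_size \<alpha> + mi_size \<beta>) + 1 \<le> (real (mi_size \<beta>) + 1) * (real (mi_size \<alpha>) + 1)"
    by (simp add: algebra_simps)
  finally show ?thesis unfolding wt_def by (simp add: divide_right_mono)
qed

text \<open>
  The summand is the eigenvalue of \<open>b\<^sub>\<alpha> M\<^sup>\<alpha> (M\<^sup>\<alpha>)\<^sup>*\<close> on \<open>z\<^sup>\<beta>\<close>. Sorted by \<open>|\<alpha>|\<close>, the multinomial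
  coefficients add up by Vandermonde's convolution, and the identity becomes the one between the
  coefficients of \<open>(1 - 1/K) K = K - 1\<close>.
\<close>
lemma dirichlet_b_weight_sum:
  fixes \<beta> :: "nat ^ 'd::finite"
  assumes "\<beta> \<noteq> 0"
  shows "(\<Sum>\<alpha> | (\<forall>i. \<alpha> $ i \<le> \<beta> $ i). dirichlet_b_mi \<alpha> * (wt \<beta> / wt (\<beta> - \<alpha>))) = 1"
proof -
  define n where "n = mi_size \<beta>"
  have n: "n \<noteq> 0" using assms by (simp add: n_def mi_size_eq_0)
  have fin: "finite {\<alpha> :: nat ^ 'd. \<forall>i. \<alpha> $ i \<le> \<beta> $ i}" by (rule finite_bounded_mi)
  have le: "mi_size \<alpha> \<le> n \<and> mi_size (\<beta> - \<alpha>) = n - mi_size \<alpha>" if "\<forall>i. \<alpha> $ i \<le> \<beta> $ i" for \<alpha>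
  proof -
    have "\<beta> = \<alpha> + (\<beta> - \<alpha>)" using that by (auto simp: vec_eq_iff)
    then have "n = mi_size \<alpha> + mi_size (\<beta> - \<alpha>)" unfolding n_def by (metis mi_size_add)
    then show ?thesis by simp
  qed
  have "(\<Sum>\<alpha> | (\<forall>i. \<alpha> $ i \<le> \<beta> $ i). dirichlet_b_mi \<alpha> / wt (\<beta> - \<alpha>)) =
     (\<Sum>j\<le>n. \<Sum>\<alpha> | (\<forall>i. \<alpha> $ i \<le> \<beta> $ i) \<and> mi_size \<alpha> = j. dirichlet_b_mi \<alpha> / wt (\<beta> - \<alpha>))"
    using le by (subst sum.group[OF fin, where g = mi_size and T="{..n}", symmetric]) auto
  also have "\<dots> = (\<Sum>j\<le>n. dirichlet_b j * dir_a (n - j) * multinom \<beta>)"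
  proof (intro sum.cong refl)
    fix j assume j: "j \<in> {..n}"
    have "(\<Sum>\<alpha> | (\<forall>i. \<alpha> $ i \<le> \<beta> $ i) \<and> mi_size \<alpha> = j. dirichlet_b_mi \<alpha> / wt (\<beta> - \<alpha>)) =
      (\<Sum>\<alpha> | (\<forall>i. \<alpha> $ i \<le> \<beta> $ i) \<and> mi_size \<alpha> = j. dirichlet_b j * dir_a (n - j) * (multinom \<alpha> * multinom (\<beta> - \<alpha>)))"
      using le by (intro sum.cong refl) (auto simp: dirichlet_b_mi_def multinom_def wt_def field_simps)
    also have "\<dots> = dirichlet_b j * dir_a (n - j) * 
        (\<Sum>\<alpha> | (\<forall>i. \<alpha> $ i \<le> \<beta> $ i) \<and> mi_size \<alpha> = j. multinom \<alpha> * multinom (\<beta> - \<alpha>))"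
      by (simp add: sum_distrib_left)
    also have "(\<Sum>\<alpha> | (\<forall>i. \<alpha> $ i \<le> \<beta> $ i) \<and> mi_size \<alpha> = j. multinom \<alpha> * multinom (\<beta> - \<alpha>)) =
       (\<Sum>\<alpha> | mi_size \<alpha> = j. multinom \<alpha> * (if \<forall>i. \<alpha> $ i \<le> \<beta> $ i then multinom (\<beta> - \<alpha>) else 0))"
      by (rule sum.mono_neutral_cong_left) auto
    also have "\<dots> = multinom \<beta>" using j by (intro multinom_vandermonde[of j "n - j"]) (auto simp: n_def)
    finally show "(\<Sum>\<alpha> | (\<forall>i. \<alpha> $ i \<le> \<beta> $ i) \<and> mi_size \<alpha> = j. dirichlet_b_mi \<alpha> / wt (\<beta> - \<alpha>)) =
      dirichlet_b j * dir_a (n - j) * multinom \<beta>" .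
  qed
  also have "\<dots> = (\<Sum>j\<le>n. dirichlet_b j * dir_a (n - j)) * multinom \<beta>" by (simp only: sum_distrib_right)
  also have "\<dots> = 1 / wt \<beta>" unfolding dirichlet_b_conv using n by (simp add: wt_def n_def)
  finally have "(\<Sum>\<alpha> | (\<forall>i. \<alpha> $ i \<le> \<beta> $ i). dirichlet_b_mi \<alpha> / wt (\<beta> - \<alpha>)) * wt \<beta> = 1" by simp
  then show ?thesis by (simp add: sum_distrib_right)
qed

declare One_nat_def [simp]

section \<open>Power series on the ball\<close>

lemma has_sum_fibres:
  fixes f :: "'a \<Rightarrow> complex"
  assumes S: "(f has_sum S) A" and g: "\<And>k. (f has_sum g k) {x\<in>A. h x = k}"
  shows "(g has_sum S) UNIV"
proof (rule has_sum_SigmaD)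
  show "((\<lambda>p. f (snd p)) has_sum S) (Sigma UNIV (\<lambda>k. {x\<in>A. h x = k}))"
  proof (subst has_sum_reindex_bij_witness[of A snd "\<lambda>x. (h x, x)" _ _ f S S, symmetric])
  qed (use S in auto)
  show "((\<lambda>y. f (snd (k, y))) has_sum g k) {x\<in>A. h x = k}" for k using g by simp
qed

lemma powser_zero_imp_coeff_zero:
  fixes a :: "nat \<Rightarrow> complex"
  assumes "\<And>x. norm x < 1 \<Longrightarrow> (\<lambda>n. a n * x ^ n) sums 0"
  shows "a n = 0"
proof (rule ccontr)
  assume an: "a n \<noteq> 0"
  have "(\<lambda>n. a n * 0 ^ n) sums 0" using assms[of 0] by simp
  then have "a 0 = 0" using powser_sums_zero_iff[of a 0] by simp
  then have n: "n > 0" using an by (cases n) auto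
  show False
  proof (rule powser_0_nonzero[of 1 0 a "\<lambda>_. 0" n])
    fix s :: real assume s: "0 < s" "\<And>z. z \<in> cball 0 s - {0::complex} \<Longrightarrow> (0::complex) \<noteq> 0"
    have "of_real s \<in> cball 0 s - {0::complex}" using s(1) by simp
    then show False using s(2) by blast
  qed (use assms an n in auto)
qed

text \<open>
  Separate the variables one at a time: scaling the \<open>i\<close>-th coordinate turns the series into a power
  series in one variable, so the part with a prescribed exponent of \<open>z\<^sub>i\<close> vanishes by itself. When
  all exponents are prescribed, only the term \<open>c \<gamma> z\<^sup>\<gamma>\<close> is left.
\<close>
lemma mi_power_series_unique:
  fixes c :: "nat ^ 'd::finite \<Rightarrow> complex"
  assumes c: "\<And>z. z \<in> ball 0 1 \<Longrightarrow> ((\<lambda>\<alpha>. c \<alpha> * mi_monom \<alpha> z) has_sum 0) UNIV"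
  shows "c \<gamma> = 0"
proof -
  have "\<forall>z\<in>ball 0 1. ((\<lambda>\<alpha>. c \<alpha> * mi_monom \<alpha> z) has_sum 0) {\<alpha>. \<forall>i\<in>J. \<alpha> $ i = \<gamma> $ i}"
    if "finite J" for J :: "'d set"
    using that
  proof (induction J)
    case empty then show ?case using c by simp
  next
    case (insert i J)
    define A where "A = {\<alpha> :: nat ^ 'd. \<forall>i\<in>J. \<alpha> $ i = \<gamma> $ i}"
    show ?case
    proof
      fix z :: "complex ^ 'd" assume z: "z \<in> ball 0 1"
      define p where "p k = (\<Sum>\<^sub>\<infinity>\<alpha>\<in>{\<alpha>\<in>A. \<alpha> $ i = k}. c \<alpha> * mi_monom \<alpha> z)" for k
      have p: "((\<lambda>\<alpha>. c \<alpha> * mi_monom \<alpha> z) has_sum p k) {\<alpha>\<in>A. \<alpha> $ i = k}" for k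
        unfolding p_def
        by (rule has_sum_infsum, rule summable_on_subset_banach[OF has_sum_imp_summable[OF c[OF z]]]) auto
      have "(\<lambda>n. p n * x ^ n) sums 0" if x: "norm x < 1" for x
      proof -
        define y where "y = (\<chi> j. if j = i then x * z $ j else z $ j)"
        have "norm y \<le> norm z" unfolding norm_vec_def
        proof (rule L2_set_mono)
          fix j
          show "norm (y $ j) \<le> norm (z $ j)"
            using x mult_right_mono[of "norm x" 1 "norm (z $ j)"] by (auto simp: y_def norm_mult)
        qed simp
        then have y: "y \<in> ball 0 1" using z by simp
        have mono: "mi_monom \<alpha> y = x ^ (\<alpha> $ i) * mi_monom \<alpha> z" for \<alpha>
        proof -
          have "mi_monom \<alpha> y = y $ i ^ (\<alpha> $ i) * (\<Prod>j\<in>UNIV - {i}. y $ j ^ (\<alpha> $ j))"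
            unfolding mi_monom_def by (subst prod.remove[of _ i]) auto
          moreover have "mi_monom \<alpha> z = z $ i ^ (\<alpha> $ i) * (\<Prod>j\<in>UNIV - {i}. z $ j ^ (\<alpha> $ j))"
            unfolding mi_monom_def by (subst prod.remove[of _ i]) auto
          ultimately show ?thesis by (simp add: y_def power_mult_distrib mult_ac)
        qed
        have "((\<lambda>\<alpha>. c \<alpha> * mi_monom \<alpha> y) has_sum 0) A" using insert.IH y by (simp add: A_def)
        moreover have "((\<lambda>\<alpha>. c \<alpha> * mi_monom \<alpha> y) has_sum (p k * x ^ k)) {\<alpha>\<in>A. \<alpha> $ i = k}" for k
          using has_sum_cmult_left[OF p[of k], of "x ^ k"]
          by (rule has_sum_cong[THEN iffD1, rotated]) (auto simp: mono mult_ac)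
        ultimately have "((\<lambda>k. p k * x ^ k) has_sum 0) UNIV" by (rule has_sum_fibres)
        then show ?thesis by (rule has_sum_imp_sums)
      qed
      then have "p (\<gamma> $ i) = 0" by (rule powser_zero_imp_coeff_zero)
      moreover have "{\<alpha>\<in>A. \<alpha> $ i = \<gamma> $ i} = {\<alpha>. \<forall>i\<in>insert i J. \<alpha> $ i = \<gamma> $ i}" by (auto simp: A_def)
      ultimately show "((\<lambda>\<alpha>. c \<alpha> * mi_monom \<alpha> z) has_sum 0) {\<alpha>. \<forall>i\<in>insert i J. \<alpha> $ i = \<gamma> $ i}"
        using p[of "\<gamma> $ i"] by simp
    qed
  qed
  from this[of UNIV]
  have "\<forall>z\<in>ball 0 1. ((\<lambda>\<alpha>. c \<alpha> * mi_monom \<alpha> z) has_sum 0) {\<alpha>. \<forall>i\<in>UNIV. \<alpha> $ i = \<gamma> $ i}" by simp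
  moreover have "{\<alpha>. \<forall>i\<in>UNIV. \<alpha> $ i = \<gamma> $ i} = {\<gamma>}" by (auto simp: vec_eq_iff)
  ultimately have *: "((\<lambda>\<alpha>. c \<alpha> * mi_monom \<alpha> z) has_sum 0) {\<gamma>}" if "z \<in> ball 0 1" for z
    using that by simp
  \<comment> \<open>Any point of the ball with nonzero coordinates will do.\<close>
  define N where "N = real CARD('d) + 1"
  define z :: "complex ^ 'd" where "z = (\<chi> i. of_real (1 / N))"
  have "norm z \<le> (\<Sum>i\<in>UNIV. norm (z $ i))" unfolding norm_vec_def by (rule L2_set_le_sum) simp
  also have "\<dots> = real CARD('d) / N"
  proof -
    have "norm (z $ i) = 1 / N" for i
      by (simp add: z_def N_def norm_of_real del: of_real_divide)
    then show ?thesis by simp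
  qed
  also have "\<dots> < 1" by (simp add: N_def)
  finally have "z \<in> ball 0 1" by simp
  from *[OF this] have "c \<gamma> * mi_monom \<gamma> z = 0" by (simp add: has_sum_finite_iff)
  moreover have "mi_monom \<gamma> z \<noteq> 0" by (simp add: mi_monom_def z_def N_def) (simp add: complex_eq_iff)
  ultimately show ?thesis by simp
qed

lemma hdot_power:
  "hdot z w ^ n = (\<Sum>\<alpha> | mi_size \<alpha> = n. of_real (multinom \<alpha>) * (mi_monom \<alpha> z * cnj (mi_monom \<alpha> (w :: complex ^ 'd::finite))))"
  unfolding hdot_def multinomial_theorem
  by (simp add: mi_monom_def power_mult_distrib prod.distrib)

lemma sum_norm_mult_less_1:
  assumes "z \<in> ball 0 1" "w \<in> ball 0 (1::real)"
  shows "(\<Sum>i\<in>UNIV. norm (z $ i) * norm (w $ i)) < (1::real)"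
    and "norm (hdot z (w :: complex ^ 'd::finite)) < 1"
proof -
  have "(\<Sum>i\<in>UNIV. \<bar>norm (z $ i)\<bar> * \<bar>norm (w $ i)\<bar>) \<le> norm z * norm w"
    unfolding norm_vec_def by (rule L2_set_mult_ineq)
  also have "\<dots> < 1"
    using assms mult_strict_mono'[of "norm z" 1 "norm w" 1] by simp
  finally show *: "(\<Sum>i\<in>UNIV. norm (z $ i) * norm (w $ i)) < (1::real)" by simp
  have "norm (hdot z w) \<le> (\<Sum>i\<in>UNIV. norm (z $ i * cnj (w $ i)))" unfolding hdot_def by (rule norm_sum)
  with * show "norm (hdot z w) < 1" by (simp add: norm_mult)
qed

text \<open>
  By the multinomial theorem the multi-index series, grouped by size, is the series in \<open>\<langle>z,w\<rangle>\<close>. Absolute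
  convergence comes from the same expansion of a power of \<open>\<Sum> |z\<^sub>i| |w\<^sub>i| < 1\<close>. It is applied to the
  coefficients of \<open>K\<close> and to those of \<open>1 - 1/K\<close>.
\<close>
lemma hdot_series:
  fixes z w :: "complex ^ 'd::finite"
  assumes z: "z \<in> ball 0 1" and w: "w \<in> ball 0 1" and a: "\<And>n. \<bar>a n\<bar> \<le> 1"
  shows "(\<lambda>\<alpha>. norm (of_real (a (mi_size \<alpha>) * multinom \<alpha>) * (mi_monom \<alpha> z * cnj (mi_monom \<alpha> w)) :: complex)) summable_on UNIV" (is "(\<lambda>\<alpha>. norm (?f \<alpha>)) summable_on _")
    and "((\<lambda>\<alpha>. of_real (a (mi_size \<alpha>) * multinom \<alpha>) * (mi_monom \<alpha> z * cnj (mi_monom \<alpha> w)))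
      has_sum (\<Sum>n. of_real (a n) * hdot z w ^ n)) UNIV"
    and "summable (\<lambda>n. norm (of_real (a n) * hdot z w ^ n))"
proof -
  define q where "q = (\<Sum>i\<in>UNIV. norm (z $ i) * norm (w $ i))"
  have q: "0 \<le> q" "q < 1" using sum_norm_mult_less_1[OF z w] by (auto simp: q_def intro: sum_nonneg)
  have nf: "norm (?f \<alpha>) \<le> multinom \<alpha> * (\<Prod>i\<in>UNIV. (norm (z $ i) * norm (w $ i)) ^ (\<alpha> $ i))" for \<alpha>
    using a[of "mi_size \<alpha>"] mult_left_le_one_le[of "multinom \<alpha> * (\<Prod>i\<in>UNIV. (norm (z $ i) * norm (w $ i)) ^ (\<alpha> $ i))" "\<bar>a (mi_size \<alpha>)\<bar>"]
    by (simp add: norm_mult mi_monom_def prod_norm[symmetric] norm_power power_mult_distrib prod.distrib abs_mult mult.assoc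
         prod_nonneg)
  show abs: "(\<lambda>\<alpha>. norm (?f \<alpha>)) summable_on UNIV"
  proof (rule nonneg_bdd_above_summable_on)
    show "bdd_above (sum (\<lambda>\<alpha>. norm (?f \<alpha>)) ` {F. F \<subseteq> UNIV \<and> finite F})"
    proof (rule bdd_aboveI2)
      fix F :: "(nat ^ 'd) set" assume "F \<in> {F. F \<subseteq> UNIV \<and> finite F}"
      then have F: "finite F" by simp
      define N where "N = Max (insert 0 (mi_size ` F))"
      have N: "mi_size \<alpha> \<le> N" if "\<alpha> \<in> F" for \<alpha> using that F by (auto simp: N_def)
      have "(\<Sum>\<alpha>\<in>F. norm (?f \<alpha>)) \<le> (\<Sum>\<alpha>\<in>F. multinom \<alpha> * (\<Prod>i\<in>UNIV. (norm (z $ i) * norm (w $ i)) ^ (\<alpha> $ i)))"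
        by (intro sum_mono nf)
      also have "\<dots> = (\<Sum>n\<le>N. \<Sum>\<alpha> | \<alpha> \<in> F \<and> mi_size \<alpha> = n. multinom \<alpha> * (\<Prod>i\<in>UNIV. (norm (z $ i) * norm (w $ i)) ^ (\<alpha> $ i)))"
        using N by (subst sum.group[OF F, where g = mi_size and T = "{..N}", symmetric]) auto
      also have "\<dots> \<le> (\<Sum>n\<le>N. q ^ n)"
      proof (rule sum_mono)
        fix n
        have "(\<Sum>\<alpha> | \<alpha> \<in> F \<and> mi_size \<alpha> = n. multinom \<alpha> * (\<Prod>i\<in>UNIV. (norm (z $ i) * norm (w $ i)) ^ (\<alpha> $ i)))
          \<le> (\<Sum>\<alpha> | mi_size \<alpha> = n. multinom \<alpha> * (\<Prod>i\<in>UNIV. (norm (z $ i) * norm (w $ i)) ^ (\<alpha> $ i)))"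
          by (rule sum_mono2) (auto intro!: mult_nonneg_nonneg prod_nonneg)
        also have "\<dots> = q ^ n" unfolding q_def multinomial_theorem by simp
        finally show "(\<Sum>\<alpha> | \<alpha> \<in> F \<and> mi_size \<alpha> = n. multinom \<alpha> * (\<Prod>i\<in>UNIV. (norm (z $ i) * norm (w $ i)) ^ (\<alpha> $ i))) \<le> q ^ n" .
      qed
      also have "\<dots> \<le> (\<Sum>n. q ^ n)" using q by (intro sum_le_suminf summable_geometric) auto
      finally show "(\<Sum>\<alpha>\<in>F. norm (?f \<alpha>)) \<le> (\<Sum>n. q ^ n)" .
    qed
  qed simp
  show "summable (\<lambda>n. norm (of_real (a n) * hdot z w ^ n))"
  proof (rule summable_comparison_test'[OF summable_geometric[of "norm (hdot z w)"]])
    show "norm (norm (of_real (a n) * hdot z w ^ n)) \<le> norm (hdot z w) ^ n" for n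
      using a[of n] mult_left_le_one_le[of "norm (hdot z w) ^ n" "\<bar>a n\<bar>"] by (simp add: norm_mult norm_power)
  qed (use sum_norm_mult_less_1(2)[OF z w] in simp)
  have f: "(?f has_sum infsum ?f UNIV) UNIV" using abs_summable_summable[OF abs] by simp
  have "((\<lambda>n. of_real (a n) * hdot z w ^ n) has_sum infsum ?f UNIV) UNIV"
  proof (rule has_sum_fibres[OF f])
    fix n
    show "(?f has_sum (of_real (a n) * hdot z w ^ n)) {\<alpha>\<in>UNIV. mi_size \<alpha> = n}"
      by (rule has_sum_finiteI) (auto simp: hdot_power sum_distrib_left mult_ac intro!: sum.cong)
  qed
  then have "infsum ?f UNIV = (\<Sum>n. of_real (a n) * hdot z w ^ n)"
    using has_sum_imp_sums sums_unique by blast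
  then show "(?f has_sum (\<Sum>n. of_real (a n) * hdot z w ^ n)) UNIV" using f by simp
qed

section \<open>The coefficient model of the Dirichlet module\<close>

definition psum :: "(nat ^ 'd::finite \<Rightarrow> complex) \<Rightarrow> complex ^ 'd \<Rightarrow> complex" where
  "psum c z = (if z \<in> ball 0 1 then \<Sum>\<^sub>\<infinity>\<alpha>. c \<alpha> * mi_monom \<alpha> z else 0)"

text \<open>
  Coefficients of the kernel function at \<open>w\<close>, for which \<open>psum c w\<close> is the inner product of \<open>c\<close> with
  \<open>kcoeff w\<close>.
\<close>
definition kcoeff :: "complex ^ 'd::finite \<Rightarrow> nat ^ 'd \<Rightarrow> complex" where
  "kcoeff w \<alpha> = cnj (mi_monom \<alpha> w) / of_real (wt \<alpha>)"

interpretation Coeff: hilbert_fun "wl2 (wt :: nat ^ 'd::finite \<Rightarrow> real)" "wip wt"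
  by (rule hilbert_fun_wl2) simp

lemma kcoeff_eq: "of_real (dir_a (mi_size \<alpha>) * multinom \<alpha>) * cnj (mi_monom \<alpha> w) = kcoeff w \<alpha>"
  by (simp add: kcoeff_def wt_def)

lemma kcoeff_mem: assumes "w \<in> ball 0 1" shows "kcoeff (w :: complex ^ 'd::finite) \<in> wl2 wt"
proof -
  have "wt \<alpha> * (cmod (kcoeff w \<alpha>))\<^sup>2 =
     norm (of_real (dir_a (mi_size \<alpha>) * multinom \<alpha>) * (mi_monom \<alpha> w * cnj (mi_monom \<alpha> w)))" for \<alpha>
  proof -
    have "wt \<alpha> * (cmod (kcoeff w \<alpha>))\<^sup>2 = (cmod (mi_monom \<alpha> w))\<^sup>2 / wt \<alpha>"
      by (simp add: kcoeff_def norm_divide power_divide) (simp add: power2_eq_square)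
    moreover have "norm (of_real (dir_a (mi_size \<alpha>) * multinom \<alpha>) * (mi_monom \<alpha> w * cnj (mi_monom \<alpha> w))) =
        dir_a (mi_size \<alpha>) * multinom \<alpha> * (cmod (mi_monom \<alpha> w))\<^sup>2"
      by (simp add: norm_mult power2_eq_square del: of_real_mult of_real_divide)
    ultimately show ?thesis by (simp add: wt_def)
  qed
  then show ?thesis using hdot_series(1)[OF assms assms, of dir_a] by (simp add: wl2_def)
qed

lemma psum_has_sum:
  assumes "z \<in> ball 0 1" "c \<in> wl2 (wt :: nat ^ 'd::finite \<Rightarrow> real)"
  shows "((\<lambda>\<alpha>. c \<alpha> * mi_monom \<alpha> z) has_sum psum c z) UNIV"
    and "psum c z = wip wt c (kcoeff z)"
proof -
  have eq: "(\<lambda>\<alpha>. of_real (wt \<alpha>) * (c \<alpha> * cnj (kcoeff z \<alpha>))) = (\<lambda>\<alpha>. c \<alpha> * mi_monom \<alpha> z)"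
    by (auto simp: kcoeff_def)
  show "((\<lambda>\<alpha>. c \<alpha> * mi_monom \<alpha> z) has_sum psum c z) UNIV"
    using wl2_mult_summable[OF _ assms(2) kcoeff_mem[OF assms(1)]] assms(1)
    unfolding eq by (simp add: psum_def)
  show "psum c z = wip wt c (kcoeff z)"
    using assms(1) unfolding wip_def eq by (simp add: psum_def)
qed

lemma psum_outside: "z \<notin> ball 0 1 \<Longrightarrow> psum c z = 0"
  by (auto simp: psum_def)

lemma psum_kcoeff:
  fixes w :: "complex ^ 'd::finite"
  assumes w: "w \<in> ball 0 1"
  shows "psum (kcoeff w) = (\<lambda>z. if z \<in> ball 0 1 then dirichlet_kernel z w else 0)"
proof (rule ext)
  fix z :: "complex ^ 'd"
  show "psum (kcoeff w) z = (if z \<in> ball 0 1 then dirichlet_kernel z w else 0)"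
  proof (cases "z \<in> ball 0 1")
    case True
    have "((\<lambda>\<alpha>. kcoeff w \<alpha> * mi_monom \<alpha> z) has_sum dirichlet_kernel z w) UNIV"
      using hdot_series(2)[OF True w, of dir_a] unfolding kcoeff_eq[symmetric] dirichlet_kernel_def
      by (simp add: mult_ac)
    then show ?thesis using has_sum_unique[OF psum_has_sum(1)[OF True kcoeff_mem[OF w]]] True by simp
  qed (simp add: psum_outside)
qed

lemma psum_add: "c \<in> wl2 wt \<Longrightarrow> d \<in> wl2 wt \<Longrightarrow> psum (c + d) = psum c + psum (d :: nat ^ 'd::finite \<Rightarrow> complex)"
proof (rule ext)
  fix z :: "complex ^ 'd" assume "c \<in> wl2 wt" "d \<in> wl2 wt"
  then show "psum (c + d) z = (psum c + psum d) z"
    by (cases "z \<in> ball 0 1") (auto simp: psum_has_sum(2) Coeff.add_left Coeff.mem_add kcoeff_mem psum_outside simp del: mem_ball)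
qed

lemma psum_scale: "c \<in> wl2 wt \<Longrightarrow> psum (\<lambda>\<alpha>. a * c \<alpha>) = (\<lambda>z. a * psum (c :: nat ^ 'd::finite \<Rightarrow> complex) z)"
proof (rule ext)
  fix z :: "complex ^ 'd" assume "c \<in> wl2 wt"
  then show "psum (\<lambda>\<alpha>. a * c \<alpha>) z = a * psum c z"
    by (cases "z \<in> ball 0 1") (auto simp: psum_has_sum(2) Coeff.scale_left Coeff.mem_scale kcoeff_mem psum_outside simp del: mem_ball)
qed

lemma psum_diff: "c \<in> wl2 wt \<Longrightarrow> d \<in> wl2 wt \<Longrightarrow> psum (c - d) = psum c - psum (d :: nat ^ 'd::finite \<Rightarrow> complex)"
proof (rule ext)
  fix z :: "complex ^ 'd" assume "c \<in> wl2 wt" "d \<in> wl2 wt"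
  then show "psum (c - d) z = (psum c - psum d) z"
    by (cases "z \<in> ball 0 1") (auto simp: psum_has_sum(2) Coeff.diff_left Coeff.mem_diff kcoeff_mem psum_outside simp del: mem_ball)
qed

lemma psum_coeff_unique:
  assumes "c \<in> wl2 wt" "d \<in> wl2 wt" "psum c = psum (d :: nat ^ 'd::finite \<Rightarrow> complex)"
  shows "c = d"
proof (rule ext)
  fix \<gamma>
  have "c - d \<in> wl2 wt" using assms by auto
  moreover have "psum (c - d) = 0" using assms by (simp add: psum_diff)
  ultimately have "(c - d) \<gamma> = 0"
    using psum_has_sum(1)[of _ "c - d"] by (intro mi_power_series_unique) auto
  then show "c \<gamma> = d \<gamma>" by simp
qed

lemma psum_inj: "inj_on psum (wl2 (wt :: nat ^ 'd::finite \<Rightarrow> real))"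
  using psum_coeff_unique by (auto intro: inj_onI)

lemma rkhs_psum:
  fixes coeffs :: "(complex ^ 'd::finite \<Rightarrow> complex) \<Rightarrow> nat ^ 'd \<Rightarrow> complex"
  defines "coeffs \<equiv> inv_into (wl2 wt) psum"
  shows "rkhs (ball 0 1) dirichlet_kernel (psum ` wl2 wt) (\<lambda>f g. wip wt (coeffs f) (coeffs g))"
proof -
  have [simp]: "coeffs (psum c) = c" if "c \<in> wl2 wt" for c
    unfolding coeffs_def using psum_inj that by (rule inv_into_f_f)
  let ?ip = "\<lambda>f g. wip wt (coeffs f) (coeffs g)"
  have nrm: "ip_norm ?ip (psum c) = ip_norm (wip wt) c" if "c \<in> wl2 wt" for c
    using that by (simp add: ip_norm_def)
  have p0: "psum 0 = 0" using psum_diff[of 0 0] by simp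
  show ?thesis
  proof
    show "cfun.subspace (psum ` wl2 (wt :: nat ^ 'd \<Rightarrow> real))"
    proof (rule cfun.subspaceI)
      show "0 \<in> psum ` wl2 (wt :: nat ^ 'd \<Rightarrow> real)" using p0 Coeff.mem_0 by (metis image_eqI)
    next
      fix f g assume "f \<in> psum ` wl2 (wt :: nat ^ 'd \<Rightarrow> real)" "g \<in> psum ` wl2 (wt :: nat ^ 'd \<Rightarrow> real)"
      then obtain c d :: "nat ^ 'd \<Rightarrow> complex" where "c \<in> wl2 wt" "d \<in> wl2 wt" "f = psum c" "g = psum d" by auto
      then show "f + g \<in> psum ` wl2 (wt :: nat ^ 'd \<Rightarrow> real)" using psum_add[of c d] Coeff.mem_add[of c d] by (metis image_eqI)
    next
      fix a f assume "f \<in> psum ` wl2 (wt :: nat ^ 'd \<Rightarrow> real)"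
      then obtain c :: "nat ^ 'd \<Rightarrow> complex" where "c \<in> wl2 wt" "f = psum c" by auto
      then show "(\<lambda>x. a * f x) \<in> psum ` wl2 (wt :: nat ^ 'd \<Rightarrow> real)" using psum_scale[of c a] Coeff.mem_scale[of c a] by (metis image_eqI)
    qed
  next
    fix f :: "complex ^ 'd \<Rightarrow> complex" and x :: "complex ^ 'd" assume "f \<in> psum ` wl2 wt" "x \<notin> ball 0 1"
    then show "f x = 0" by (auto simp: psum_outside simp del: mem_ball)
  next
    fix f g h :: "complex ^ 'd \<Rightarrow> complex"
    assume "f \<in> psum ` wl2 wt" "g \<in> psum ` wl2 wt" "h \<in> psum ` wl2 wt"
    then show "?ip (f + g) h = ?ip f h + ?ip g h" by (auto simp: Coeff.add_left Coeff.mem_add simp flip: psum_add)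
  next
    fix c and f g :: "complex ^ 'd \<Rightarrow> complex"
    assume "f \<in> psum ` wl2 wt" "g \<in> psum ` wl2 wt"
    then show "?ip (\<lambda>x. c * f x) g = c * ?ip f g" by (auto simp: Coeff.scale_left Coeff.mem_scale simp flip: psum_scale)
  next
    fix f g :: "complex ^ 'd \<Rightarrow> complex"
    assume "f \<in> psum ` wl2 wt" "g \<in> psum ` wl2 wt"
    then show "?ip g f = cnj (?ip f g)" by (auto intro: Coeff.commute)
  next
    fix f :: "complex ^ 'd \<Rightarrow> complex"
    assume *: "f \<in> psum ` wl2 wt" "f \<noteq> 0"
    then obtain c where c: "c \<in> wl2 wt" "f = psum c" by auto
    then have "c \<noteq> 0" using * p0 by auto
    then show "0 < Re (?ip f f)" using c Coeff.pos by auto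
  next
    fix f :: "nat \<Rightarrow> complex ^ 'd \<Rightarrow> complex"
    assume f: "\<And>n. f n \<in> psum ` wl2 wt"
      and cau: "\<And>e. 0 < e \<Longrightarrow> \<exists>N. \<forall>m\<ge>N. \<forall>n\<ge>N. ip_norm ?ip (f m - f n) < e"
    define c where "c n = coeffs (f n)" for n
    have c: "c n \<in> wl2 wt" "f n = psum (c n)" for n using f[of n] by (auto simp: c_def)
    have eq: "ip_norm ?ip (f m - f n) = ip_norm (wip wt) (c m - c n)" for m n
      using nrm[OF Coeff.mem_diff[OF c(1) c(1)], of m n] by (simp add: c(2) psum_diff[OF c(1) c(1)])
    obtain d where d: "d \<in> wl2 wt" "ip_tendsto (wip wt) c d sequentially"
      using Coeff.Cauchy_converges[of c] c(1) cau unfolding eq by blast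
    have "ip_norm ?ip (f n - psum d) = ip_norm (wip wt) (c n - d)" for n
      using nrm[OF Coeff.mem_diff[OF c(1) d(1)], of n] by (simp add: c(2) psum_diff[OF c(1) d(1)])
    then have "ip_tendsto ?ip f (psum d) sequentially" using d(2) by (simp add: ip_tendsto_def)
    then show "\<exists>g\<in>psum ` wl2 wt. ip_tendsto ?ip f g sequentially" using d(1) by blast
  next
    fix w :: "complex ^ 'd" assume w: "w \<in> ball 0 1"
    show "(\<lambda>z. if z \<in> ball 0 1 then dirichlet_kernel z w else 0) \<in> psum ` wl2 wt"
      using psum_kcoeff[OF w] kcoeff_mem[OF w] by (metis image_eqI)
  next
    fix w :: "complex ^ 'd" and f :: "complex ^ 'd \<Rightarrow> complex" assume "f \<in> psum ` wl2 wt" and w: "w \<in> ball 0 1"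
    then obtain c where c: "c \<in> wl2 wt" "f = psum c" by auto
    show "?ip f (\<lambda>z. if z \<in> ball 0 1 then dirichlet_kernel z w else 0) = f w"
      unfolding psum_kcoeff[OF w, symmetric] using c w kcoeff_mem[OF w] by (simp add: psum_has_sum(2))
  qed
qed

text \<open>
  The power series with square-summable weighted coefficients form a space with the kernel \<open>K\<close>, so
  they are the Dirichlet module.
\<close>
theorem dirichlet_model:
  fixes D :: "(complex ^ 'd::finite \<Rightarrow> complex) set"
  assumes D: "rkhs (ball 0 1) dirichlet_kernel D ip"
  shows "D = psum ` wl2 wt"
    and "c \<in> wl2 wt \<Longrightarrow> d \<in> wl2 wt \<Longrightarrow> ip (psum c) (psum d) = wip wt c d"
proof -
  show eq: "D = psum ` wl2 wt" by (rule rkhs_unique(1)[OF D rkhs_psum])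
  assume *: "c \<in> wl2 wt" "d \<in> wl2 wt"
  then have "psum c \<in> D" "psum d \<in> D" by (auto simp: eq)
  from rkhs_unique(2)[OF D rkhs_psum this] show "ip (psum c) (psum d) = wip wt c d"
    using * by (simp add: inv_into_f_f[OF psum_inj])
qed

section \<open>Multiplication operators on the Dirichlet module\<close>

definition shift :: "nat ^ 'd::finite \<Rightarrow> (nat ^ 'd \<Rightarrow> complex) \<Rightarrow> nat ^ 'd \<Rightarrow> complex" where
  "shift \<gamma> c \<alpha> = (if \<forall>i. \<gamma> $ i \<le> \<alpha> $ i then c (\<alpha> - \<gamma>) else 0)"

text \<open>
  The adjoint of \<open>shift \<gamma>\<close> for the inner product with weights \<open>wt\<close>; see \<open>wip_shift\<close>.
\<close>
definition adj_shift :: "nat ^ 'd::finite \<Rightarrow> (nat ^ 'd \<Rightarrow> complex) \<Rightarrow> nat ^ 'd \<Rightarrow> complex" where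
  "adj_shift \<gamma> c \<alpha> = of_real (wt (\<alpha> + \<gamma>) / wt \<alpha>) * c (\<alpha> + \<gamma>)"

lemma shift_add_self [simp]: "shift \<gamma> c (\<beta> + \<gamma>) = c (\<beta> :: nat ^ 'd::finite)"
proof -
  have "\<beta> + \<gamma> - \<gamma> = \<beta>" by (simp add: vec_eq_iff)
  then show ?thesis by (simp add: shift_def)
qed

lemma shift_outside: "\<not> (\<forall>i. \<gamma> $ i \<le> \<alpha> $ i) \<Longrightarrow> shift \<gamma> c \<alpha> = 0"
  by (auto simp: shift_def)

lemma sum_fun_apply: "(\<Sum>i\<in>A. f i) x = (\<Sum>i\<in>A. f i x)" for f :: "'i \<Rightarrow> 'a \<Rightarrow> complex"
  by (induction A rule: infinite_finite_induct) auto

lemma has_sum_shift: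
  fixes h :: "nat ^ 'd::finite \<Rightarrow> 'b::{comm_monoid_add,topological_space}"
  assumes "\<And>\<alpha>. \<not> (\<forall>i. \<gamma> $ i \<le> \<alpha> $ i) \<Longrightarrow> h \<alpha> = 0"
  shows "(h has_sum S) UNIV \<longleftrightarrow> ((\<lambda>\<beta>. h (\<beta> + \<gamma>)) has_sum S) UNIV"
proof -
  have inj: "inj (\<lambda>\<beta> :: nat ^ 'd. \<beta> + \<gamma>)" by (auto intro: injI simp: vec_eq_iff)
  have range: "\<alpha> \<in> range (\<lambda>\<beta>. \<beta> + \<gamma>)" if "\<forall>i. \<gamma> $ i \<le> \<alpha> $ i" for \<alpha>
    by (rule range_eqI[of _ _ "\<alpha> - \<gamma>"]) (use that in \<open>auto simp: vec_eq_iff\<close>)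
  have "(h has_sum S) UNIV \<longleftrightarrow> (h has_sum S) (range (\<lambda>\<beta>. \<beta> + \<gamma>))"
  proof (rule has_sum_cong_neutral)
    show "h x = 0" if "x \<in> UNIV - range (\<lambda>\<beta>. \<beta> + \<gamma>)" for x using that range[of x] assms[of x] by blast
  qed auto
  also have "\<dots> \<longleftrightarrow> ((\<lambda>\<beta>. h (\<beta> + \<gamma>)) has_sum S) UNIV"
    using has_sum_reindex[OF inj, of h S] by (simp add: o_def)
  finally show ?thesis .
qed

text \<open>
  The formula for the norm also governs the growth of \<open>\<parallel>z\<^sub>i\<^sup>n f\<parallel>\<close>.
\<close>
lemma shift_mem:
  assumes c: "c \<in> wl2 wt"
  shows "shift \<gamma> c \<in> wl2 wt"
    and "(ip_norm (wip wt) (shift \<gamma> c))\<^sup>2 = (\<Sum>\<^sub>\<infinity>\<beta>. wt (\<beta> + \<gamma>) * (cmod (c \<beta>))\<^sup>2)"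
    and "(\<lambda>\<beta>. wt (\<beta> + \<gamma>) * (cmod (c (\<beta> :: nat ^ 'd::finite)))\<^sup>2) summable_on UNIV"
proof -
  have "(\<lambda>\<beta>. (real (mi_size \<gamma>) + 1) * (wt \<beta> * (cmod (c \<beta>))\<^sup>2)) summable_on UNIV"
    using c by (intro summable_on_cmult_right) (simp add: wl2_def)
  then show s: "(\<lambda>\<beta>. wt (\<beta> + \<gamma>) * (cmod (c \<beta>))\<^sup>2) summable_on UNIV"
  proof (rule summable_on_comparison_test)
    fix \<beta> show "wt (\<beta> + \<gamma>) * (cmod (c \<beta>))\<^sup>2 \<le> (real (mi_size \<gamma>) + 1) * (wt \<beta> * (cmod (c \<beta>))\<^sup>2)"
      using mult_right_mono[OF wt_add_le[of \<beta> \<gamma>], of "(cmod (c \<beta>))\<^sup>2"] by (simp add: mult_ac)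
  qed auto
  have hs: "((\<lambda>\<alpha>. wt \<alpha> * (cmod (shift \<gamma> c \<alpha>))\<^sup>2) has_sum (\<Sum>\<^sub>\<infinity>\<beta>. wt (\<beta> + \<gamma>) * (cmod (c \<beta>))\<^sup>2)) UNIV"
    by (subst has_sum_shift[of \<gamma>]) (use s in \<open>simp_all add: shift_outside\<close>)
  then show m: "shift \<gamma> c \<in> wl2 wt" by (auto simp: wl2_def dest: has_sum_imp_summable)
  show "(ip_norm (wip wt) (shift \<gamma> c))\<^sup>2 = (\<Sum>\<^sub>\<infinity>\<beta>. wt (\<beta> + \<gamma>) * (cmod (c \<beta>))\<^sup>2)"
    using m hs by (subst wip_norm_square) (auto intro: infsumI)
qed

lemma psum_shift:
  assumes c: "c \<in> wl2 wt"
  shows "psum (shift \<gamma> c) = mi_monom \<gamma> * psum (c :: nat ^ 'd::finite \<Rightarrow> complex)"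
proof (rule ext)
  fix z :: "complex ^ 'd"
  show "psum (shift \<gamma> c) z = (mi_monom \<gamma> * psum c) z"
  proof (cases "z \<in> ball 0 1")
    case True
    have "((\<lambda>\<beta>. mi_monom \<gamma> z * (c \<beta> * mi_monom \<beta> z)) has_sum (mi_monom \<gamma> z * psum c z)) UNIV"
      by (intro has_sum_cmult_right psum_has_sum True c)
    then have "((\<lambda>\<alpha>. shift \<gamma> c \<alpha> * mi_monom \<alpha> z) has_sum (mi_monom \<gamma> z * psum c z)) UNIV"
      by (subst has_sum_shift[of \<gamma>]) (simp_all add: mi_monom_add mult_ac shift_outside)
    then show ?thesis using has_sum_unique[OF psum_has_sum(1)[OF True shift_mem(1)[OF c]]] by simp
  qed (simp add: psum_outside)
qed

lemma adj_shift_mem: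
  assumes c: "c \<in> wl2 wt"
  shows "adj_shift \<gamma> c \<in> wl2 (wt :: nat ^ 'd::finite \<Rightarrow> real)"
proof -
  have inj: "inj (\<lambda>\<beta> :: nat ^ 'd. \<beta> + \<gamma>)" by (auto intro: injI simp: vec_eq_iff)
  have "(\<lambda>\<alpha>. wt \<alpha> * (cmod (c \<alpha>))\<^sup>2) summable_on range (\<lambda>\<beta>. \<beta> + \<gamma>)"
    by (rule summable_on_subset_banach[of _ UNIV]) (use c in \<open>auto simp: wl2_def\<close>)
  then have "(\<lambda>\<beta>. wt (\<beta> + \<gamma>) * (cmod (c (\<beta> + \<gamma>)))\<^sup>2) summable_on UNIV"
    using summable_on_reindex[OF inj, of "\<lambda>\<alpha>. wt \<alpha> * (cmod (c \<alpha>))\<^sup>2"] by (simp add: o_def)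
  then have "(\<lambda>\<beta>. (real (mi_size \<gamma>) + 1) * (wt (\<beta> + \<gamma>) * (cmod (c (\<beta> + \<gamma>)))\<^sup>2)) summable_on UNIV"
    by (rule summable_on_cmult_right)
  then have "(\<lambda>\<beta>. wt \<beta> * (cmod (adj_shift \<gamma> c \<beta>))\<^sup>2) summable_on UNIV"
  proof (rule summable_on_comparison_test)
    fix \<beta> :: "nat ^ 'd"
    have "wt \<beta> * (cmod (adj_shift \<gamma> c \<beta>))\<^sup>2 = (wt (\<beta> + \<gamma>) / wt \<beta>) * (wt (\<beta> + \<gamma>) * (cmod (c (\<beta> + \<gamma>)))\<^sup>2)"
      by (simp add: adj_shift_def norm_mult norm_divide power_mult_distrib power_divide) (simp add: power2_eq_square)
    also have "\<dots> \<le> (real (mi_size \<gamma>) + 1) * (wt (\<beta> + \<gamma>) * (cmod (c (\<beta> + \<gamma>)))\<^sup>2)"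
      using wt_add_le[of \<beta> \<gamma>] by (intro mult_right_mono) (auto simp: divide_le_eq)
    finally show "wt \<beta> * (cmod (adj_shift \<gamma> c \<beta>))\<^sup>2 \<le> (real (mi_size \<gamma>) + 1) * (wt (\<beta> + \<gamma>) * (cmod (c (\<beta> + \<gamma>)))\<^sup>2)" .
  qed auto
  then show ?thesis by (simp add: wl2_def)
qed

lemma wip_shift:
  assumes c: "c \<in> wl2 wt" and d: "d \<in> wl2 wt"
  shows "wip wt (shift \<gamma> d) c = wip wt d (adj_shift \<gamma> (c :: nat ^ 'd::finite \<Rightarrow> complex))"
proof -
  have "((\<lambda>\<alpha>. of_real (wt \<alpha>) * (shift \<gamma> d \<alpha> * cnj (c \<alpha>))) has_sum wip wt (shift \<gamma> d) c) UNIV"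
    unfolding wip_def by (intro has_sum_infsum wl2_mult_summable shift_mem c d) simp
  then have "((\<lambda>\<beta>. of_real (wt (\<beta> + \<gamma>)) * (d \<beta> * cnj (c (\<beta> + \<gamma>)))) has_sum wip wt (shift \<gamma> d) c) UNIV"
    by (subst (asm) has_sum_shift[of \<gamma>]) (simp_all add: shift_outside)
  then have "((\<lambda>\<beta>. of_real (wt \<beta>) * (d \<beta> * cnj (adj_shift \<gamma> c \<beta>))) has_sum wip wt (shift \<gamma> d) c) UNIV"
    by (simp add: adj_shift_def mult_ac)
  then show ?thesis unfolding wip_def[of wt d] by (simp add: infsumI)
qed

lemma mi_monom_at_0: "mi_monom \<alpha> 0 = (if \<alpha> = (0 :: nat ^ 'd::finite) then 1 else 0)"
proof (cases "\<alpha> = 0")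
  case False
  then obtain i where "\<alpha> $ i \<noteq> 0" by (auto simp: vec_eq_iff)
  then have "(0 :: complex) ^ (\<alpha> $ i) = 0" by simp
  then show ?thesis using False unfolding mi_monom_def by (auto intro: prod_zero)
qed simp

lemma psum_at_0: "psum c 0 = c (0 :: nat ^ 'd::finite)"
proof -
  have "((\<lambda>\<alpha>. c \<alpha> * mi_monom \<alpha> 0) has_sum c 0) UNIV"
    by (rule has_sum_finite_neutralI[of "{0}"]) (auto simp: mi_monom_at_0)
  then show ?thesis by (simp add: psum_def infsumI)
qed

definition single :: "nat ^ 'd::finite \<Rightarrow> nat ^ 'd \<Rightarrow> complex" where
  "single \<gamma> \<alpha> = (if \<alpha> = \<gamma> then 1 else 0)"

lemma single_mem: "single \<gamma> \<in> wl2 (wt :: nat ^ 'd::finite \<Rightarrow> real)"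
  unfolding wl2_def mem_Collect_eq
  by (rule finite_nonzero_values_imp_summable_on) (auto simp: single_def)

lemma wip_single:
  assumes "c \<in> wl2 wt"
  shows "wip wt c (single \<gamma>) = of_real (wt \<gamma>) * c (\<gamma> :: nat ^ 'd::finite)"
proof -
  have "((\<lambda>\<alpha>. of_real (wt \<alpha>) * (c \<alpha> * cnj (single \<gamma> \<alpha>))) has_sum (of_real (wt \<gamma>) * c \<gamma>)) UNIV"
    by (rule has_sum_finite_neutralI[of "{\<gamma>}"]) (auto simp: single_def)
  then show ?thesis by (simp add: wip_def infsumI)
qed

lemma kcoeff_0: "kcoeff (0 :: complex ^ 'd::finite) = single 0"
  by (auto simp: kcoeff_def single_def mi_monom_at_0)

lemma shift_single: "shift \<gamma> (single 0) = single (\<gamma> :: nat ^ 'd::finite)"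
proof (rule ext)
  fix \<alpha> :: "nat ^ 'd"
  have "(\<forall>i. \<gamma> $ i \<le> \<alpha> $ i) \<and> \<alpha> - \<gamma> = 0 \<longleftrightarrow> \<alpha> = \<gamma>"
    by (auto simp: vec_eq_iff antisym)
  then show "shift \<gamma> (single 0) \<alpha> = single \<gamma> \<alpha>" by (auto simp: shift_def single_def)
qed

locale dirichlet_module = rkhs "ball 0 1" dirichlet_kernel D ip
  for D :: "(complex ^ 'd::finite \<Rightarrow> complex) set" and ip
begin

lemma D_eq: "D = psum ` wl2 wt" by (rule dirichlet_model(1)[OF rkhs_axioms])
lemma ip_psum: "c \<in> wl2 wt \<Longrightarrow> d \<in> wl2 wt \<Longrightarrow> ip (psum c) (psum d) = wip wt c d"
  by (rule dirichlet_model(2)[OF rkhs_axioms])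
lemma nrm_psum: "c \<in> wl2 wt \<Longrightarrow> hilb.nrm (psum c) = ip_norm (wip wt) c"
  by (simp add: ip_norm_def ip_psum)
lemma psum_mem: "c \<in> wl2 wt \<Longrightarrow> psum c \<in> D" by (auto simp: D_eq)
lemma obtain_coeffs: assumes "f \<in> D" obtains c where "c \<in> wl2 wt" "f = psum c"
  using assms by (auto simp: D_eq)

lemma kfun_psum: "w \<in> ball 0 1 \<Longrightarrow> kfun w = psum (kcoeff w)" by (simp add: kfun_def psum_kcoeff)
lemma kfun_0: "kfun 0 = psum (single 0)" by (simp add: kfun_psum kcoeff_0)
lemma kfun_0_0 [simp]: "kfun 0 0 = 1" by (simp add: kfun_0 psum_at_0 single_def)

lemma monom_mult_mem: "f \<in> D \<Longrightarrow> mi_monom \<gamma> * f \<in> D"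
  by (auto simp: D_eq psum_shift[symmetric] shift_mem)

lemma poly_mult_mem:
  assumes M: "cfun.subspace M" and mono: "\<And>\<gamma>. mi_monom \<gamma> * f \<in> M" and p: "p \<in> polynomials"
  shows "p * f \<in> M"
proof -
  obtain F c where "p = (\<lambda>z. \<Sum>\<alpha>\<in>F. c \<alpha> * mi_monom \<alpha> z)" using p by (auto simp: polynomials_def)
  then have "p * f = (\<Sum>\<alpha>\<in>F. (\<lambda>z. c \<alpha> * (mi_monom \<alpha> * f) z))"
    by (auto simp: fun_eq_iff sum_distrib_left sum_distrib_right sum_fun_apply mult_ac intro!: sum.cong)
  moreover have "(\<Sum>\<alpha>\<in>F. (\<lambda>z. c \<alpha> * (mi_monom \<alpha> * f) z)) \<in> M"
    by (intro cfun.subspace_sum[OF M] cfun.subspace_scale[OF M mono])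
  ultimately show ?thesis by (simp only:)
qed

lemma mi_monom_poly: "mi_monom \<gamma> \<in> polynomials"
  unfolding polynomials_def by (rule CollectI, rule exI[of _ "{\<gamma>}"], rule exI[of _ "\<lambda>_. 1"]) simp

lemma whole_submodule: "poly_submodule D ip D"
  unfolding poly_submodule_def using subspace poly_mult_mem[OF subspace monom_mult_mem] by auto

lemma adjoint_D:
  assumes c: "c \<in> wl2 wt"
  shows "adjoint_on ip D (\<lambda>g. mi_monom \<gamma> * g) (psum c) = psum (adj_shift \<gamma> c)"
  unfolding adjoint_on_def
proof (rule the_equality)
  have *: "ip (mi_monom \<gamma> * f) (psum c) = ip f (psum (adj_shift \<gamma> c))" if "f \<in> D" for f
  proof -
    obtain d where d: "d \<in> wl2 wt" "f = psum d" using obtain_coeffs[OF \<open>f \<in> D\<close>] by blast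
    then show ?thesis
      using c by (simp add: psum_shift[symmetric] ip_psum shift_mem adj_shift_mem wip_shift)
  qed
  then show "psum (adj_shift \<gamma> c) \<in> D \<and> (\<forall>f\<in>D. ip (mi_monom \<gamma> * f) (psum c) = ip f (psum (adj_shift \<gamma> c)))"
    using psum_mem adj_shift_mem c by blast
  fix h assume h: "h \<in> D \<and> (\<forall>f\<in>D. ip (mi_monom \<gamma> * f) (psum c) = ip f h)"
  let ?h = "psum (adj_shift \<gamma> c)"
  have m: "?h \<in> D" using psum_mem adj_shift_mem c by blast
  then have "h - ?h \<in> D" using h by auto
  then have "ip (h - ?h) (h - ?h) = 0" using h m * by (simp add: hilb.diff_right)
  then have "h - ?h = 0" using ip_pos[OF \<open>h - ?h \<in> D\<close>] by force
  then show "h = ?h" by simp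
qed

text \<open>
  The eigenvalue of \<open>\<Sum>\<^bsub>\<gamma>\<in>F\<^esub> b\<^sub>\<gamma> M\<^sup>\<gamma> (M\<^sup>\<gamma>)\<^sup>*\<close> on the monomial \<open>z\<^sup>\<alpha>\<close>.
\<close>
definition eigen :: "(nat ^ 'd) set \<Rightarrow> nat ^ 'd \<Rightarrow> real" where
  "eigen F \<alpha> = (\<Sum>\<gamma>\<in>F. if \<forall>i. \<gamma> $ i \<le> \<alpha> $ i then dirichlet_b_mi \<gamma> * (wt \<alpha> / wt (\<alpha> - \<gamma>)) else 0)"

lemma dirichlet_b_mi_nonneg: "dirichlet_b_mi \<gamma> \<ge> 0"
  by (simp add: dirichlet_b_mi_def dirichlet_b_nonneg)

lemma eigen_bounds:
  assumes F: "finite F" and a: "\<alpha> \<noteq> 0"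
  shows "0 \<le> eigen F \<alpha>" "eigen F \<alpha> \<le> 1" "{\<gamma>. \<forall>i. \<gamma> $ i \<le> \<alpha> $ i} - {0} \<subseteq> F \<Longrightarrow> eigen F \<alpha> = 1"
proof -
  let ?t = "\<lambda>\<gamma>. dirichlet_b_mi \<gamma> * (wt \<alpha> / wt (\<alpha> - \<gamma>))"
  let ?L = "{\<gamma>. \<forall>i. \<gamma> $ i \<le> \<alpha> $ i}"
  have t: "?t \<gamma> \<ge> 0" for \<gamma> by (simp add: dirichlet_b_mi_nonneg)
  have t0: "?t 0 = 0" by (simp add: dirichlet_b_mi_def)
  have fin: "finite ?L" by (rule finite_bounded_mi)
  have eq: "eigen F \<alpha> = (\<Sum>\<gamma>\<in>F \<inter> ?L. ?t \<gamma>)"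
    unfolding eigen_def by (subst sum.inter_restrict[OF F]) (simp only: mem_Collect_eq)
  show "0 \<le> eigen F \<alpha>" unfolding eq using t by (rule sum_nonneg)
  have one: "(\<Sum>\<gamma>\<in>?L. ?t \<gamma>) = 1" by (rule dirichlet_b_weight_sum[OF a])
  have "(\<Sum>\<gamma>\<in>F \<inter> ?L. ?t \<gamma>) \<le> (\<Sum>\<gamma>\<in>?L. ?t \<gamma>)" by (rule sum_mono2[OF fin]) (use t in auto)
  then show "eigen F \<alpha> \<le> 1" unfolding eq one .
  assume "?L - {0} \<subseteq> F"
  then have "(\<Sum>\<gamma>\<in>F \<inter> ?L. ?t \<gamma>) = (\<Sum>\<gamma>\<in>?L. ?t \<gamma>)"
    using t0 by (intro sum.mono_neutral_left fin) auto
  then show "eigen F \<alpha> = 1" unfolding eq one .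
qed

lemma eigen_0: "0 \<notin> F \<Longrightarrow> eigen F 0 = 0"
proof -
  assume F: "0 \<notin> F"
  have "(if \<forall>i. \<gamma> $ i \<le> (0 :: nat ^ 'd) $ i then dirichlet_b_mi \<gamma> * (wt 0 / wt (0 - \<gamma>)) else 0) = 0" if "\<gamma> \<in> F" for \<gamma>
    using that F by (cases "\<gamma> = 0") (auto simp: vec_eq_iff)
  then show ?thesis unfolding eigen_def by (intro sum.neutral) blast
qed

lemma partial_defect_sum:
  assumes c: "c \<in> wl2 wt" and F: "finite F"
  shows "(\<lambda>\<alpha>. of_real (eigen F \<alpha>) * c \<alpha>) \<in> wl2 wt"
    and "(\<Sum>\<gamma>\<in>F. (\<lambda>z. of_real (dirichlet_b_mi \<gamma>) * (mi_monom \<gamma> * adjoint_on ip D (\<lambda>g. mi_monom \<gamma> * g) (psum c)) z)) =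
      psum (\<lambda>\<alpha>. of_real (eigen F \<alpha>) * c \<alpha>)"
proof -
  let ?d = "\<lambda>\<gamma>. (\<lambda>\<alpha>. of_real (dirichlet_b_mi \<gamma>) * shift \<gamma> (adj_shift \<gamma> c) \<alpha>)"
  have d: "?d \<gamma> \<in> wl2 wt" for \<gamma> by (intro wl2_scale shift_mem adj_shift_mem c)
  have eq: "(\<Sum>\<gamma>\<in>F. ?d \<gamma>) = (\<lambda>\<alpha>. of_real (eigen F \<alpha>) * c \<alpha>)"
  proof (rule ext)
    fix \<alpha>
    have "?d \<gamma> \<alpha> = of_real (if \<forall>i. \<gamma> $ i \<le> \<alpha> $ i then dirichlet_b_mi \<gamma> * (wt \<alpha> / wt (\<alpha> - \<gamma>)) else 0) * c \<alpha>" for \<gamma>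
    proof (cases "\<forall>i. \<gamma> $ i \<le> \<alpha> $ i")
      case True
      then have "\<alpha> - \<gamma> + \<gamma> = \<alpha>" by (simp add: vec_eq_iff)
      then show ?thesis using True by (simp add: shift_def adj_shift_def)
    qed (auto simp: shift_def)
    then show "(\<Sum>\<gamma>\<in>F. ?d \<gamma>) \<alpha> = of_real (eigen F \<alpha>) * c \<alpha>"
      by (simp add: eigen_def sum_distrib_right sum_fun_apply)
  qed
  show "(\<lambda>\<alpha>. of_real (eigen F \<alpha>) * c \<alpha>) \<in> wl2 wt"
    unfolding eq[symmetric] using d by (rule Coeff.mem_sum)
  have "(\<Sum>\<gamma>\<in>F. (\<lambda>z. of_real (dirichlet_b_mi \<gamma>) * (mi_monom \<gamma> * adjoint_on ip D (\<lambda>g. mi_monom \<gamma> * g) (psum c)) z)) =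
      (\<Sum>\<gamma>\<in>F. psum (?d \<gamma>))"
  proof (rule sum.cong[OF refl])
    fix \<gamma>
    show "(\<lambda>z. of_real (dirichlet_b_mi \<gamma>) * (mi_monom \<gamma> * adjoint_on ip D (\<lambda>g. mi_monom \<gamma> * g) (psum c)) z) = psum (?d \<gamma>)"
      unfolding adjoint_D[OF c] psum_shift[OF adj_shift_mem[OF c], symmetric]
      by (rule psum_scale[symmetric]) (intro shift_mem adj_shift_mem c)
  qed
  also have "\<dots> = psum (\<Sum>\<gamma>\<in>F. ?d \<gamma>)"
    using F
  proof (induction F rule: finite_induct)
    case empty
    have "psum 0 = 0" using psum_diff[of 0 0] by simp
    then show ?case unfolding sum.empty by (rule sym)
  next
    case (insert x F)
    have "(\<Sum>\<gamma>\<in>F. ?d \<gamma>) \<in> wl2 wt" by (rule Coeff.mem_sum) (rule d)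
    from psum_add[OF d[of x] this] show ?case
      unfolding sum.insert[OF insert(1,2)] insert(3) by (rule sym)
  qed
  finally show "(\<Sum>\<gamma>\<in>F. (\<lambda>z. of_real (dirichlet_b_mi \<gamma>) * (mi_monom \<gamma> * adjoint_on ip D (\<lambda>g. mi_monom \<gamma> * g) (psum c)) z)) =
      psum (\<lambda>\<alpha>. of_real (eigen F \<alpha>) * c \<alpha>)" unfolding eq .
qed

text \<open>
  Strong convergence of the diagonal operators: on finitely many monomials, which carry almost all
  of the norm, the eigenvalues become exactly 1, and elsewhere they stay between 0 and 1.
\<close>
lemma whole_defect_sum:
  assumes c: "c \<in> wl2 wt"
  shows "ip_has_sum ip (\<lambda>\<gamma> z. of_real (dirichlet_b_mi \<gamma>) * (mi_monom \<gamma> * adjoint_on ip D (\<lambda>g. mi_monom \<gamma> * g) (psum c)) z)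
     (psum (\<lambda>\<alpha>. if \<alpha> = 0 then 0 else c \<alpha>)) (- {0})"
  unfolding ip_has_sum_def ip_tendsto_def
proof (rule tendstoI)
  fix e :: real assume e: "e > 0"
  let ?c0 = "\<lambda>\<alpha>. if \<alpha> = 0 then 0 else c \<alpha>"
  have c0: "?c0 \<in> wl2 wt"
    unfolding wl2_def mem_Collect_eq
    by (rule summable_on_comparison_test[of "\<lambda>\<alpha>. wt \<alpha> * (cmod (c \<alpha>))\<^sup>2"]) (use c in \<open>auto simp: wl2_def\<close>)
  have sc: "(\<lambda>\<alpha>. wt \<alpha> * (cmod (c \<alpha>))\<^sup>2) summable_on UNIV" using c by (simp add: wl2_def)
  obtain B where B: "finite B" "(\<Sum>\<^sub>\<infinity>\<alpha>\<in>-B. wt \<alpha> * (cmod (c \<alpha>))\<^sup>2) < e\<^sup>2"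
    using infsum_small_tail[OF sc, of "e\<^sup>2"] e by auto
  define G where "G = (\<Union>\<alpha>\<in>B. {\<gamma>. \<forall>i. \<gamma> $ i \<le> \<alpha> $ i} - {0})"
  have G: "finite G" "G \<subseteq> - {0}" using B finite_bounded_mi by (auto simp: G_def)
  let ?S = "sum (\<lambda>\<gamma> z. of_real (dirichlet_b_mi \<gamma>) * (mi_monom \<gamma> * adjoint_on ip D (\<lambda>g. mi_monom \<gamma> * g) (psum c)) z)"
  have "dist (hilb.nrm (?S F - psum ?c0)) 0 < e" if F: "finite F" "G \<subseteq> F" "F \<subseteq> - {0}" for F
  proof -
    note pd = partial_defect_sum[OF c F(1)]
    let ?d = "(\<lambda>\<alpha>. of_real (eigen F \<alpha>) * c \<alpha>) - ?c0"
    have d: "?d \<in> wl2 wt" using pd(1) c0 by auto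
    have "?S F - psum ?c0 = psum ?d" unfolding pd(2) by (rule psum_diff[symmetric, OF pd(1) c0])
    then have "hilb.nrm (?S F - psum ?c0) = ip_norm (wip wt) ?d" using nrm_psum[OF d] by (simp only:)
    moreover have "(ip_norm (wip wt) ?d)\<^sup>2 < e\<^sup>2"
    proof -
      have dz: "?d 0 = 0" using eigen_0[of F] F by auto
      have dB: "?d \<alpha> = 0" if "\<alpha> \<in> B" for \<alpha>
      proof (cases "\<alpha> = 0")
        case False
        then have "eigen F \<alpha> = 1" using F that by (intro eigen_bounds(3)) (auto simp: G_def)
        then show ?thesis using False by simp
      qed (use dz in simp)
      have le: "cmod (?d \<alpha>) \<le> cmod (c \<alpha>)" for \<alpha>
      proof (cases "\<alpha> = 0")
        case False
        have "?d \<alpha> = of_real (eigen F \<alpha> - 1) * c \<alpha>" using False by (simp add: algebra_simps)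
        then have "cmod (?d \<alpha>) = \<bar>eigen F \<alpha> - 1\<bar> * cmod (c \<alpha>)" by (simp only: norm_mult norm_of_real)
        also have "\<dots> \<le> 1 * cmod (c \<alpha>)"
          using eigen_bounds(1,2)[OF F(1) False] by (intro mult_right_mono) auto
        finally show ?thesis by simp
      qed (use dz in \<open>simp only: norm_zero norm_ge_zero\<close>)
      have "(ip_norm (wip wt) ?d)\<^sup>2 = (\<Sum>\<^sub>\<infinity>\<alpha>. wt \<alpha> * (cmod (?d \<alpha>))\<^sup>2)" by (rule wip_norm_square[OF _ d]) simp
      also have "\<dots> = (\<Sum>\<^sub>\<infinity>\<alpha>\<in>-B. wt \<alpha> * (cmod (?d \<alpha>))\<^sup>2)"
        by (rule infsum_cong_neutral) (use dB in auto)
      also have "\<dots> \<le> (\<Sum>\<^sub>\<infinity>\<alpha>\<in>-B. wt \<alpha> * (cmod (c \<alpha>))\<^sup>2)"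
      proof (rule infsum_mono)
        have "(\<lambda>\<alpha>. wt \<alpha> * (cmod (?d \<alpha>))\<^sup>2) summable_on UNIV" using d unfolding wl2_def by simp
        then show "(\<lambda>\<alpha>. wt \<alpha> * (cmod (?d \<alpha>))\<^sup>2) summable_on -B" by (rule summable_on_subset_banach) simp
        show "(\<lambda>\<alpha>. wt \<alpha> * (cmod (c \<alpha>))\<^sup>2) summable_on -B" by (rule summable_on_subset_banach[OF sc]) simp
        show "wt \<alpha> * (cmod (?d \<alpha>))\<^sup>2 \<le> wt \<alpha> * (cmod (c \<alpha>))\<^sup>2" for \<alpha>
          by (intro mult_left_mono power_mono le) auto
      qed
      finally show ?thesis using B(2) by simp
    qed
    moreover have "0 \<le> ip_norm (wip wt) ?d" using Coeff.nrm_nonneg[OF d] .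
    ultimately show ?thesis using e by (simp add: power2_less_imp_less dist_real_def)
  qed
  then show "\<forall>\<^sub>F F in finite_subsets_at_top (- {0}). dist (hilb.nrm (?S F - psum ?c0)) 0 < e"
    unfolding eventually_finite_subsets_at_top using G by blast
qed

text \<open>
  The projection onto the constants, which is the defect operator of the whole module.
\<close>
definition const_part :: "(complex ^ 'd \<Rightarrow> complex) \<Rightarrow> complex ^ 'd \<Rightarrow> complex" where
  "const_part f = (\<lambda>z. f 0 * kfun 0 z)"

lemma const_part_add: "const_part (f + g) = const_part f + const_part g"
  unfolding const_part_def by (rule ext) (simp add: distrib_right)

lemma const_part_scale: "const_part (\<lambda>x. c * f x) = (\<lambda>x. c * const_part f x)"
  unfolding const_part_def by (rule ext) simp

lemma whole_finite_defect: "finite_defect ip D"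
  unfolding finite_defect_def
proof (intro exI[of _ const_part] conjI)
  have k0: "kfun 0 \<in> D" by (rule kfun_mem) simp
  have f0: "ip f (kfun 0) = f 0" if "f \<in> D" for f using ip_kfun[OF that] by simp
  show "finite_rank_on D const_part"
    unfolding finite_rank_on_def const_part_def
    by (rule exI[of _ "{kfun 0}"]) (auto intro: cfun.span_scale[OF cfun.span_base])
  have bdd: "bounded_op_on ip D const_part"
    unfolding bounded_op_on_def
  proof (intro conjI ballI allI)
    show "const_part f \<in> D" if "f \<in> D" for f unfolding const_part_def by (rule hilb.mem_scale[OF k0])
    show "\<exists>C. \<forall>f\<in>D. hilb.nrm (const_part f) \<le> C * hilb.nrm f"
    proof (intro exI ballI)
      fix f assume f: "f \<in> D"
      have "hilb.nrm (const_part f) = cmod (f 0) * hilb.nrm (kfun 0)" unfolding const_part_def by (rule hilb.nrm_scale[OF k0])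
      also have "\<dots> \<le> (hilb.nrm f * hilb.nrm (kfun 0)) * hilb.nrm (kfun 0)"
        using hilb.Cauchy_Schwarz[OF f k0] k0 unfolding f0[OF f] by (intro mult_right_mono) auto
      finally show "hilb.nrm (const_part f) \<le> (hilb.nrm (kfun 0) * hilb.nrm (kfun 0)) * hilb.nrm f" by (simp add: mult_ac)
    qed
  next
    fix f g show "const_part (f + g) = const_part f + const_part g" by (rule const_part_add)
  next
    fix c f show "const_part (\<lambda>x. c * f x) = (\<lambda>x. c * const_part f x)" by (rule const_part_scale)
  qed
  show "is_defect_operator ip D const_part"
    unfolding is_defect_operator_def positive_op_on_def
  proof (intro conjI ballI bdd)
    fix f assume f: "f \<in> D"
    have "ip (const_part f) f = f 0 * cnj (f 0)"
      unfolding const_part_def using hilb.scale_left[OF k0 f] ip_kfun_left[OF f, of 0] by simp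
    then show "ip (const_part f) f \<in> \<real>\<^sub>\<ge>\<^sub>0" 
      by (simp add: complex_mult_cnj complex_nonneg_Reals_iff)
    obtain c where c: "c \<in> wl2 wt" "f = psum c" using obtain_coeffs[OF f] by blast
    have "const_part (const_part f) = (\<lambda>z. c 0 * psum (single 0) z)"
      by (simp add: const_part_def c(2) psum_at_0 kfun_0) (simp add: single_def)
    also have "\<dots> = psum (\<lambda>\<alpha>. c 0 * single 0 \<alpha>)" by (rule psum_scale[OF single_mem, symmetric])
    finally have "const_part (const_part f) = psum (\<lambda>\<alpha>. c 0 * single 0 \<alpha>)" .
    then have "f - const_part (const_part f) = psum (c - (\<lambda>\<alpha>. c 0 * single 0 \<alpha>))"
      using psum_diff[OF c(1) wl2_scale[OF single_mem], of "c 0" 0] c(2) by simp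
    also have "c - (\<lambda>\<alpha>. c 0 * single 0 \<alpha>) = (\<lambda>\<alpha>. if \<alpha> = 0 then 0 else c \<alpha>)"
      by (auto simp: single_def)
    finally have eq: "f - const_part (const_part f) = psum (\<lambda>\<alpha>. if \<alpha> = 0 then 0 else c \<alpha>)" .
    show "ip_has_sum ip (\<lambda>\<alpha> z. of_real (dirichlet_b_mi \<alpha>) * (mi_monom \<alpha> * adjoint_on ip D (\<lambda>g. mi_monom \<alpha> * g) f) z)
       (f - const_part (const_part f)) (- {0})"
      unfolding eq unfolding c(2) by (rule whole_defect_sum[OF c(1)])
  qed
qed

lemma submodule_closed: "poly_submodule D ip M \<Longrightarrow> hilb.closed_subspace M"
  unfolding poly_submodule_def hilb.closed_subspace_def by blast

text \<open>
  The orthogonal complement contains no nonzero function: its coefficients are inner products with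
  monomials, and these belong to \<open>M\<close>.
\<close>
lemma submodule_with_constants:
  assumes M: "poly_submodule D ip M" and k0: "kfun 0 \<in> M"
  shows "M = D"
proof
  show "M \<subseteq> D" using M by (simp add: poly_submodule_def)
  show "D \<subseteq> M"
  proof
    fix f assume f: "f \<in> D"
    obtain p where p: "p \<in> M" "\<And>m. m \<in> M \<Longrightarrow> ip (f - p) m = 0"
      using hilb.projection_exists[OF submodule_closed[OF M] f] by blast
    have "f - p \<in> D" using f p M by (auto simp: poly_submodule_def)
    then obtain d where d: "d \<in> wl2 wt" "f - p = psum d" by (rule obtain_coeffs)
    have "d \<gamma> = 0" for \<gamma>
    proof -
      have "mi_monom \<gamma> * kfun 0 \<in> M" using M k0 mi_monom_poly unfolding poly_submodule_def by blast
      moreover have "mi_monom \<gamma> * kfun 0 = psum (single \<gamma>)"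
        using psum_shift[OF single_mem, of \<gamma> 0] by (simp add: kfun_0 shift_single)
      ultimately have "ip (psum d) (psum (single \<gamma>)) = 0" using p(2) d(2) by metis
      then show ?thesis by (simp add: ip_psum[OF d(1) single_mem] wip_single[OF d(1)])
    qed
    then have "d = 0" by auto
    then have "f - p = 0" using d(2) psum_diff[of 0 0] by simp
    then show "f \<in> M" using p(1) by simp
  qed
qed

end

section \<open>Means over circles\<close>

abbreviation circ :: "real \<Rightarrow> complex" where "circ t \<equiv> cis (2 * pi * t)"

lemma circ_orthogonal:
  "((\<lambda>t. circ t ^ j * cnj (circ t) ^ k) has_integral (if j = k then 1 else 0)) {0..1::real}"
proof (cases "j = k")
  case True
  have "circ t ^ k * cnj (circ t) ^ k = 1" for t
    by (simp flip: power_mult_distrib add: complex_mult_cnj)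
  then show ?thesis using True has_integral_const_real[of "1::complex" 0 1] by simp
next
  case False
  define a where "a = 2 * pi * (real j - real k)"
  have a: "a \<noteq> 0" using False by (simp add: a_def)
  have eq: "circ t ^ j * cnj (circ t) ^ k = cis (a * t)" for t
  proof -
    have "circ t ^ j = cis (real j * (2 * pi * t))" by (rule Complex.DeMoivre)
    moreover have "cnj (circ t) ^ k = cis (real k * (- (2 * pi * t)))" unfolding cis_cnj by (rule Complex.DeMoivre)
    ultimately have "circ t ^ j * cnj (circ t) ^ k = cis (real j * (2 * pi * t) + real k * (- (2 * pi * t)))"
      by (simp only: cis_mult)
    also have "real j * (2 * pi * t) + real k * (- (2 * pi * t)) = a * t" by (simp add: a_def algebra_simps)
    finally show ?thesis .
  qed
  have "((\<lambda>t. cis (a * t)) has_integral (cis (a * 1) / (\<i> * of_real a) - cis (a * 0) / (\<i> * of_real a))) {0..1}"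
  proof (rule fundamental_theorem_of_calculus)
    fix t :: real
    show "((\<lambda>t. cis (a * t) / (\<i> * of_real a)) has_vector_derivative cis (a * t)) (at t within {0..1})"
      unfolding has_vector_derivative_def using a
      by (auto intro!: derivative_eq_intros simp: fun_eq_iff scaleR_conv_of_real mult.left_commute[of "of_real _" \<i>])
  qed simp
  moreover have "cis a = 1"
  proof -
    have "a = 2 * pi * of_int (int j - int k)" by (simp add: a_def)
    then show ?thesis by (simp only: cis_multiple_2pi Ints_of_int)
  qed
  ultimately show ?thesis using False unfolding eq by simp
qed

lemma circ_mean_double_sum:
  assumes "finite A"
  shows "((\<lambda>t. Re (\<Sum>j\<in>A. \<Sum>k\<in>A. m j k * (circ t ^ j * cnj (circ t) ^ k))) has_integral Re (\<Sum>j\<in>A. m j j)) {0..1}"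
proof -
  have "((\<lambda>t. \<Sum>j\<in>A. \<Sum>k\<in>A. m j k * (circ t ^ j * cnj (circ t) ^ k)) has_integral
       (\<Sum>j\<in>A. \<Sum>k\<in>A. m j k * (if j = k then 1 else 0))) {0..1}"
    by (intro has_integral_sum has_integral_mult_right circ_orthogonal assms)
  then have "((\<lambda>t. \<Sum>j\<in>A. \<Sum>k\<in>A. m j k * (circ t ^ j * cnj (circ t) ^ k)) has_integral (\<Sum>j\<in>A. m j j)) {0..1}"
    using assms by (simp add: if_distrib[of "\<lambda>x. _ * x"] cong: if_cong)
  from has_integral_linear[OF this bounded_linear_Re] show ?thesis by (simp add: o_def)
qed

text \<open>
  Parseval's identity on a circle, by orthogonality for partial sums and dominated convergence.
\<close>
lemma circ_mean_power_series:
  fixes c :: "nat \<Rightarrow> complex"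
  assumes r: "r \<ge> 0" and s: "summable (\<lambda>n. norm (c n) * r ^ n)"
    and F: "\<And>t. (\<lambda>n. c n * (of_real r * circ t) ^ n) sums F t"
  shows "((\<lambda>t. (cmod (F t))\<^sup>2) has_integral (\<Sum>n. (cmod (c n))\<^sup>2 * r ^ (2 * n))) {0..1}"
    and "summable (\<lambda>n. (cmod (c n))\<^sup>2 * r ^ (2 * n))"
proof -
  define S where "S N t = (\<Sum>n<N. c n * (of_real r * circ t) ^ n)" for N t
  define C where "C = (\<Sum>n. norm (c n) * r ^ n)"
  have int: "((\<lambda>t. (cmod (S N t))\<^sup>2) has_integral (\<Sum>n<N. (cmod (c n))\<^sup>2 * r ^ (2 * n))) {0..1}" for N
  proof -
    have "of_real ((cmod (S N t))\<^sup>2) = (\<Sum>j<N. \<Sum>k<N. (c j * cnj (c k) * of_real (r ^ j * r ^ k)) * (circ t ^ j * cnj (circ t) ^ k))" for t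
      unfolding complex_norm_square S_def cnj_sum sum_product
      by (simp add: power_mult_distrib mult_ac)
    then have eq: "(cmod (S N t))\<^sup>2 = Re (\<Sum>j<N. \<Sum>k<N. (c j * cnj (c k) * of_real (r ^ j * r ^ k)) * (circ t ^ j * cnj (circ t) ^ k))" for t
      by (metis Re_complex_of_real)
    have "Re (\<Sum>j<N. c j * cnj (c j) * of_real (r ^ j * r ^ j)) = (\<Sum>n<N. (cmod (c n))\<^sup>2 * r ^ (2 * n))"
    proof -
      have "c j * cnj (c j) * of_real (r ^ j * r ^ j) = of_real ((cmod (c j))\<^sup>2 * r ^ (2 * j))" for j
        by (simp add: complex_norm_square mult_2 power_add del: of_real_power)
      then show ?thesis by (simp only: Re_sum Re_complex_of_real)
    qed
    then show ?thesis
      unfolding eq using circ_mean_double_sum[of "{..<N}" "\<lambda>j k. c j * cnj (c k) * of_real (r ^ j * r ^ k)"] by simp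
  qed
  have SC: "norm (S N t) \<le> C" for N t
  proof -
    have "norm (S N t) \<le> (\<Sum>n<N. norm (c n * (of_real r * circ t) ^ n))" unfolding S_def by (rule norm_sum)
    also have "\<dots> = (\<Sum>n<N. norm (c n) * r ^ n)" using r by (simp add: norm_mult norm_power)
    also have "\<dots> \<le> C" unfolding C_def using r s by (intro sum_le_suminf) auto
    finally show ?thesis .
  qed
  have lim: "(\<lambda>N. (cmod (S N t))\<^sup>2) \<longlonglongrightarrow> (cmod (F t))\<^sup>2" for t
    using F[of t] unfolding sums_def S_def by (intro tendsto_intros)
  have i1: "(\<lambda>t. (cmod (S N t))\<^sup>2) integrable_on {0..1}" for N
    using int by (rule has_integral_integrable)
  have i2: "(\<lambda>t::real. C\<^sup>2) integrable_on {0..1}" by (rule integrable_const_ivl)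
  have i3: "norm ((cmod (S N t))\<^sup>2) \<le> C\<^sup>2" for N t
    using power_mono[OF SC[of N t], of 2] by simp
  note dc = dominated_convergence[OF i1 i2 i3 lim]
  have "(\<lambda>n. (cmod (c n))\<^sup>2 * r ^ (2 * n)) sums integral {0..1} (\<lambda>t. (cmod (F t))\<^sup>2)"
    using dc(2) unfolding sums_def integral_unique[OF int] .
  then show "((\<lambda>t. (cmod (F t))\<^sup>2) has_integral (\<Sum>n. (cmod (c n))\<^sup>2 * r ^ (2 * n))) {0..1}"
    and "summable (\<lambda>n. (cmod (c n))\<^sup>2 * r ^ (2 * n))"
    using dc(1) by (auto simp: sums_iff has_integral_iff)
qed

lemma (in hilbert_fun) circ_mean_nrm:
  assumes A: "finite A" and v: "\<And>n. n \<in> A \<Longrightarrow> v n \<in> H"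
  shows "((\<lambda>t. (nrm (\<Sum>n\<in>A. (\<lambda>x. (of_real (a n) * cnj (circ t) ^ n) * v n x)))\<^sup>2) has_integral (\<Sum>n\<in>A. (a n)\<^sup>2 * (nrm (v n))\<^sup>2)) {0..1}"
proof -
  have "(nrm (\<Sum>n\<in>A. (\<lambda>x. (of_real (a n) * cnj (circ t) ^ n) * v n x)))\<^sup>2 =
     Re (\<Sum>j\<in>A. \<Sum>k\<in>A. (of_real (a j * a k) * ip (v k) (v j)) * (circ t ^ j * cnj (circ t) ^ k))" for t
  proof -
    let ?u = "\<lambda>n x. (of_real (a n) * cnj (circ t) ^ n) * v n x"
    have u: "?u n \<in> H" if "n \<in> A" for n using v[OF that] by (rule mem_scale)
    have "ip (\<Sum>n\<in>A. ?u n) (\<Sum>n\<in>A. ?u n) = (\<Sum>j\<in>A. ip (\<Sum>n\<in>A. ?u n) (?u j))"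
      by (rule sum_right) (use u in auto)
    also have "\<dots> = (\<Sum>j\<in>A. \<Sum>k\<in>A. ip (?u k) (?u j))"
      by (intro sum.cong refl sum_left u)
    also have "\<dots> = (\<Sum>j\<in>A. \<Sum>k\<in>A. (of_real (a j * a k) * ip (v k) (v j)) * (circ t ^ j * cnj (circ t) ^ k))"
    proof (intro sum.cong refl)
      fix j k assume jk: "j \<in> A" "k \<in> A"
      have "ip (?u k) (?u j) = (of_real (a k) * cnj (circ t) ^ k) * (cnj (of_real (a j) * cnj (circ t) ^ j) * ip (v k) (v j))"
        by (subst scale_left[OF v[OF jk(2)] u[OF jk(1)]], subst scale_right[OF v[OF jk(1)] v[OF jk(2)]]) simp
      then show "ip (?u k) (?u j) = (of_real (a j * a k) * ip (v k) (v j)) * (circ t ^ j * cnj (circ t) ^ k)"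
        by (simp add: mult_ac)
    qed
    finally show ?thesis using nrm_square[OF mem_sum[of A ?u]] u by simp
  qed
  moreover have "Re (\<Sum>j\<in>A. of_real (a j * a j) * ip (v j) (v j)) = (\<Sum>n\<in>A. (a n)\<^sup>2 * (nrm (v n))\<^sup>2)"
    using v by (simp add: ip_self power2_eq_square)
  ultimately show ?thesis
    using circ_mean_double_sum[OF A, of "\<lambda>j k. of_real (a j * a k) * ip (v k) (v j)"] by simp
qed

section \<open>Square-summable power series in one variable\<close>

abbreviation hardy :: "(nat \<Rightarrow> complex) set" where "hardy \<equiv> wl2 (\<lambda>_. 1)"

definition nsq :: "(nat \<Rightarrow> complex) \<Rightarrow> real" where "nsq c = (\<Sum>n. (cmod (c n))\<^sup>2)"

definition conv :: "(nat \<Rightarrow> complex) \<Rightarrow> (nat \<Rightarrow> complex) \<Rightarrow> nat \<Rightarrow> complex" where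
  "conv g h n = (\<Sum>k\<le>n. g k * h (n - k))"

definition pser :: "(nat \<Rightarrow> complex) \<Rightarrow> complex \<Rightarrow> complex" where
  "pser c x = (\<Sum>n. c n * x ^ n)"

interpretation Hardy: hilbert_fun hardy "wip (\<lambda>_. 1)"
  by (rule hilbert_fun_wl2) simp

lemma hardy_iff: "c \<in> hardy \<longleftrightarrow> summable (\<lambda>n. (cmod (c n))\<^sup>2)"
  unfolding wl2_def by (simp add: summable_on_UNIV_nonneg_real_iff)

lemma nrm_nsq: "c \<in> hardy \<Longrightarrow> (Hardy.nrm c)\<^sup>2 = nsq c"
proof -
  assume c: "c \<in> hardy"
  then have "((\<lambda>n. (cmod (c n))\<^sup>2) has_sum infsum (\<lambda>n. (cmod (c n))\<^sup>2) UNIV) UNIV" by (simp add: wl2_def)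
  then have "nsq c = infsum (\<lambda>n. (cmod (c n))\<^sup>2) UNIV"
    unfolding nsq_def using has_sum_imp_sums sums_unique by metis
  then show ?thesis using wip_norm_square[OF _ c] by simp
qed

lemma nsq_nonneg: "c \<in> hardy \<Longrightarrow> nsq c \<ge> 0"
  using nrm_nsq[of c] by (metis zero_le_power2)

lemma hardy_partial: "c \<in> hardy \<Longrightarrow> finite A \<Longrightarrow> (\<Sum>n\<in>A. (cmod (c n))\<^sup>2) \<le> nsq c"
  unfolding nsq_def by (intro sum_le_suminf) (auto simp: hardy_iff)

lemma hardyI:
  assumes "\<And>N. (\<Sum>n<N. (cmod (c n))\<^sup>2) \<le> B"
  shows "c \<in> hardy" "nsq c \<le> B"
proof -
  show "c \<in> hardy" unfolding hardy_iff
    by (rule summableI_nonneg_bounded[of _ B]) (use assms in auto)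
  then show "nsq c \<le> B" unfolding hardy_iff nsq_def using assms by (intro suminf_le_const) auto
qed

lemma hardy_coeff_le: "c \<in> hardy \<Longrightarrow> cmod (c n) \<le> Hardy.nrm c"
  using hardy_partial[of c "{n}"] nrm_nsq[of c] by (auto intro: power2_le_imp_le)

lemma pser_summable:
  assumes c: "c \<in> hardy" and x: "norm x < 1"
  shows "summable (\<lambda>n. norm (c n * x ^ n))"
proof (rule summable_comparison_test')
  show "summable (\<lambda>n. Hardy.nrm c * norm x ^ n)" using x by (intro summable_mult summable_geometric) simp
  show "norm (norm (c n * x ^ n)) \<le> Hardy.nrm c * norm x ^ n" for n
    using hardy_coeff_le[OF c, of n] by (simp add: norm_mult norm_power mult_right_mono)
qed

lemma pser_sums: "c \<in> hardy \<Longrightarrow> norm x < 1 \<Longrightarrow> (\<lambda>n. c n * x ^ n) sums pser c x"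
  unfolding pser_def by (rule summable_sums[OF summable_norm_cancel[OF pser_summable]])

lemma conv_sums:
  assumes "g \<in> hardy" "h \<in> hardy" and x: "norm x < 1"
  shows "summable (\<lambda>n. norm (conv g h n * x ^ n))"
    and "(\<lambda>n. conv g h n * x ^ n) sums (pser g x * pser h x)"
proof -
  have eq: "(\<Sum>i\<le>k. (g i * x ^ i) * (h (k - i) * x ^ (k - i))) = conv g h k * x ^ k" for k
    unfolding conv_def sum_distrib_right
  proof (intro sum.cong refl)
    fix i assume "i \<in> {..k}"
    then have "x ^ k = x ^ i * x ^ (k - i)" by (simp flip: power_add)
    then show "g i * x ^ i * (h (k - i) * x ^ (k - i)) = g i * h (k - i) * x ^ k" by (simp add: mult_ac)
  qed
  show "(\<lambda>n. conv g h n * x ^ n) sums (pser g x * pser h x)"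
    using Cauchy_product_sums[OF pser_summable[OF assms(1) x] pser_summable[OF assms(2) x]]
    unfolding eq pser_def .
  show "summable (\<lambda>n. norm (conv g h n * x ^ n))"
  proof (rule summable_comparison_test')
    show "summable (\<lambda>k. \<Sum>i\<le>k. norm (g i * x ^ i) * norm (h (k - i) * x ^ (k - i)))"
      using pser_summable[OF assms(1) x] pser_summable[OF assms(2) x]
      by (intro summable_Cauchy_product) auto
    show "norm (norm (conv g h k * x ^ k)) \<le> (\<Sum>i\<le>k. norm (g i * x ^ i) * norm (h (k - i) * x ^ (k - i)))" for k
      unfolding eq[symmetric] using norm_sum[of "\<lambda>i. (g i * x ^ i) * (h (k - i) * x ^ (k - i))" "{..k}"]
      by (simp add: norm_mult)
  qed
qed

lemma circ_mean_pser:
  assumes c: "c \<in> hardy" and r: "0 \<le> r" "r < 1"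
  shows "((\<lambda>t. (cmod (pser c (of_real r * circ t)))\<^sup>2) has_integral (\<Sum>n. (cmod (c n))\<^sup>2 * r ^ (2 * n))) {0..1}"
    and "summable (\<lambda>n. (cmod (c n))\<^sup>2 * r ^ (2 * n))"
    and "(\<Sum>n. (cmod (c n))\<^sup>2 * r ^ (2 * n)) \<le> nsq c"
proof -
  have s: "summable (\<lambda>n. norm (c n) * r ^ n)" using pser_summable[OF c, of "of_real r"] r by (simp add: norm_mult norm_power)
  have F: "(\<lambda>n. c n * (of_real r * circ t) ^ n) sums pser c (of_real r * circ t)" for t
    by (rule pser_sums[OF c]) (use r in \<open>simp add: norm_mult\<close>)
  show "((\<lambda>t. (cmod (pser c (of_real r * circ t)))\<^sup>2) has_integral (\<Sum>n. (cmod (c n))\<^sup>2 * r ^ (2 * n))) {0..1}"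
    and sm: "summable (\<lambda>n. (cmod (c n))\<^sup>2 * r ^ (2 * n))"
    using circ_mean_power_series[OF r(1) s F] by auto
  show "(\<Sum>n. (cmod (c n))\<^sup>2 * r ^ (2 * n)) \<le> nsq c"
    unfolding nsq_def
  proof (rule suminf_le[OF _ sm])
    show "(cmod (c n))\<^sup>2 * r ^ (2 * n) \<le> (cmod (c n))\<^sup>2" for n
      using r by (intro mult_left_le power_le_one) auto
  qed (use c in \<open>simp add: hardy_iff\<close>)
qed

lemma circ_mean_conv:
  assumes g: "g \<in> hardy" and h: "h \<in> hardy" and r: "0 \<le> r" "r < 1"
  shows "((\<lambda>t. (cmod (pser g (of_real r * circ t)))\<^sup>2 * (cmod (pser h (of_real r * circ t)))\<^sup>2) has_integral
      (\<Sum>n. (cmod (conv g h n))\<^sup>2 * r ^ (2 * n))) {0..1}"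
    and "summable (\<lambda>n. (cmod (conv g h n))\<^sup>2 * r ^ (2 * n))"
proof -
  have s: "summable (\<lambda>n. norm (conv g h n) * r ^ n)"
    using conv_sums(1)[OF g h, of "of_real r"] r by (simp add: norm_mult norm_power)
  have F: "(\<lambda>n. conv g h n * (of_real r * circ t) ^ n) sums (pser g (of_real r * circ t) * pser h (of_real r * circ t))" for t
    by (rule conv_sums(2)[OF g h]) (use r in \<open>simp add: norm_mult\<close>)
  show "((\<lambda>t. (cmod (pser g (of_real r * circ t)))\<^sup>2 * (cmod (pser h (of_real r * circ t)))\<^sup>2) has_integral
      (\<Sum>n. (cmod (conv g h n))\<^sup>2 * r ^ (2 * n))) {0..1}"
    and "summable (\<lambda>n. (cmod (conv g h n))\<^sup>2 * r ^ (2 * n))"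
    using circ_mean_power_series[OF r(1) s F] by (auto simp: norm_mult power_mult_distrib)
qed

section \<open>Contractive column multipliers\<close>

text \<open>
  A column of functions that is pointwise bounded by 1 on the disc is a contractive multiplier on the
  Hardy space: compare means over circles of radius \<open>r < 1\<close> and let \<open>r\<close> tend to 1.
\<close>
lemma column_contraction:
  assumes E: "finite E" and g: "\<And>i. i \<in> E \<Longrightarrow> g i \<in> hardy"
    and le: "\<And>x. norm x < 1 \<Longrightarrow> (\<Sum>i\<in>E. (cmod (pser (g i) x))\<^sup>2) \<le> 1"
    and h: "h \<in> hardy"
  shows "i \<in> E \<Longrightarrow> conv (g i) h \<in> hardy" and "(\<Sum>i\<in>E. nsq (conv (g i) h)) \<le> nsq h"
proof -
  have fin: "(\<Sum>i\<in>E. \<Sum>n<N. (cmod (conv (g i) h n))\<^sup>2) \<le> nsq h" for N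
  proof -
    have r_le: "(\<Sum>i\<in>E. \<Sum>n<N. (cmod (conv (g i) h n))\<^sup>2 * r ^ (2 * n)) \<le> nsq h" if r: "0 \<le> r" "r < 1" for r
    proof -
      have "(\<Sum>i\<in>E. \<Sum>n<N. (cmod (conv (g i) h n))\<^sup>2 * r ^ (2 * n)) \<le>
         (\<Sum>i\<in>E. \<Sum>n. (cmod (conv (g i) h n))\<^sup>2 * r ^ (2 * n))"
        using g h r by (intro sum_mono sum_le_suminf circ_mean_conv) auto
      also have "\<dots> \<le> (\<Sum>n. (cmod (h n))\<^sup>2 * r ^ (2 * n))"
      proof (rule has_integral_le)
        show "((\<lambda>t. \<Sum>i\<in>E. (cmod (pser (g i) (of_real r * circ t)))\<^sup>2 * (cmod (pser h (of_real r * circ t)))\<^sup>2)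
          has_integral (\<Sum>i\<in>E. \<Sum>n. (cmod (conv (g i) h n))\<^sup>2 * r ^ (2 * n))) {0..1}"
          by (intro has_integral_sum E circ_mean_conv g h r)
        show "((\<lambda>t. (cmod (pser h (of_real r * circ t)))\<^sup>2) has_integral (\<Sum>n. (cmod (h n))\<^sup>2 * r ^ (2 * n))) {0..1}"
          by (rule circ_mean_pser[OF h r])
        fix t :: real
        have "(\<Sum>i\<in>E. (cmod (pser (g i) (of_real r * circ t)))\<^sup>2) * (cmod (pser h (of_real r * circ t)))\<^sup>2 \<le>
            1 * (cmod (pser h (of_real r * circ t)))\<^sup>2"
          using r by (intro mult_right_mono le) (auto simp: norm_mult)
        then show "(\<Sum>i\<in>E. (cmod (pser (g i) (of_real r * circ t)))\<^sup>2 * (cmod (pser h (of_real r * circ t)))\<^sup>2)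
          \<le> (cmod (pser h (of_real r * circ t)))\<^sup>2" by (simp add: sum_distrib_right)
      qed
      also have "\<dots> \<le> nsq h" by (rule circ_mean_pser[OF h r])
      finally show ?thesis .
    qed
    define r where "r k = 1 - 1 / (real k + 2)" for k :: nat
    have "r \<longlonglongrightarrow> 1 - 0"
      unfolding r_def
    proof (intro tendsto_intros)
      show "(\<lambda>k. 1 / (real k + 2)) \<longlonglongrightarrow> 0"
        using LIMSEQ_ignore_initial_segment[OF lim_1_over_n, of 2] by (simp add: add_ac)
    qed
    then have "(\<lambda>k. \<Sum>i\<in>E. \<Sum>n<N. (cmod (conv (g i) h n))\<^sup>2 * r k ^ (2 * n)) \<longlonglongrightarrow>
      (\<Sum>i\<in>E. \<Sum>n<N. (cmod (conv (g i) h n))\<^sup>2 * 1 ^ (2 * n))"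
      by (intro tendsto_intros) simp
    then have "(\<Sum>i\<in>E. \<Sum>n<N. (cmod (conv (g i) h n))\<^sup>2 * 1 ^ (2 * n)) \<le> nsq h"
    proof (rule tendsto_upperbound)
      have "0 \<le> r k" "r k < 1" for k by (auto simp: r_def field_simps)
      then show "\<forall>\<^sub>F k in sequentially. (\<Sum>i\<in>E. \<Sum>n<N. (cmod (conv (g i) h n))\<^sup>2 * r k ^ (2 * n)) \<le> nsq h"
        by (intro always_eventually allI r_le)
    qed simp
    then show ?thesis by simp
  qed
  have one: "conv (g i) h \<in> hardy" if "i \<in> E" for i
  proof (rule hardyI(1))
    fix N
    have "(\<Sum>n<N. (cmod (conv (g i) h n))\<^sup>2) \<le> (\<Sum>i\<in>E. \<Sum>n<N. (cmod (conv (g i) h n))\<^sup>2)"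
      by (rule member_le_sum[OF that _ E]) (auto intro: sum_nonneg)
    then show "(\<Sum>n<N. (cmod (conv (g i) h n))\<^sup>2) \<le> nsq h" using fin[of N] by simp
  qed
  then show "i \<in> E \<Longrightarrow> conv (g i) h \<in> hardy" .
  have "(\<lambda>N. \<Sum>i\<in>E. \<Sum>n<N. (cmod (conv (g i) h n))\<^sup>2) \<longlonglongrightarrow> (\<Sum>i\<in>E. nsq (conv (g i) h))"
    unfolding nsq_def using one by (intro tendsto_sum summable_LIMSEQ) (simp add: hardy_iff)
  then show "(\<Sum>i\<in>E. nsq (conv (g i) h)) \<le> nsq h"
    by (rule tendsto_upperbound) (auto intro!: always_eventually fin)
qed

section \<open>Wandering vectors\<close>

definition rshift :: "(nat \<Rightarrow> complex) \<Rightarrow> nat \<Rightarrow> complex" where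
  "rshift h n = (case n of 0 \<Rightarrow> 0 | Suc k \<Rightarrow> h k)"

lemma rshift_add: "rshift (f + g) = rshift f + rshift g" by (auto simp: rshift_def split: nat.split)
lemma rshift_diff: "rshift (f - g) = rshift f - rshift g" by (auto simp: rshift_def split: nat.split)
lemma rshift_scale: "rshift (\<lambda>n. c * f n) = (\<lambda>n. c * rshift f n)" by (auto simp: rshift_def split: nat.split)
lemma rshift_funpow: "(rshift ^^ k) h n = (if n < k then 0 else h (n - k))"
  by (induction k arbitrary: n) (auto simp: rshift_def split: nat.split)

lemma rshift_hardy: assumes "h \<in> hardy" shows "rshift h \<in> hardy" "nsq (rshift h) = nsq h"
proof -
  have "(\<lambda>n. (cmod (rshift h (Suc n)))\<^sup>2) sums nsq h"
    using assms by (simp add: hardy_iff nsq_def rshift_def summable_sums)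
  from sums_Suc[OF this] have "(\<lambda>n. (cmod (rshift h n))\<^sup>2) sums nsq h" by (simp add: rshift_def)
  then show "rshift h \<in> hardy" "nsq (rshift h) = nsq h" by (auto simp: hardy_iff nsq_def sums_iff)
qed

lemma nrm_rshift: "h \<in> hardy \<Longrightarrow> Hardy.nrm (rshift h) = Hardy.nrm h"
proof (rule power2_eq_imp_eq)
  assume h: "h \<in> hardy"
  show "(Hardy.nrm (rshift h))\<^sup>2 = (Hardy.nrm h)\<^sup>2" by (simp only: nrm_nsq rshift_hardy h)
qed (intro Hardy.nrm_nonneg rshift_hardy, assumption)+

lemma rshift_isometry: assumes "f \<in> hardy" "g \<in> hardy" shows "wip (\<lambda>_. 1) (rshift f) (rshift g) = wip (\<lambda>_. 1) f g"
proof -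
  note n = nrm_rshift
  have ig: "(\<lambda>x. \<i> * g x) \<in> hardy" by (rule Hardy.mem_scale[OF assms(2)])
  show ?thesis
    unfolding Hardy.polarization[OF assms] Hardy.polarization[OF rshift_hardy(1)[OF assms(1)] rshift_hardy(1)[OF assms(2)]]
      rshift_add[symmetric] rshift_diff[symmetric] rshift_scale[symmetric]
      n[OF Hardy.mem_add[OF assms]] n[OF Hardy.mem_diff[OF assms]] n[OF Hardy.mem_add[OF assms(1) ig]] n[OF Hardy.mem_diff[OF assms(1) ig]] ..
qed

lemma rshift_funpow_hardy: "h \<in> hardy \<Longrightarrow> (rshift ^^ k) h \<in> hardy"
  by (induction k) (auto intro: rshift_hardy)

lemma conv_as_shifts: "conv g h n = (\<Sum>k<N. (\<lambda>j. g k * (rshift ^^ k) h j)) n" if "n < N"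
proof -
  have "(\<Sum>k<N. (\<lambda>j. g k * (rshift ^^ k) h j)) n = (\<Sum>k<N. if n < k then 0 else g k * h (n - k))"
    by (simp add: sum_fun_apply rshift_funpow if_distrib cong: if_cong)
  also have "\<dots> = (\<Sum>k\<le>n. g k * h (n - k))"
    by (rule sum.mono_neutral_cong_right) (use that in auto)
  finally show ?thesis by (simp add: conv_def)
qed

text \<open>
  The powers of the shift carry a wandering vector \<open>e\<close> to an orthogonal family, so multiplication by
  \<open>e\<close> only scales norms. In terms of functions, \<open>|e|\<close> is constant on the circle.
\<close>
lemma wandering_conv_le:
  assumes e: "e \<in> hardy" and w: "\<And>k. k > 0 \<Longrightarrow> wip (\<lambda>_. 1) e ((rshift ^^ k) e) = 0" and g: "g \<in> hardy"
  shows "nsq (conv g e) \<le> nsq g * nsq e"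
proof (rule hardyI(2))
  have orth: "wip (\<lambda>_. 1) ((rshift ^^ j) e) ((rshift ^^ k) e) = (if j = k then of_real (nsq e) else 0)" for j k
  proof -
    have *: "wip (\<lambda>_. 1) ((rshift ^^ j) e) ((rshift ^^ (j + l)) e) = (if l = 0 then of_real (nsq e) else 0)" for j l
    proof (induction j)
      case 0
      show ?case using w[of l] Hardy.ip_self[OF e] nrm_nsq[OF e] by auto
    next
      case (Suc j)
      then show ?case using rshift_isometry[OF rshift_funpow_hardy[OF e, of j] rshift_funpow_hardy[OF e, of "j + l"]] by simp
    qed
    show ?thesis
    proof (cases "j \<le> k")
      case True then show ?thesis using *[of j "k - j"] by auto
    next
      case False
      then have "wip (\<lambda>_. 1) ((rshift ^^ k) e) ((rshift ^^ j) e) = 0" using *[of k "j - k"] by auto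
      then show ?thesis
        using Hardy.commute[OF rshift_funpow_hardy[OF e, of k] rshift_funpow_hardy[OF e, of j]] False by auto
    qed
  qed
  fix N
  let ?u = "\<lambda>k j. g k * (rshift ^^ k) e j"
  have u: "?u k \<in> hardy" for k by (rule Hardy.mem_scale[OF rshift_funpow_hardy[OF e]])
  have s: "(\<Sum>k<N. ?u k) \<in> hardy" by (rule Hardy.mem_sum) (rule u)
  have "(\<Sum>n<N. (cmod (conv g e n))\<^sup>2) = (\<Sum>n<N. (cmod ((\<Sum>k<N. ?u k) n))\<^sup>2)"
    by (intro sum.cong refl) (simp only: conv_as_shifts lessThan_iff)
  also have "\<dots> \<le> nsq (\<Sum>k<N. ?u k)" by (rule hardy_partial[OF s]) simp
  also have "\<dots> = Re (wip (\<lambda>_. 1) (\<Sum>k<N. ?u k) (\<Sum>k<N. ?u k))"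
    using nrm_nsq[OF s] Hardy.nrm_square[OF s] by (simp only:)
  also have "wip (\<lambda>_. 1) (\<Sum>k<N. ?u k) (\<Sum>k<N. ?u k) = (\<Sum>j<N. \<Sum>k<N. wip (\<lambda>_. 1) (?u k) (?u j))"
    by (subst Hardy.sum_right[OF u s]) (intro sum.cong refl Hardy.sum_left u)
  also have "\<dots> = (\<Sum>j<N. \<Sum>k<N. if k = j then of_real ((cmod (g j))\<^sup>2 * nsq e) else 0)"
  proof (intro sum.cong refl)
    fix j k
    have "wip (\<lambda>_. 1) (?u k) (?u j) = g k * (cnj (g j) * wip (\<lambda>_. 1) ((rshift ^^ k) e) ((rshift ^^ j) e))"
      by (subst Hardy.scale_left[OF rshift_funpow_hardy[OF e] u], subst Hardy.scale_right[OF rshift_funpow_hardy[OF e] rshift_funpow_hardy[OF e]]) simp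
    then show "wip (\<lambda>_. 1) (?u k) (?u j) = (if k = j then of_real ((cmod (g j))\<^sup>2 * nsq e) else 0)"
      unfolding orth by (simp add: complex_norm_square del: of_real_power)
  qed
  also have "Re \<dots> = (\<Sum>j<N. (cmod (g j))\<^sup>2) * nsq e" by (simp add: sum_distrib_right)
  also have "\<dots> \<le> nsq g * nsq e"
    by (intro mult_right_mono hardy_partial g nsq_nonneg e) simp
  finally show "(\<Sum>n<N. (cmod (conv g e n))\<^sup>2) \<le> nsq g * nsq e" .
qed

lemma conv_diff: "conv g (h - k) = conv g h - conv g k"
  by (auto simp: conv_def fun_eq_iff right_diff_distrib sum_subtractf)

text \<open>
  The wandering vector is the component \<open>e\<close> of some \<open>h \<in> W\<close> orthogonal to the closure of the shifted
  space. It is a limit of elements of \<open>W\<close>, so it inherits the inequality assumed on \<open>W\<close>, the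
  column being contractive. Combined with \<open>wandering_conv_le\<close> this reads
  \<open>\<parallel>e\<parallel>\<^sup>2 \<le> (\<Sum>\<^sub>i \<parallel>g\<^sub>i\<parallel>\<^sup>2) \<parallel>e\<parallel>\<^sup>2\<close>.
\<close>
theorem inner_column:
  assumes E: "finite E" and g: "\<And>i. i \<in> E \<Longrightarrow> g i \<in> hardy"
    and le: "\<And>x. norm x < 1 \<Longrightarrow> (\<Sum>i\<in>E. (cmod (pser (g i) x))\<^sup>2) \<le> 1"
    and W: "cfun.subspace W" "W \<subseteq> hardy" "\<And>h. h \<in> W \<Longrightarrow> rshift h \<in> W"
    and F: "F \<in> W" "F \<noteq> 0"
    and crit: "\<And>h. h \<in> W \<Longrightarrow> nsq h \<le> (\<Sum>i\<in>E. nsq (conv (g i) h))"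
  shows "1 \<le> (\<Sum>i\<in>E. nsq (g i))"
proof -
  note contr = column_contraction[OF E g le]
  \<comment> \<open>The lowest degree \<open>m\<close> occurring in \<open>W\<close> does not occur in the shifted space, which makes \<open>e \<noteq> 0\<close>.\<close>
  define P where "P m \<longleftrightarrow> (\<exists>h\<in>W. h m \<noteq> 0)" for m
  have "\<exists>m. P m" using F by (auto simp: P_def fun_eq_iff)
  define m where "m = (LEAST m. P m)"
  have "P m" unfolding m_def using \<open>\<exists>m. P m\<close> by (rule LeastI_ex)
  then obtain h0 where h0: "h0 \<in> W" "h0 m \<noteq> 0" by (auto simp: P_def)
  have below: "h j = 0" if "h \<in> W" "j < m" for h j
    using not_less_Least[of j P] that unfolding m_def P_def by blast
  define S where "S = rshift ` W"
  have SW: "S \<subseteq> W" using W(3) by (auto simp: S_def)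
  have S: "S \<subseteq> hardy" "cfun.subspace S"
  proof -
    show "S \<subseteq> hardy" using SW W(2) by auto
    show "cfun.subspace S"
    proof (rule cfun.subspaceI)
      have "rshift 0 = 0" by (auto simp: rshift_def fun_eq_iff split: nat.split)
      then show "0 \<in> S" using cfun.subspace_0[OF W(1)] unfolding S_def by (rule image_eqI[OF sym])
    next
      fix x y assume "x \<in> S" "y \<in> S"
      then obtain a b where ab: "a \<in> W" "b \<in> W" "x = rshift a" "y = rshift b" by (auto simp: S_def)
      show "x + y \<in> S" unfolding S_def ab rshift_add[symmetric]
        by (intro imageI cfun.subspace_add[OF W(1)] ab)
    next
      fix c x assume "x \<in> S"
      then obtain a where a: "a \<in> W" "x = rshift a" by (auto simp: S_def)
      show "(\<lambda>n. c * x n) \<in> S" unfolding S_def a rshift_scale[symmetric]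
        by (intro imageI cfun.subspace_scale[OF W(1)] a)
    qed
  qed
  define C where "C = {g\<in>hardy. \<exists>f. (\<forall>n::nat. f n \<in> S) \<and> ip_tendsto (wip (\<lambda>_. 1)) f g sequentially}"
  have h0H: "h0 \<in> hardy" using h0 W by auto
  obtain p where p: "p \<in> C" "\<And>x. x \<in> C \<Longrightarrow> wip (\<lambda>_. 1) (h0 - p) x = 0"
    using Hardy.projection_exists[OF Hardy.seq_closure_closed[OF S] h0H] unfolding C_def by blast
  then obtain s where s: "\<And>n::nat. s n \<in> S" "ip_tendsto (wip (\<lambda>_. 1)) s p sequentially" and pH: "p \<in> hardy"
    by (auto simp: C_def)
  define e where "e = h0 - p"
  define f where "f n = h0 - s n" for n
  have fW: "f n \<in> W" for n unfolding f_def using cfun.subspace_diff[OF W(1) h0(1)] s SW by blast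
  have fH: "f n \<in> hardy" for n using fW W by auto
  have eH: "e \<in> hardy" unfolding e_def using h0H pH by (rule Hardy.mem_diff)
  have fe: "(\<lambda>n. Hardy.nrm (f n - e)) \<longlonglongrightarrow> 0"
  proof -
    have "Hardy.nrm (f n - e) = Hardy.nrm (s n - p)" for n
    proof -
      have "f n - e = p - s n" by (simp add: f_def e_def)
      then show ?thesis using Hardy.nrm_minus_commute[of p "s n"] pH s S by (simp only:) auto
    qed
    then show ?thesis using s(2) unfolding ip_tendsto_def by presburger
  qed
  have tend: "ip_tendsto (wip (\<lambda>_. 1)) f e sequentially" using fe by (simp add: ip_tendsto_def)
  have rshift_nrm: "Hardy.nrm ((rshift ^^ k) h) = Hardy.nrm h" if "h \<in> hardy" for h k
  proof (induction k)
    case (Suc k)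
    then show ?case using nrm_rshift[OF rshift_funpow_hardy[OF that, of k]] by simp
  qed simp
  have wand: "wip (\<lambda>_. 1) e ((rshift ^^ k) e) = 0" if k: "k > 0" for k
  proof -
    have shd: "(rshift ^^ k) (a - b) = (rshift ^^ k) a - (rshift ^^ k) b" for a b
      by (auto simp: fun_eq_iff rshift_funpow)
    have inW: "(rshift ^^ j) (f n) \<in> W" for j n by (induction j) (use fW W in auto)
    obtain j where j: "k = Suc j" using k by (cases k) auto
    have "(rshift ^^ k) (f n) \<in> S" for n using inW[of j n] by (simp add: j S_def)
    moreover have "ip_tendsto (wip (\<lambda>_. 1)) (\<lambda>n. (rshift ^^ k) (f n)) ((rshift ^^ k) e) sequentially"
    proof -
      have "Hardy.nrm ((rshift ^^ k) (f n) - (rshift ^^ k) e) = Hardy.nrm (f n - e)" for n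
        unfolding shd[symmetric] by (rule rshift_nrm[OF Hardy.mem_diff[OF fH eH]])
      then show ?thesis using fe unfolding ip_tendsto_def by presburger
    qed
    ultimately have "(rshift ^^ k) e \<in> C" unfolding C_def using rshift_funpow_hardy[OF eH]
      by (intro CollectI conjI exI[of _ "\<lambda>n. (rshift ^^ k) (f n)"]) auto
    then show ?thesis using p(2) by (simp add: e_def)
  qed
  have em: "e m \<noteq> 0"
  proof -
    have "s n m = 0" for n
    proof -
      obtain h where h: "h \<in> W" "s n = rshift h" using s(1)[of n] by (auto simp: S_def)
      show ?thesis
      proof (cases m)
        case 0 then show ?thesis by (simp add: h rshift_def)
      next
        case (Suc j) then show ?thesis using below[OF h(1), of j] by (simp add: h rshift_def)
      qed
    qed
    moreover have "cmod (s n m - p m) \<le> Hardy.nrm (s n - p)" for n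
      using hardy_coeff_le[OF Hardy.mem_diff[of "s n" p], of m] s S pH by auto
    ultimately have "cmod (p m) \<le> Hardy.nrm (s n - p)" for n by (metis diff_0 norm_minus_cancel)
    then have "cmod (p m) \<le> 0"
      using s(2) unfolding ip_tendsto_def by (intro tendsto_lowerbound[of _ 0 sequentially]) auto
    then show ?thesis using h0 by (simp add: e_def)
  qed
  then have epos: "nsq e > 0"
  proof -
    have "0 < (cmod (e m))\<^sup>2" using em by simp
    also have "\<dots> \<le> nsq e" using hardy_partial[OF eH, of "{m}"] by simp
    finally show ?thesis .
  qed
  have conv_tend: "(\<lambda>n. nsq (conv (g i) (f n))) \<longlonglongrightarrow> nsq (conv (g i) e)" if i: "i \<in> E" for i
  proof -
    have H: "conv (g i) h \<in> hardy" if "h \<in> hardy" for h using contr(1)[OF _ _ that i] .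
    have "Hardy.nrm (conv (g i) (f n) - conv (g i) e) \<le> Hardy.nrm (f n - e)" for n
    proof (rule power2_le_imp_le)
      have fme: "f n - e \<in> hardy" by (rule Hardy.mem_diff[OF fH eH])
      have "nsq (conv (g i) (f n - e)) \<le> (\<Sum>i\<in>E. nsq (conv (g i) (f n - e)))"
        by (rule member_le_sum[OF i _ E]) (use contr(1)[OF _ _ fme] in \<open>auto intro!: nsq_nonneg\<close>)
      also have "\<dots> \<le> nsq (f n - e)" using contr(2)[OF _ _ fme] by blast
      finally show "(Hardy.nrm (conv (g i) (f n) - conv (g i) e))\<^sup>2 \<le> (Hardy.nrm (f n - e))\<^sup>2"
        unfolding conv_diff[symmetric] nrm_nsq[OF fme] nrm_nsq[OF H[OF fme]] .
    qed (use Hardy.nrm_nonneg[OF Hardy.mem_diff[OF fH eH]] in auto)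
    then have "(\<lambda>n. Hardy.nrm (conv (g i) (f n) - conv (g i) e)) \<longlonglongrightarrow> 0"
      using fe Hardy.nrm_nonneg[OF Hardy.mem_diff[OF H[OF fH] H[OF eH]]]
      by (intro Lim_null_comparison[OF _ fe] always_eventually allI) auto
    then have "ip_tendsto (wip (\<lambda>_. 1)) (\<lambda>n. conv (g i) (f n)) (conv (g i) e) sequentially" by (simp add: ip_tendsto_def)
    from tendsto_power[OF Hardy.tendsto_nrm[OF this H[OF fH] H[OF eH]], of 2]
    show ?thesis by (simp add: nrm_nsq H fH eH)
  qed
  have "nsq e \<le> (\<Sum>i\<in>E. nsq (conv (g i) e))"
  proof (rule tendsto_le[of sequentially])
    show "(\<lambda>n. \<Sum>i\<in>E. nsq (conv (g i) (f n))) \<longlonglongrightarrow> (\<Sum>i\<in>E. nsq (conv (g i) e))"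
      by (intro tendsto_sum conv_tend)
    show "(\<lambda>n. nsq (f n)) \<longlonglongrightarrow> nsq e"
      using tendsto_power[OF Hardy.tendsto_nrm[OF tend fH eH], of 2] by (simp add: nrm_nsq fH eH)
    show "\<forall>\<^sub>F n in sequentially. nsq (f n) \<le> (\<Sum>i\<in>E. nsq (conv (g i) (f n)))"
      using crit[OF fW] by simp
  qed simp
  also have "\<dots> \<le> (\<Sum>i\<in>E. nsq (g i) * nsq e)"
    by (intro sum_mono wandering_conv_le eH wand g)
  also have "\<dots> = (\<Sum>i\<in>E. nsq (g i)) * nsq e" by (simp add: sum_distrib_right)
  finally show ?thesis using epos by simp
qed

section \<open>Restriction to a coordinate disc\<close>

lemma axis_inj: "inj (\<lambda>n. axis i n :: 'b::zero ^ 'd::finite)"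
  by (auto intro!: injI simp: axis_eq_axis)

lemma norm_axis_complex [simp]: "norm (axis i x :: complex ^ 'd::finite) = norm x"
proof -
  have "(\<Sum>j\<in>UNIV. (norm ((axis i x :: complex ^ 'd) $ j))\<^sup>2) = (\<Sum>j\<in>{i}. (norm x)\<^sup>2)"
    by (rule sum.mono_neutral_cong_right) (auto simp: axis_def)
  then show ?thesis by (simp add: norm_vec_def L2_set_def)
qed

lemma mi_monom_at_axis:
  "mi_monom \<alpha> (axis i x :: complex ^ 'd::finite) = (if \<alpha> \<in> range (axis i) then x ^ (\<alpha> $ i) else 0)"
proof (cases "\<alpha> \<in> range (axis i)")
  case True
  then obtain n where n: "\<alpha> = axis i n" by auto
  have "(axis i x :: complex ^ 'd) $ i = x" "(axis i n :: nat ^ 'd) $ i = n" by (auto simp: axis_def)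
  then show ?thesis using True unfolding n by simp
next
  case False
  have "\<exists>j. j \<noteq> i \<and> \<alpha> $ j \<noteq> 0"
  proof (rule ccontr)
    assume "\<not> ?thesis"
    then have "\<alpha> = axis i (\<alpha> $ i)" by (auto simp: vec_eq_iff axis_def)
    then show False using False by blast
  qed
  then obtain j where "j \<noteq> i" "\<alpha> $ j \<noteq> 0" by blast
  then have "axis i x $ j ^ (\<alpha> $ j) = 0" by (simp add: axis_def)
  then show ?thesis using False unfolding mi_monom_def by (auto intro: prod_zero)
qed

lemma multinom_axis [simp]: "multinom (axis i n :: nat ^ 'd::finite) = 1"
proof -
  have "mi_fact (axis i n :: nat ^ 'd) = (\<Prod>j\<in>{i}. fact n)"
    unfolding mi_fact_def by (rule prod.mono_neutral_cong_right) (auto simp: axis_def)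
  then show ?thesis by (simp add: multinom_def)
qed

lemma wt_axis [simp]: "wt (axis i n :: nat ^ 'd::finite) = real n + 1"
  by (simp add: wt_def)

text \<open>
  Taylor coefficients of the restriction to the \<open>i\<close>-th coordinate disc.
\<close>
definition slice :: "'d::finite \<Rightarrow> (nat ^ 'd \<Rightarrow> complex) \<Rightarrow> nat \<Rightarrow> complex" where
  "slice i c n = c (axis i n)"

lemma slice_summable:
  assumes "c \<in> wl2 (wt :: nat ^ 'd::finite \<Rightarrow> real)"
  shows "summable (\<lambda>n. (real n + 1) * (cmod (slice i c n))\<^sup>2)" "slice i c \<in> hardy"
proof -
  have "(\<lambda>\<alpha>. wt \<alpha> * (cmod (c \<alpha>))\<^sup>2) summable_on range (axis i)"
    by (rule summable_on_subset_banach[of _ UNIV]) (use assms in \<open>auto simp: wl2_def\<close>)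
  then have "(\<lambda>n. wt (axis i n) * (cmod (c (axis i n)))\<^sup>2) summable_on UNIV"
    using summable_on_reindex[OF axis_inj[of i], of "\<lambda>\<alpha>. wt \<alpha> * (cmod (c \<alpha>))\<^sup>2"] by (simp add: o_def)
  then show s: "summable (\<lambda>n. (real n + 1) * (cmod (slice i c n))\<^sup>2)"
    using summable_on_imp_summable by (simp add: slice_def)
  show "slice i c \<in> hardy" unfolding hardy_iff
    by (rule summable_comparison_test'[OF s]) (auto simp: distrib_right)
qed

lemma psum_at_axis:
  assumes c: "c \<in> wl2 wt" and x: "norm x < 1"
  shows "psum c (axis i x :: complex ^ 'd::finite) = pser (slice i c) x"
proof -
  have "axis i x \<in> ball 0 (1::real)" using x by (simp add: mem_ball)
  then have "((\<lambda>\<alpha>. c \<alpha> * mi_monom \<alpha> (axis i x)) has_sum psum c (axis i x)) UNIV"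
    using psum_has_sum(1) c by blast
  then have "((\<lambda>\<alpha>. c \<alpha> * mi_monom \<alpha> (axis i x)) has_sum psum c (axis i x)) (range (axis i))"
    by (rule has_sum_cong_neutral[THEN iffD1, rotated 3]) (auto simp: mi_monom_at_axis)
  then have "((\<lambda>n. slice i c n * x ^ n) has_sum psum c (axis i x)) UNIV"
    using has_sum_reindex[OF axis_inj[of i], of "\<lambda>\<alpha>. c \<alpha> * mi_monom \<alpha> (axis i x)"] by (simp add: o_def slice_def)
  then show ?thesis using has_sum_imp_sums sums_unique unfolding pser_def by metis
qed

lemma slice_linear:
  "slice i (c + d) = slice i c + slice i d" "slice i (\<lambda>\<alpha>. a * c \<alpha>) = (\<lambda>n. a * slice i c n)" "slice i 0 = 0"
  by (auto simp: slice_def fun_eq_iff)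

lemma slice_shift: "slice i (shift (axis i 1) c) = rshift (slice i (c :: nat ^ 'd::finite \<Rightarrow> complex))"
proof (rule ext)
  fix n
  show "slice i (shift (axis i 1) c) n = rshift (slice i c) n"
  proof (cases n)
    case 0
    have "\<not> (\<forall>j. (axis i 1 :: nat ^ 'd) $ j \<le> axis i 0 $ j)" by (auto simp: axis_def)
    then show ?thesis using 0 by (simp add: slice_def rshift_def shift_outside)
  next
    case (Suc k)
    have "(axis i (Suc k) :: nat ^ 'd) = axis i k + axis i 1" by (auto simp: vec_eq_iff axis_def)
    then show ?thesis using Suc by (simp add: slice_def rshift_def)
  qed
qed

text \<open>
  A variable other than \<open>z\<^sub>i\<close> costs a factor of order \<open>1/n\<close> in \<open>\<alpha>! / |\<alpha>|!\<close>, which cancels the growth of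
  the factor \<open>|\<alpha>| + 1\<close>.
\<close>
lemma wt_add_axis_bounded:
  fixes \<beta> :: "nat ^ 'd::finite"
  assumes "\<beta> \<notin> range (axis i)"
  shows "\<exists>C. \<forall>n. wt (\<beta> + axis i n) \<le> C"
proof -
  have "\<exists>j. j \<noteq> i \<and> \<beta> $ j \<noteq> 0"
  proof (rule ccontr)
    assume "\<not> ?thesis"
    then have "\<beta> = axis i (\<beta> $ i)" by (auto simp: vec_eq_iff axis_def)
    then show False using assms by blast
  qed
  then obtain j where j: "j \<noteq> i" "\<beta> $ j > 0" by blast
  define \<gamma> where "\<gamma> = \<beta> - axis j 1"
  have b: "\<beta> = \<gamma> + axis j 1" unfolding \<gamma>_def using axis_diff_add[OF j(2)] by simp
  have "wt (\<beta> + axis i n) \<le> 2 * (real (\<gamma> $ j) + 1) / multinom \<gamma>" for n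
  proof -
    define s where "s = real (mi_size \<gamma>) + real n"
    have s: "s \<ge> 0" by (simp add: s_def)
    have eq: "\<beta> + axis i n = (\<gamma> + axis i n) + axis j 1" by (simp add: b add_ac)
    have "(\<gamma> + axis i n) $ j = \<gamma> $ j" using j by (simp add: axis_def)
    then have "(real (\<gamma> $ j) + 1) * multinom (\<beta> + axis i n) = (s + 1) * multinom (\<gamma> + axis i n)"
      using multinom_add_axis[of "\<gamma> + axis i n" j] unfolding eq by (simp add: s_def)
    also have "\<dots> \<ge> (s + 1) * multinom \<gamma>" using s by (intro mult_left_mono multinom_add_ge) auto
    finally have *: "(s + 1) * multinom \<gamma> \<le> (real (\<gamma> $ j) + 1) * multinom (\<beta> + axis i n)" .
    have "wt (\<beta> + axis i n) = (s + 2) / multinom (\<beta> + axis i n)" unfolding eq by (simp add: wt_def s_def add_ac)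
    also have "\<dots> \<le> 2 * (s + 1) / multinom (\<beta> + axis i n)" using s by (intro divide_right_mono) auto
    also have "\<dots> \<le> 2 * (real (\<gamma> $ j) + 1) / multinom \<gamma>"
    proof (rule mult_imp_div_pos_le[OF multinom_pos])
      have "2 * (s + 1) * multinom \<gamma> \<le> 2 * (real (\<gamma> $ j) + 1) * multinom (\<beta> + axis i n)" using * by linarith
      then have "2 * (s + 1) \<le> 2 * (real (\<gamma> $ j) + 1) * multinom (\<beta> + axis i n) / multinom \<gamma>"
        by (rule mult_imp_le_div_pos[OF multinom_pos])
      then show "2 * (s + 1) \<le> 2 * (real (\<gamma> $ j) + 1) / multinom \<gamma> * multinom (\<beta> + axis i n)" by simp
    qed
    finally show ?thesis .
  qed
  then show ?thesis by blast
qed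

text \<open>
  Divided by \<open>n + 1\<close>, the weights of \<open>z\<^sub>i\<^sup>n z\<^sup>\<beta>\<close> tend to 1 if \<open>z\<^sup>\<beta>\<close> is a power of \<open>z\<^sub>i\<close>, and to 0 otherwise. They
  are dominated by \<open>wt \<beta>\<close>, so the limit may be taken termwise, and what remains is the Hardy space
  norm on the disc.
\<close>
lemma shift_norm_growth:
  fixes c :: "nat ^ 'd::finite \<Rightarrow> complex"
  assumes c: "c \<in> wl2 wt" and e: "e > 0"
  shows "\<exists>n0. \<forall>n\<ge>n0. (ip_norm (wip wt) (shift (axis i n) c))\<^sup>2 \<le> (real n + 1) * (nsq (slice i c) + e)"
proof -
  have sc: "(\<lambda>\<beta>. wt \<beta> * (cmod (c \<beta>))\<^sup>2) summable_on UNIV" using c by (simp add: wl2_def)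
  obtain B where B: "finite B" "(\<Sum>\<^sub>\<infinity>\<beta>\<in>-B. wt \<beta> * (cmod (c \<beta>))\<^sup>2) < e / 2"
    using infsum_small_tail[OF sc, of "e/2"] e by auto
  define l where "l \<beta> = (if \<beta> \<in> range (axis i) then 1 else 0 :: real)" for \<beta> :: "nat ^ 'd"
  have lim: "(\<lambda>n. wt (\<beta> + axis i n) / (real n + 1)) \<longlonglongrightarrow> l \<beta>" for \<beta>
  proof (cases "\<beta> \<in> range (axis i)")
    case True
    then obtain m where m: "\<beta> = axis i m" by auto
    have "wt (\<beta> + axis i n) / (real n + 1) = 1 + real m * (1 / (real n + 1))" for n
    proof -
      have "\<beta> + axis i n = axis i (m + n)" by (auto simp: m vec_eq_iff axis_def)
      then show ?thesis by (simp add: field_simps)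
    qed
    moreover have "(\<lambda>n. 1 + real m * (1 / (real n + 1))) \<longlonglongrightarrow> 1 + real m * 0"
      using LIMSEQ_ignore_initial_segment[OF lim_1_over_n, of 1] by (intro tendsto_intros) (simp add: add_ac)
    ultimately show ?thesis using True by (simp add: l_def)
  next
    case False
    obtain C where C: "\<And>n. wt (\<beta> + axis i n) \<le> C" using wt_add_axis_bounded[OF False] by blast
    have "(\<lambda>n. C * (1 / (real n + 1))) \<longlonglongrightarrow> C * 0"
      using LIMSEQ_ignore_initial_segment[OF lim_1_over_n, of 1] by (intro tendsto_intros) (simp add: add_ac)
    then have C0: "(\<lambda>n. C * (1 / (real n + 1))) \<longlonglongrightarrow> 0" by simp
    have "norm (wt (\<beta> + axis i n) / (real n + 1)) \<le> C * (1 / (real n + 1))" for n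
      using divide_right_mono[OF C[of n], of "real n + 1"] by simp
    then have "(\<lambda>n. wt (\<beta> + axis i n) / (real n + 1)) \<longlonglongrightarrow> 0"
      by (intro Lim_null_comparison[OF _ C0] always_eventually allI)
    then show ?thesis using False by (simp add: l_def)
  qed
  have "(\<lambda>n. \<Sum>\<beta>\<in>B. wt (\<beta> + axis i n) / (real n + 1) * (cmod (c \<beta>))\<^sup>2) \<longlonglongrightarrow> (\<Sum>\<beta>\<in>B. l \<beta> * (cmod (c \<beta>))\<^sup>2)"
    by (intro tendsto_intros lim)
  moreover have "(\<Sum>\<beta>\<in>B. l \<beta> * (cmod (c \<beta>))\<^sup>2) < nsq (slice i c) + e / 2"
  proof -
    define A where "A = {n. axis i n \<in> B}"
    have A: "axis i ` A = B \<inter> range (axis i)" by (auto simp: A_def)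
    then have finA: "finite A" using B(1) inj_on_subset[OF axis_inj[of i]] by (metis finite_Int finite_imageD subset_UNIV)
    have "(\<Sum>\<beta>\<in>B. l \<beta> * (cmod (c \<beta>))\<^sup>2) = (\<Sum>\<beta>\<in>B \<inter> range (axis i). (cmod (c \<beta>))\<^sup>2)"
      by (rule sum.mono_neutral_cong_right) (use B in \<open>auto simp: l_def\<close>)
    also have "\<dots> = (\<Sum>n\<in>A. (cmod (slice i c n))\<^sup>2)"
      unfolding A[symmetric] by (subst sum.reindex) (auto simp: slice_def intro: inj_on_subset[OF axis_inj])
    also have "\<dots> \<le> nsq (slice i c)" by (rule hardy_partial[OF slice_summable(2)[OF c] finA])
    finally show ?thesis using e by simp
  qed
  ultimately have "\<forall>\<^sub>F n in sequentially. (\<Sum>\<beta>\<in>B. wt (\<beta> + axis i n) / (real n + 1) * (cmod (c \<beta>))\<^sup>2) < nsq (slice i c) + e / 2"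
    by (rule order_tendstoD(2))
  then obtain n0 where n0: "\<And>n. n \<ge> n0 \<Longrightarrow> (\<Sum>\<beta>\<in>B. wt (\<beta> + axis i n) / (real n + 1) * (cmod (c \<beta>))\<^sup>2) < nsq (slice i c) + e / 2"
    by (auto simp: eventually_sequentially)
  have "(ip_norm (wip wt) (shift (axis i n) c))\<^sup>2 \<le> (real n + 1) * (nsq (slice i c) + e)" if n: "n \<ge> n0" for n
  proof -
    let ?h = "\<lambda>\<beta>. wt (\<beta> + axis i n) * (cmod (c \<beta>))\<^sup>2"
    note rshift = shift_mem[OF c, of "axis i n"]
    have hB: "?h summable_on B" "?h summable_on -B"
      by (auto intro: summable_on_subset_banach[OF rshift(3)])
    have "(ip_norm (wip wt) (shift (axis i n) c))\<^sup>2 = infsum ?h (B \<union> -B)" using rshift(2) by simp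
    also have "\<dots> = infsum ?h B + infsum ?h (-B)" by (rule infsum_Un_disjoint[OF hB]) auto
    also have "infsum ?h B = (real n + 1) * (\<Sum>\<beta>\<in>B. wt (\<beta> + axis i n) / (real n + 1) * (cmod (c \<beta>))\<^sup>2)"
      using B(1) by (simp add: sum_distrib_left)
    also have "\<dots> \<le> (real n + 1) * (nsq (slice i c) + e / 2)" using n0[OF n] by (intro mult_left_mono) auto
    also have "infsum ?h (-B) \<le> (\<Sum>\<^sub>\<infinity>\<beta>\<in>-B. (real n + 1) * (wt \<beta> * (cmod (c \<beta>))\<^sup>2))"
    proof (rule infsum_mono[OF hB(2)])
      show "(\<lambda>\<beta>. (real n + 1) * (wt \<beta> * (cmod (c \<beta>))\<^sup>2)) summable_on -B"
        by (intro summable_on_cmult_right) (rule summable_on_subset_banach[OF sc], simp)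
      show "?h \<beta> \<le> (real n + 1) * (wt \<beta> * (cmod (c \<beta>))\<^sup>2)" for \<beta>
        using mult_right_mono[OF wt_add_le[of \<beta> "axis i n"], of "(cmod (c \<beta>))\<^sup>2"] by (simp add: mult_ac)
    qed
    also have "\<dots> = (real n + 1) * (\<Sum>\<^sub>\<infinity>\<beta>\<in>-B. wt \<beta> * (cmod (c \<beta>))\<^sup>2)" by (rule infsum_cmult_right')
    also have "\<dots> \<le> (real n + 1) * (e / 2)" using B(2) by (intro mult_left_mono) auto
    finally show ?thesis by (simp add: distrib_left field_simps)
  qed
  then show ?thesis by blast
qed

section \<open>The kernel on the diagonal\<close>

text \<open>
  \<open>K(z,z)\<close> as a function of \<open>|z|\<^sup>2\<close>.
\<close>
definition kdiag :: "real \<Rightarrow> real" where "kdiag s = (\<Sum>n. dir_a n * s ^ n)"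

lemma kdiag_summable: assumes "0 \<le> s" "s < 1" shows "summable (\<lambda>n. dir_a n * s ^ n)"
proof (rule summable_comparison_test'[OF summable_geometric[of s]])
  show "norm (dir_a n * s ^ n) \<le> s ^ n" for n
    using assms mult_left_le_one_le[of "s ^ n" "dir_a n"] by (simp add: abs_mult)
qed (use assms in auto)

lemma kdiag_pos: assumes "0 \<le> s" "s < 1" shows "kdiag s > 0"
proof -
  have "(\<Sum>n<1. dir_a n * s ^ n) \<le> kdiag s" unfolding kdiag_def using assms
    by (intro sum_le_suminf kdiag_summable) auto
  then show ?thesis by simp
qed

text \<open>
  Bounding the first \<open>N\<close> terms by 1 and the rest by a geometric series shows that
  \<open>(1 - s) K \<rightarrow> 0\<close> as \<open>s \<rightarrow> 1\<close>.
\<close>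
lemma kdiag_upper: assumes s: "0 \<le> s" "s < 1" shows "kdiag s * (1 - s) \<le> real N * (1 - s) + 1 / (real N + 1)"
proof -
  have "kdiag s = (\<Sum>n. dir_a (n + N) * s ^ (n + N)) + (\<Sum>n<N. dir_a n * s ^ n)"
    unfolding kdiag_def by (rule suminf_split_initial_segment[OF kdiag_summable[OF s]])
  also have "(\<Sum>n. dir_a (n + N) * s ^ (n + N)) \<le> (\<Sum>n. (1 / (real N + 1)) * s ^ n)"
  proof (rule suminf_le)
    show "summable (\<lambda>n. dir_a (n + N) * s ^ (n + N))" using kdiag_summable[OF s] by (subst summable_iff_shift) 
    show "summable (\<lambda>n. (1 / (real N + 1)) * s ^ n)" using s by (intro summable_mult summable_geometric) auto
    show "dir_a (n + N) * s ^ (n + N) \<le> (1 / (real N + 1)) * s ^ n" for n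
      using s by (intro mult_mono frac_le power_decreasing) auto
  qed
  also have "\<dots> = (1 / (real N + 1)) * (1 / (1 - s))"
    using s by (subst suminf_mult) (auto simp: suminf_geometric)
  also have "(\<Sum>n<N. dir_a n * s ^ n) \<le> (\<Sum>n<N. 1)"
    using s by (intro sum_mono mult_le_one power_le_one) auto
  finally have "kdiag s \<le> (1 / (real N + 1)) * (1 / (1 - s)) + real N" by simp
  then have "kdiag s * (1 - s) \<le> ((1 / (real N + 1)) * (1 / (1 - s)) + real N) * (1 - s)"
    using s by (intro mult_right_mono) auto
  also have "\<dots> = real N * (1 - s) + 1 / (real N + 1) * (1 / (1 - s) * (1 - s))" by (simp only: distrib_right mult.assoc add.commute)
  also have "1 / (1 - s) * (1 - s) = 1" using s by simp
  also have "real N * (1 - s) + 1 / (real N + 1) * 1 = real N * (1 - s) + 1 / (real N + 1)" by simp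
  finally show ?thesis .
qed

text \<open>
  The radii are chosen so that, by Bernoulli's inequality, the first \<open>m\<close> powers stay above 1/2, and
  \<open>K\<close> is at least half a harmonic sum.
\<close>
lemma kdiag_lower: 
  defines "r \<equiv> \<lambda>m. 1 - 1 / (4 * (real m + 1))"
  shows "ln (real m + 1) / 2 \<le> kdiag ((r m)\<^sup>2)"
proof -
  have r: "0 \<le> r m" "r m < 1" by (auto simp: r_def field_simps)
  have r2: "0 \<le> (r m)\<^sup>2" "(r m)\<^sup>2 < 1" using r by (auto simp: power_less_one_iff abs_less_iff)
  have half: "1 / 2 \<le> ((r m)\<^sup>2) ^ n" if "n < m" for n
  proof -
    have "1 + real (2 * m) * (- 1 / (4 * (real m + 1))) \<le> (1 + (- 1 / (4 * (real m + 1)))) ^ (2 * m)"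
      by (rule Bernoulli_inequality) (simp add: field_simps)
    also have "\<dots> = (r m) ^ (2 * m)" by (simp add: r_def)
    also have "\<dots> \<le> (r m) ^ (2 * n)" using r that by (intro power_decreasing) auto
    also have "\<dots> = ((r m)\<^sup>2) ^ n" by (simp add: power_mult)
    finally have *: "1 + real (2 * m) * (- 1 / (4 * (real m + 1))) \<le> ((r m)\<^sup>2) ^ n" .
    have "1 / 2 \<le> 1 + real (2 * m) * (- 1 / (4 * (real m + 1)))" by (simp add: field_simps)
    with * show ?thesis by linarith
  qed
  have "ln (real m + 1) / 2 \<le> harm m / 2" using ln_le_harm[of m] by simp
  also have "harm m = (\<Sum>n<m. dir_a n)"
    unfolding harm_def by (rule sum.reindex_bij_witness[of _ Suc "\<lambda>n. n - 1"]) (auto simp: inverse_eq_divide add_ac)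
  also have "(\<Sum>n<m. dir_a n) / 2 = (\<Sum>n<m. dir_a n * (1 / 2))" by (simp add: sum_divide_distrib)
  also have "\<dots> \<le> (\<Sum>n<m. dir_a n * ((r m)\<^sup>2) ^ n)" using half by (intro sum_mono mult_left_mono) auto
  also have "\<dots> \<le> kdiag ((r m)\<^sup>2)" unfolding kdiag_def using r2 by (intro sum_le_suminf kdiag_summable) auto
  finally show ?thesis .
qed

lemma hdot_self: "hdot z z = of_real ((norm (z :: complex ^ 'd::finite))\<^sup>2)"
proof -
  have "hdot z z = of_real (\<Sum>i\<in>UNIV. (norm (z $ i))\<^sup>2)"
    unfolding hdot_def of_real_sum by (intro sum.cong refl) (rule complex_norm_square[symmetric])
  then show ?thesis by (simp add: norm_vec_def L2_set_def sum_nonneg)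
qed

lemma dirichlet_kernel_diag:
  assumes "(z :: complex ^ 'd::finite) \<in> ball 0 1"
  shows "dirichlet_kernel z z = of_real (kdiag ((norm z)\<^sup>2))"
proof -
  have s: "0 \<le> (norm z)\<^sup>2" "(norm z)\<^sup>2 < 1" using assms by (auto simp: power_less_one_iff abs_less_iff)
  have "(\<lambda>n. of_real (dir_a n * ((norm z)\<^sup>2) ^ n) :: complex) sums of_real (kdiag ((norm z)\<^sup>2))"
    unfolding kdiag_def using summable_sums[OF kdiag_summable[OF s]] by (rule sums_of_real)
  then show ?thesis unfolding dirichlet_kernel_def hdot_self by (simp add: sums_iff)
qed

section \<open>Submodules that do not vanish on a disc\<close>

text \<open>
  A space \<open>M\<close> whose kernel on the diagonal is \<open>K G\<close> with \<open>G = \<Sum> |\<phi>\<^sub>e|\<^sup>2\<close>. Invariance is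
  stated for multiplication by \<open>z\<^sub>i\<close>, a condition that is easy to follow through a unitary change of
  variables. Closedness enters through the existence of the kernel elements \<open>k\<close>.
\<close>
locale kernel_factor = dirichlet_module D ip
  for D :: "(complex ^ 'd::finite \<Rightarrow> complex) set" and ip +
  fixes M :: "(complex ^ 'd \<Rightarrow> complex) set" and i :: 'd
    and E :: "'e set" and \<phi> :: "'e \<Rightarrow> nat ^ 'd \<Rightarrow> complex"
  assumes M_sub: "M \<subseteq> D" "cfun.subspace M"
    and M_mult: "\<And>f. f \<in> M \<Longrightarrow> mi_monom (axis i 1) * f \<in> M"
    and E: "finite E" and \<phi>: "\<And>e. e \<in> E \<Longrightarrow> \<phi> e \<in> wl2 wt"
    and ker: "\<And>z. z \<in> ball 0 1 \<Longrightarrow> \<exists>k\<in>M. (\<forall>f\<in>M. ip f k = f z) \<and>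
      k z = dirichlet_kernel z z * of_real (\<Sum>e\<in>E. (cmod (psum (\<phi> e) z))\<^sup>2)"
begin

definition G :: "complex ^ 'd \<Rightarrow> real" where "G z = (\<Sum>e\<in>E. (cmod (psum (\<phi> e) z))\<^sup>2)"

lemma G_nonneg: "G z \<ge> 0" by (simp add: G_def sum_nonneg)

lemma ball_axis: "norm x < 1 \<Longrightarrow> (axis i x :: complex ^ 'd) \<in> ball 0 1"
  by simp

lemma obtain_kernel:
  assumes z: "z \<in> ball 0 1"
  obtains k where "k \<in> M" "\<forall>f\<in>M. ip f k = f z" "k z = of_real (kdiag ((norm z)\<^sup>2) * G z)"
    "(hilb.nrm k)\<^sup>2 = kdiag ((norm z)\<^sup>2) * G z"
proof -
  obtain k where k: "k \<in> M" "\<forall>f\<in>M. ip f k = f z" "k z = dirichlet_kernel z z * of_real (G z)"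
    using ker[OF z] unfolding G_def by blast
  then have kz: "k z = of_real (kdiag ((norm z)\<^sup>2) * G z)" by (simp add: dirichlet_kernel_diag[OF z])
  have "(hilb.nrm k)\<^sup>2 = Re (ip k k)" using k M_sub by (intro hilb.nrm_square) auto
  moreover have "ip k k = k z" using k by blast
  ultimately have "(hilb.nrm k)\<^sup>2 = kdiag ((norm z)\<^sup>2) * G z" by (simp only: kz Re_complex_of_real)
  then show ?thesis using that k kz by blast
qed

lemma eval_bound:
  assumes z: "z \<in> ball 0 1" and f: "f \<in> M"
  shows "(cmod (f z))\<^sup>2 \<le> (hilb.nrm f)\<^sup>2 * (kdiag ((norm z)\<^sup>2) * G z)"
proof -
  obtain k where k: "k \<in> M" "\<forall>f\<in>M. ip f k = f z" "k z = of_real (kdiag ((norm z)\<^sup>2) * G z)"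
     "(hilb.nrm k)\<^sup>2 = kdiag ((norm z)\<^sup>2) * G z"
    by (rule obtain_kernel[OF z])
  have "cmod (f z) \<le> hilb.nrm f * hilb.nrm k"
    using hilb.Cauchy_Schwarz[OF subsetD[OF M_sub(1) f] subsetD[OF M_sub(1) k(1)]] k(2)[rule_format, OF f] by simp
  then have "(cmod (f z))\<^sup>2 \<le> (hilb.nrm f * hilb.nrm k)\<^sup>2" by (rule power_mono) simp
  then show ?thesis by (simp add: power_mult_distrib k(4))
qed

lemma kdiag_norm_pos: "z \<in> ball 0 1 \<Longrightarrow> kdiag ((norm z)\<^sup>2) > 0"
  by (rule kdiag_pos) (auto simp: power_less_one_iff abs_less_iff)

lemma nrm_kfun: "z \<in> ball 0 1 \<Longrightarrow> (hilb.nrm (kfun z))\<^sup>2 = kdiag ((norm z)\<^sup>2)"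
proof -
  assume z: "z \<in> ball 0 1"
  have "ip (kfun z) (kfun z) = kfun z z" by (rule ip_kfun[OF kfun_mem[OF z] z])
  also have "\<dots> = of_real (kdiag ((norm z)\<^sup>2))" using z dirichlet_kernel_diag[OF z] by (simp add: kfun_def)
  finally show ?thesis using hilb.nrm_square[OF kfun_mem[OF z]] by simp
qed

text \<open>
  \<open>K (1 - G)\<close> is the kernel of the orthogonal complement.
\<close>
lemma complement_eval_bound:
  assumes z: "z \<in> ball 0 1" and h: "h \<in> D" and perp: "\<And>m. m \<in> M \<Longrightarrow> ip h m = 0"
  shows "(cmod (h z))\<^sup>2 \<le> (hilb.nrm h)\<^sup>2 * (kdiag ((norm z)\<^sup>2) * (1 - G z))"
proof -
  obtain k where k: "k \<in> M" "\<forall>f\<in>M. ip f k = f z" "k z = of_real (kdiag ((norm z)\<^sup>2) * G z)"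
     "(hilb.nrm k)\<^sup>2 = kdiag ((norm z)\<^sup>2) * G z"
    by (rule obtain_kernel[OF z])
  have kD: "k \<in> D" using k M_sub by auto
  have kfun: "kfun z \<in> D" by (rule kfun_mem[OF z])
  have "ip h (kfun z - k) = ip h (kfun z) - ip h k" by (rule hilb.diff_right[OF kfun kD h])
  then have "h z = ip h (kfun z - k)" using ip_kfun[OF h z] perp[OF k(1)] by simp
  then have "cmod (h z) \<le> hilb.nrm h * hilb.nrm (kfun z - k)"
    using hilb.Cauchy_Schwarz[OF h hilb.mem_diff[OF kfun kD]] by simp
  then have "(cmod (h z))\<^sup>2 \<le> (hilb.nrm h * hilb.nrm (kfun z - k))\<^sup>2" by (rule power_mono) simp
  also have "\<dots> = (hilb.nrm h)\<^sup>2 * (hilb.nrm (kfun z - k))\<^sup>2" by (simp only: power_mult_distrib)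
  also have "(hilb.nrm (kfun z - k))\<^sup>2 = kdiag ((norm z)\<^sup>2) - 2 * (kdiag ((norm z)\<^sup>2) * G z) + kdiag ((norm z)\<^sup>2) * G z"
    using hilb.nrm_diff_square[OF kfun kD] ip_kfun_left[OF kD z] nrm_kfun[OF z] k(3,4) by simp
  also have "\<dots> = kdiag ((norm z)\<^sup>2) * (1 - G z)" by (simp add: algebra_simps)
  finally show ?thesis .
qed

text \<open>
  The kernel function of \<open>M\<close> at \<open>z\<close> is a projection of that of \<open>D\<close>.
\<close>
lemma G_le_1: assumes z: "z \<in> ball 0 1" shows "G z \<le> 1"
proof -
  obtain k where k: "k \<in> M" "\<forall>f\<in>M. ip f k = f z" "k z = of_real (kdiag ((norm z)\<^sup>2) * G z)"
     "(hilb.nrm k)\<^sup>2 = kdiag ((norm z)\<^sup>2) * G z"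
    by (rule obtain_kernel[OF z])
  have kD: "k \<in> D" using k M_sub by auto
  have "cmod (k z) \<le> hilb.nrm k * hilb.nrm (kfun z)"
    using hilb.Cauchy_Schwarz[OF kD kfun_mem[OF z]] ip_kfun[OF kD z] by simp
  then have "(cmod (k z))\<^sup>2 \<le> (hilb.nrm k * hilb.nrm (kfun z))\<^sup>2" by (rule power_mono) simp
  also have "\<dots> = (kdiag ((norm z)\<^sup>2))\<^sup>2 * G z"
    by (simp add: power_mult_distrib k(4) nrm_kfun[OF z]) (simp add: power2_eq_square)
  finally have "(kdiag ((norm z)\<^sup>2))\<^sup>2 * (G z)\<^sup>2 \<le> (kdiag ((norm z)\<^sup>2))\<^sup>2 * G z"
    by (simp add: k(3) power_mult_distrib norm_mult)
  then have "(G z)\<^sup>2 \<le> G z" using kdiag_norm_pos[OF z] by simp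
  then show ?thesis using G_nonneg[of z] by (cases "G z = 0") (auto simp: power2_eq_square)
qed

abbreviation g :: "'e \<Rightarrow> nat \<Rightarrow> complex" where "g e \<equiv> slice i (\<phi> e)"

lemma G_axis: "norm x < 1 \<Longrightarrow> G (axis i x) = (\<Sum>e\<in>E. (cmod (pser (g e) x))\<^sup>2)"
  unfolding G_def by (intro sum.cong refl) (simp add: psum_at_axis \<phi>)

lemma g_hardy: "e \<in> E \<Longrightarrow> g e \<in> hardy"
  by (rule slice_summable(2)[OF \<phi>])

lemma g_contractive: "norm x < 1 \<Longrightarrow> (\<Sum>e\<in>E. (cmod (pser (g e) x))\<^sup>2) \<le> 1"
  using G_le_1[OF ball_axis] G_axis by simp

lemma M_mult_power: "f \<in> M \<Longrightarrow> mi_monom (axis i n) * f \<in> M"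
proof (induction n)
  case 0
  have "mi_monom (axis i 0) * f = f" by (auto simp: fun_eq_iff)
  then show ?case using 0 by simp
next
  case (Suc n)
  have "mi_monom (axis i (Suc n)) * f = mi_monom (axis i 1) * (mi_monom (axis i n) * f)"
    by (auto simp: fun_eq_iff mult_ac)
  then show ?case using M_mult[OF Suc.IH[OF Suc.prems]] by (simp only:)
qed

text \<open>
  Test the evaluation bound on \<open>h\<^sub>t = f \<Sum>\<^sub>n (r\<^sup>n / (n+1)) e\<^sup>-\<^sup>i\<^sup>n\<^sup>t z\<^sub>i\<^sup>n\<close>, that is, \<open>f\<close> times a piece of the kernel at
  the point \<open>z\<^sub>i = r e\<^sup>i\<^sup>t\<close>, and integrate over \<open>t\<close>. The terms of \<open>h\<^sub>t\<close> become orthogonal in the mean,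
  and the growth hypothesis turns \<open>\<parallel>h\<^sub>t\<parallel>\<^sup>2\<close> into \<open>B\<close> times the truncated kernel \<open>s N\<close>. The pointwise step
  uses \<open>G \<le> 1\<close> to pass from \<open>|f|\<^sup>2 \<le> a G\<close> to \<open>(1 - G) |f|\<^sup>2 \<le> a - |f|\<^sup>2\<close>.
\<close>
lemma circle_inequality:
  assumes c: "c \<in> wl2 wt" "psum c \<in> M" and r: "0 < r" "r < 1"
    and n0: "\<And>n. n \<ge> n0 \<Longrightarrow> (ip_norm (wip wt) (shift (axis i n) c))\<^sup>2 \<le> (real n + 1) * B"
  defines "s \<equiv> \<lambda>N. \<Sum>n\<in>{n0..<N}. dir_a n * (r\<^sup>2) ^ n"
  shows "s N * (2 * (\<Sum>n. (cmod (slice i c n))\<^sup>2 * r ^ (2 * n)) -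
     (\<Sum>e\<in>E. \<Sum>n. (cmod (conv (g e) (slice i c) n))\<^sup>2 * r ^ (2 * n))) \<le> kdiag (r\<^sup>2) * B"
proof -
  define f where "f = psum c"
  define v where "v n = mi_monom (axis i n) * f" for n
  define a where "a n = dir_a n * r ^ n" for n
  let ?A = "{n0..<N}"
  let ?p = "\<lambda>t. axis i (of_real r * circ t) :: complex ^ 'd"
  let ?H = "\<lambda>t. \<Sum>n\<in>?A. (\<lambda>x. (of_real (a n) * cnj (circ t) ^ n) * v n x)"
  have nr: "norm (of_real r * circ t) = r" for t using r by (simp add: norm_mult)
  have pb: "?p t \<in> ball 0 1" for t using nr r by (intro ball_axis) simp
  have r0: "0 \<le> r" using r by simp
  have vM: "v n \<in> M" for n unfolding v_def f_def by (rule M_mult_power[OF c(2)])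
  have vD: "v n \<in> D" for n using vM M_sub by auto
  have HM: "?H t \<in> M" for t
    by (rule cfun.subspace_sum[OF M_sub(2)], rule cfun.subspace_scale[OF M_sub(2) vM])
  have Hval: "?H t (?p t) = f (?p t) * of_real (s N)" for t
  proof -
    have "(of_real (a n) * cnj (circ t) ^ n) * v n (?p t) = f (?p t) * of_real (dir_a n * (r\<^sup>2) ^ n)" for n
    proof -
      have "cnj (circ t) ^ n * circ t ^ n = 1"
        by (simp flip: power_mult_distrib add: complex_mult_cnj mult.commute[of "cnj _"])
      then have "cnj (circ t) ^ n * (circ t ^ n * y) = y" for y by (simp flip: mult.assoc)
      then show ?thesis
        by (simp add: v_def a_def power_mult_distrib mult_ac power2_eq_square)
    qed
    then show ?thesis by (simp add: sum_fun_apply s_def sum_distrib_left)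
  qed
  have pt: "(2 * (cmod (f (?p t)))\<^sup>2 - G (?p t) * (cmod (f (?p t)))\<^sup>2) * (s N)\<^sup>2 \<le> kdiag (r\<^sup>2) * (hilb.nrm (?H t))\<^sup>2" for t
  proof -
    define X where "X = kdiag (r\<^sup>2) * (hilb.nrm (?H t))\<^sup>2"
    define u where "u = (cmod (f (?p t)))\<^sup>2 * (s N)\<^sup>2"
    define q where "q = G (?p t)"
    have q: "0 \<le> q" "q \<le> 1" using G_nonneg G_le_1[OF pb] by (auto simp: q_def)
    have "(cmod (?H t (?p t)))\<^sup>2 \<le> (hilb.nrm (?H t))\<^sup>2 * (kdiag (r\<^sup>2) * q)"
      using eval_bound[OF pb HM, of t] nr r by (simp add: q_def norm_mult)
    then have u: "u \<le> X * q"
      unfolding Hval by (simp add: u_def X_def norm_mult power_mult_distrib mult_ac)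
    have "0 \<le> u" by (simp add: u_def)
    have "X \<ge> 0" unfolding X_def using kdiag_pos[of "r\<^sup>2"] r by (intro mult_nonneg_nonneg) (auto simp: power_less_one_iff)
    then have "X * q \<le> X" using q by (simp add: mult_left_le)
    have "(1 - q) * u \<le> (1 - q) * X" using q u \<open>X * q \<le> X\<close> by (intro mult_left_mono) auto
    then have "2 * u - q * u \<le> X" using u by (simp add: algebra_simps)
    then show ?thesis by (simp add: u_def X_def q_def algebra_simps)
  qed
  let ?h = "slice i c"
  have hh: "?h \<in> hardy" by (rule slice_summable(2)[OF c(1)])
  have fval: "f (?p t) = pser ?h (of_real r * circ t)" for t
    unfolding f_def by (rule psum_at_axis[OF c(1)]) (use nr r in simp)
  have Gval: "G (?p t) = (\<Sum>e\<in>E. (cmod (pser (g e) (of_real r * circ t)))\<^sup>2)" for t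
    by (rule G_axis) (use nr r in simp)
  have I1: "((\<lambda>t. (2 * (cmod (f (?p t)))\<^sup>2 - G (?p t) * (cmod (f (?p t)))\<^sup>2) * (s N)\<^sup>2) has_integral
     (2 * (\<Sum>n. (cmod (?h n))\<^sup>2 * r ^ (2 * n)) - (\<Sum>e\<in>E. \<Sum>n. (cmod (conv (g e) ?h n))\<^sup>2 * r ^ (2 * n))) * (s N)\<^sup>2) {0..1}"
    unfolding fval Gval sum_distrib_right
    by (intro has_integral_mult_left has_integral_diff has_integral_mult_right has_integral_sum E
        circ_mean_pser(1)[OF hh r0 r(2)] circ_mean_conv(1)[OF g_hardy hh r0 r(2)])
  have I2: "((\<lambda>t. kdiag (r\<^sup>2) * (hilb.nrm (?H t))\<^sup>2) has_integral kdiag (r\<^sup>2) * (\<Sum>n\<in>?A. (a n)\<^sup>2 * (hilb.nrm (v n))\<^sup>2)) {0..1}"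
    by (intro has_integral_mult_right hilb.circ_mean_nrm vD) simp
  have kkp: "kdiag (r\<^sup>2) > 0" using r by (intro kdiag_pos) (auto simp: power_less_one_iff)
  have s0: "0 \<le> s N" unfolding s_def by (intro sum_nonneg) auto
  have "(2 * (\<Sum>n. (cmod (?h n))\<^sup>2 * r ^ (2 * n)) - (\<Sum>e\<in>E. \<Sum>n. (cmod (conv (g e) ?h n))\<^sup>2 * r ^ (2 * n))) * (s N)\<^sup>2
    \<le> kdiag (r\<^sup>2) * (\<Sum>n\<in>?A. (a n)\<^sup>2 * (hilb.nrm (v n))\<^sup>2)"
    by (rule has_integral_le[OF I1 I2]) (rule pt)
  also have "\<dots> \<le> kdiag (r\<^sup>2) * (\<Sum>n\<in>?A. dir_a n * (r\<^sup>2) ^ n * B)"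
  proof (intro mult_left_mono sum_mono)
    fix n assume n: "n \<in> ?A"
    have "v n = psum (shift (axis i n) c)" unfolding v_def f_def by (rule psum_shift[OF c(1), symmetric])
    then have "(hilb.nrm (v n))\<^sup>2 \<le> (real n + 1) * B"
      using n0[of n] n nrm_psum[OF shift_mem(1)[OF c(1)], of "axis i n"] by simp
    then have "(a n)\<^sup>2 * (hilb.nrm (v n))\<^sup>2 \<le> (a n)\<^sup>2 * ((real n + 1) * B)" by (rule mult_left_mono) simp
    also have "(a n)\<^sup>2 * ((real n + 1) * B) = dir_a n * (r\<^sup>2) ^ n * B"
      by (simp add: a_def power_mult_distrib power_divide) (simp add: power2_eq_square power_mult_distrib)
    finally show "(a n)\<^sup>2 * (hilb.nrm (v n))\<^sup>2 \<le> dir_a n * (r\<^sup>2) ^ n * B" .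
  qed (use kkp in simp)
  also have "\<dots> = kdiag (r\<^sup>2) * B * s N" by (simp add: s_def sum_distrib_left sum_distrib_right mult_ac)
  finally have fin: "(2 * (\<Sum>n. (cmod (?h n))\<^sup>2 * r ^ (2 * n)) - (\<Sum>e\<in>E. \<Sum>n. (cmod (conv (g e) ?h n))\<^sup>2 * r ^ (2 * n))) * (s N)\<^sup>2
    \<le> kdiag (r\<^sup>2) * B * s N" (is "?L * _ \<le> _") .
  show ?thesis
  proof (cases "N \<le> n0")
    case True
    then have "s N = 0" by (simp add: s_def)
    moreover have "B \<ge> 0"
      using n0[of n0] order_trans[OF zero_le_power2 n0[of n0]] by (simp add: zero_le_mult_iff)
    ultimately show ?thesis using kkp by simp
  next
    case False
    then have "s N > 0" unfolding s_def using r by (intro sum_pos) auto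
    then show ?thesis using fin by (simp add: power2_eq_square mult_ac)
  qed
qed

text \<open>
  The limit of \<open>circle_inequality\<close>. By \<open>shift_norm_growth\<close> the constant \<open>B\<close> may be taken as close to
  the Hardy space norm as desired, at the cost of dropping \<open>n0\<close> terms of the kernel; this loss is
  bounded, whereas \<open>K\<close> tends to infinity.
\<close>
lemma critical_inequality:
  assumes c: "c \<in> wl2 wt" "psum c \<in> M"
  shows "nsq (slice i c) \<le> (\<Sum>e\<in>E. nsq (conv (g e) (slice i c)))"
proof -
  let ?h = "slice i c"
  define A where "A = nsq ?h"
  define Q where "Q = (\<Sum>e\<in>E. nsq (conv (g e) ?h))"
  have hh: "?h \<in> hardy" by (rule slice_summable(2)[OF c(1)])
  have A0: "A \<ge> 0" unfolding A_def by (rule nsq_nonneg[OF hh])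
  have cH: "e \<in> E \<Longrightarrow> conv (g e) ?h \<in> hardy" for e
    by (rule column_contraction(1)[OF E g_hardy g_contractive hh])
  have "A \<le> Q + \<epsilon>" if eps: "\<epsilon> > 0" for \<epsilon>
  proof -
    obtain n0 where n0: "\<And>n. n \<ge> n0 \<Longrightarrow> (ip_norm (wip wt) (shift (axis i n) c))\<^sup>2 \<le> (real n + 1) * (A + \<epsilon>)"
      using shift_norm_growth[OF c(1) eps, of i] unfolding A_def by blast
    \<comment> \<open>The radii for which \<open>kdiag_lower\<close> bounds the kernel from below.\<close>
    define r where "r m = 1 - 1 / (4 * (real m + 1))" for m :: nat
    have r: "0 < r m" "r m < 1" for m by (auto simp: r_def field_simps)
    have r2: "0 \<le> (r m)\<^sup>2" "(r m)\<^sup>2 < 1" for m using r[of m] by (auto simp: power_less_one_iff abs_less_iff)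
    define P where "P m = (\<Sum>n. (cmod (?h n))\<^sup>2 * r m ^ (2 * n))" for m
    have PA: "0 \<le> P m" "P m \<le> A" for m
      unfolding P_def A_def using circ_mean_pser(2,3)[OF hh less_imp_le[OF r(1)[of m]] r(2)] r[of m]
      by (auto intro!: suminf_nonneg)
    have main: "2 * P m - Q - A - \<epsilon> \<le> real n0 * (2 * A) / kdiag ((r m)\<^sup>2)" for m
    proof -
      define q where "q = (\<Sum>e\<in>E. \<Sum>n. (cmod (conv (g e) ?h n))\<^sup>2 * r m ^ (2 * n))"
      have qQ: "q \<le> Q" "0 \<le> q" unfolding q_def Q_def
        using circ_mean_pser(2,3)[OF cH less_imp_le[OF r(1)[of m]] r(2)] r[of m]
        by (auto intro!: sum_mono sum_nonneg suminf_nonneg)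
      define K where "K = kdiag ((r m)\<^sup>2)"
      have K: "K > 0" unfolding K_def by (rule kdiag_pos[OF r2])
      define \<kappa> where "\<kappa> = (\<Sum>n<n0. dir_a n * ((r m)\<^sup>2) ^ n)"
      have \<kappa>: "0 \<le> \<kappa>" "\<kappa> \<le> real n0"
      proof -
        show "0 \<le> \<kappa>" unfolding \<kappa>_def by (intro sum_nonneg) auto
        have "\<kappa> \<le> (\<Sum>n<n0. 1)" unfolding \<kappa>_def using r2[of m]
          by (intro sum_mono mult_le_one power_le_one[OF r2(1) less_imp_le[OF r2(2)]]) auto
        then show "\<kappa> \<le> real n0" by simp
      qed
      have "(\<lambda>N. \<Sum>n\<in>{n0..<N}. dir_a n * ((r m)\<^sup>2) ^ n) \<longlonglongrightarrow> K - \<kappa>"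
      proof (rule Lim_transform_eventually)
        show "(\<lambda>N. (\<Sum>n<N. dir_a n * ((r m)\<^sup>2) ^ n) - \<kappa>) \<longlonglongrightarrow> K - \<kappa>"
          unfolding K_def kdiag_def by (intro tendsto_diff summable_LIMSEQ kdiag_summable r2 tendsto_const)
        have "(\<Sum>n<N. dir_a n * ((r m)\<^sup>2) ^ n) - \<kappa> = (\<Sum>n\<in>{n0..<N}. dir_a n * ((r m)\<^sup>2) ^ n)" if "N \<ge> n0" for N
        proof -
          have "{..<N} = {..<n0} \<union> {n0..<N}" using that by auto
          then show ?thesis unfolding \<kappa>_def by (simp add: sum.union_disjoint ivl_disj_int)
        qed
        then show "\<forall>\<^sub>F N in sequentially. (\<Sum>n<N. dir_a n * ((r m)\<^sup>2) ^ n) - \<kappa> = (\<Sum>n\<in>{n0..<N}. dir_a n * ((r m)\<^sup>2) ^ n)"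
          by (auto simp: eventually_sequentially)
      qed
      then have "(\<lambda>N. (\<Sum>n\<in>{n0..<N}. dir_a n * ((r m)\<^sup>2) ^ n) * (2 * P m - q)) \<longlonglongrightarrow> (K - \<kappa>) * (2 * P m - q)"
        by (intro tendsto_intros)
      then have "(K - \<kappa>) * (2 * P m - q) \<le> K * (A + \<epsilon>)"
        by (rule tendsto_upperbound)
          (use circle_inequality[OF c r(1)[of m] r(2)[of m] n0] in \<open>auto simp: P_def q_def K_def intro!: always_eventually\<close>)
      then have "K * (2 * P m - q - A - \<epsilon>) \<le> \<kappa> * (2 * P m - q)" by (simp add: algebra_simps)
      also have "\<dots> \<le> \<kappa> * (2 * A)" using \<kappa> PA(2)[of m] qQ by (intro mult_left_mono) auto
      also have "\<dots> \<le> real n0 * (2 * A)" using \<kappa> A0 by (intro mult_right_mono) auto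
      finally have "2 * P m - q - A - \<epsilon> \<le> real n0 * (2 * A) / K"
        using K by (simp add: le_divide_eq mult.commute)
      then show ?thesis using qQ by (simp add: K_def)
    qed
    have rl: "r \<longlonglongrightarrow> 1"
    proof -
      have "(\<lambda>m. 1 - (1/4) * (1 / (real m + 1))) \<longlonglongrightarrow> 1 - (1/4) * 0"
        using LIMSEQ_ignore_initial_segment[OF lim_1_over_n, of 1] by (intro tendsto_intros) (simp add: add_ac)
      moreover have "r = (\<lambda>m. 1 - (1/4) * (1 / (real m + 1)))" by (auto simp: r_def fun_eq_iff)
      ultimately show ?thesis by simp
    qed
    have kinf: "filterlim (\<lambda>m. kdiag ((r m)\<^sup>2)) at_top sequentially"
    proof (rule filterlim_at_top_mono)
      have "filterlim (\<lambda>m. real m + 1) at_top sequentially"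
        by (rule filterlim_at_top_mono[OF filterlim_real_sequentially]) simp
      then have "filterlim (\<lambda>m. ln (real m + 1)) at_top sequentially"
        by (rule filterlim_compose[OF ln_at_top])
      then show "filterlim (\<lambda>m. ln (real m + 1) / 2) at_top sequentially"
        by (rule filterlim_at_top_mult_tendsto_pos[OF tendsto_const[of "1/2"], simplified])
      show "\<forall>\<^sub>F m in sequentially. ln (real m + 1) / 2 \<le> kdiag ((r m)\<^sup>2)"
        using kdiag_lower unfolding r_def by (intro always_eventually allI)
    qed
    have rhs: "(\<lambda>m. real n0 * (2 * A) / kdiag ((r m)\<^sup>2)) \<longlonglongrightarrow> 0"
      by (rule tendsto_divide_0[OF tendsto_const filterlim_at_top_imp_at_infinity[OF kinf]])
    have partial: "2 * (\<Sum>n<N. (cmod (?h n))\<^sup>2) - Q - A - \<epsilon> \<le> 0" for N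
    proof (rule tendsto_le[OF _ rhs])
      have "(\<lambda>m. 2 * (\<Sum>n<N. (cmod (?h n))\<^sup>2 * r m ^ (2 * n)) - Q - A - \<epsilon>) \<longlonglongrightarrow> 2 * (\<Sum>n<N. (cmod (?h n))\<^sup>2 * 1 ^ (2 * n)) - Q - A - \<epsilon>"
        by (intro tendsto_intros rl)
      then show "(\<lambda>m. 2 * (\<Sum>n<N. (cmod (?h n))\<^sup>2 * r m ^ (2 * n)) - Q - A - \<epsilon>) \<longlonglongrightarrow> 2 * (\<Sum>n<N. (cmod (?h n))\<^sup>2) - Q - A - \<epsilon>" by simp
      have "2 * (\<Sum>n<N. (cmod (?h n))\<^sup>2 * r m ^ (2 * n)) - Q - A - \<epsilon> \<le> real n0 * (2 * A) / kdiag ((r m)\<^sup>2)" for m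
      proof -
        have "(\<Sum>n<N. (cmod (?h n))\<^sup>2 * r m ^ (2 * n)) \<le> P m"
          unfolding P_def using circ_mean_pser(2)[OF hh less_imp_le[OF r(1)[of m]] r(2)] r(1)[of m]
          by (intro sum_le_suminf) auto
        then show ?thesis using main[of m] by simp
      qed
      then show "\<forall>\<^sub>F m in sequentially. 2 * (\<Sum>n<N. (cmod (?h n))\<^sup>2 * r m ^ (2 * n)) - Q - A - \<epsilon> \<le> real n0 * (2 * A) / kdiag ((r m)\<^sup>2)"
        by (intro always_eventually allI)
    qed simp
    have "A \<le> (Q + A + \<epsilon>) / 2"
      unfolding A_def by (rule hardyI(2)) (use partial in \<open>simp add: A_def field_simps\<close>)
    then show ?thesis by simp
  qed
  then show ?thesis using field_le_epsilon unfolding A_def Q_def by blast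
qed

lemma inner_on_slice:
  assumes f: "f \<in> M" and x: "norm x < 1" "f (axis i x) \<noteq> 0"
  shows "1 \<le> (\<Sum>e\<in>E. nsq (g e))"
proof -
  define W where "W = {slice i c | c. c \<in> wl2 wt \<and> psum c \<in> M}"
  obtain c where c: "c \<in> wl2 wt" "f = psum c" using f M_sub obtain_coeffs by blast
  show ?thesis
  proof (rule inner_column[OF E g_hardy g_contractive, where W = W and F = "slice i c"])
    show "cfun.subspace W"
    proof (rule cfun.subspaceI)
      have "psum (0 :: nat ^ 'd \<Rightarrow> complex) = 0" using psum_diff[of 0 0] by simp
      then have "psum (0 :: nat ^ 'd \<Rightarrow> complex) \<in> M" using cfun.subspace_0[OF M_sub(2)] by (simp only:)
      then show "0 \<in> W" unfolding W_def slice_linear(3)[of i, symmetric] using Coeff.mem_0 by blast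
    next
      fix a b assume "a \<in> W" "b \<in> W"
      then obtain u v where uv: "a = slice i u" "b = slice i v" "u \<in> wl2 wt" "v \<in> wl2 wt" "psum u \<in> M" "psum v \<in> M"
        by (auto simp: W_def)
      have "psum (u + v) \<in> M" unfolding psum_add[OF uv(3,4)] by (rule cfun.subspace_add[OF M_sub(2) uv(5,6)])
      then show "a + b \<in> W" unfolding W_def uv slice_linear[symmetric] using Coeff.mem_add[OF uv(3,4)] by blast
    next
      fix b a assume "a \<in> W"
      then obtain u where u: "a = slice i u" "u \<in> wl2 wt" "psum u \<in> M" by (auto simp: W_def)
      have "psum (\<lambda>\<alpha>. b * u \<alpha>) \<in> M" unfolding psum_scale[OF u(2)] by (rule cfun.subspace_scale[OF M_sub(2) u(3)])
      then show "(\<lambda>n. b * a n) \<in> W" unfolding W_def u slice_linear[symmetric] using Coeff.mem_scale[OF u(2)] by blast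
    qed
    show "W \<subseteq> hardy" by (auto simp: W_def slice_summable)
    show "rshift h \<in> W" if "h \<in> W" for h
    proof -
      obtain u where u: "h = slice i u" "u \<in> wl2 wt" "psum u \<in> M" using \<open>h \<in> W\<close> by (auto simp: W_def)
      have "psum (shift (axis i 1) u) \<in> M" unfolding psum_shift[OF u(2)] by (rule M_mult[OF u(3)])
      then show ?thesis unfolding W_def u slice_shift[symmetric] using shift_mem(1)[OF u(2)] by blast
    qed
    show "slice i c \<in> W" using c f by (auto simp: W_def)
    show "slice i c \<noteq> 0"
    proof
      assume "slice i c = 0"
      then have "f (axis i x) = 0" using psum_at_axis[OF c(1) x(1), of i] by (simp add: c(2) pser_def)
      then show False using x(2) by simp
    qed
    show "nsq h \<le> (\<Sum>e\<in>E. nsq (conv (g e) h))" if "h \<in> W" for h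
      using that critical_inequality by (auto simp: W_def)
  qed
qed

text \<open>
  The circle means of \<open>1 - G\<close> are \<open>O(1 - r\<^sup>2)\<close>, since \<open>1 - r\<^sup>2\<^sup>n \<le> n (1 - r\<^sup>2)\<close> and the \<open>\<phi>\<^sub>e\<close> have
  \<open>\<Sum> (n + 1) |\<phi>\<^sub>e\<^sub>,\<^sub>n|\<^sup>2 < \<infinity>\<close> on the disc; the logarithmic growth of \<open>K\<close> does not make up for this.
  So \<open>h = 1 - k\<^sub>0\<close> has circle means tending to 0.
\<close>
theorem constants_in_M:
  assumes f: "f \<in> M" and x: "norm x < 1" "f (axis i x) \<noteq> 0"
  shows "kfun 0 \<in> M"
proof -
  have inner: "1 \<le> (\<Sum>e\<in>E. nsq (g e))" by (rule inner_on_slice[OF f x])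
  have b0: "(0 :: complex ^ 'd) \<in> ball 0 1" by simp
  obtain k where k: "k \<in> M" "\<forall>f\<in>M. ip f k = f 0"
    "k 0 = of_real (kdiag ((norm (0 :: complex ^ 'd))\<^sup>2) * G 0)" "(hilb.nrm k)\<^sup>2 = kdiag ((norm (0 :: complex ^ 'd))\<^sup>2) * G 0"
    by (rule obtain_kernel[OF b0])
  define h where "h = kfun 0 - k"
  have kD: "k \<in> D" using k M_sub by auto
  have kf0: "kfun 0 \<in> D" by (rule kfun_mem[OF b0])
  have hD: "h \<in> D" unfolding h_def by (rule hilb.mem_diff[OF kf0 kD])
  have perp: "ip h m = 0" if "m \<in> M" for m
  proof -
    have mD: "m \<in> D" using that M_sub by auto
    have "ip h m = ip (kfun 0) m - ip k m" unfolding h_def by (rule hilb.diff_left[OF kf0 kD mD])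
    also have "ip k m = cnj (m 0)" using hilb.commute[OF mD kD] k(2)[rule_format, OF that] by simp
    finally show ?thesis using ip_kfun_left[OF mD b0] by simp
  qed
  obtain d where d: "d \<in> wl2 wt" "h = psum d" using obtain_coeffs[OF hD] by blast
  define u where "u = slice i d"
  have uH: "u \<in> hardy" unfolding u_def by (rule slice_summable(2)[OF d(1)])
  have "h 0 = ip h (kfun 0)" using ip_kfun[OF hD b0] by simp
  also have "\<dots> = ip h h" using hilb.diff_right[OF kf0 kD hD] perp[OF k(1)] by (simp add: h_def)
  also have "\<dots> = of_real ((hilb.nrm h)\<^sup>2)" by (rule hilb.ip_self[OF hD])
  finally have h0: "h 0 = of_real ((hilb.nrm h)\<^sup>2)" .
  have "(axis i 0 :: nat ^ 'd) = 0" by (auto simp: vec_eq_iff axis_def)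
  then have "u 0 = d 0" unfolding u_def slice_def by (simp only:)
  then have u0: "u 0 = of_real ((hilb.nrm h)\<^sup>2)" using h0 psum_at_0[of d] by (simp only: d(2))
  define C where "C = (\<Sum>e\<in>E. \<Sum>n. (real n + 1) * (cmod (g e n))\<^sup>2)"
  have C0: "C \<ge> 0" unfolding C_def by (intro sum_nonneg suminf_nonneg slice_summable \<phi>) auto
  \<comment> \<open>Compare \<open>|h(0)|\<^sup>2\<close> with the mean of \<open>|h|\<^sup>2\<close> over the circle of radius \<open>r\<close>.\<close>
  have step: "(hilb.nrm h)\<^sup>2 * (hilb.nrm h)\<^sup>2 \<le> (hilb.nrm h)\<^sup>2 * (kdiag (r\<^sup>2) * ((1 - r\<^sup>2) * C))" if r: "0 \<le> r" "r < 1" for r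
  proof -
    let ?p = "\<lambda>t. axis i (of_real r * circ t) :: complex ^ 'd"
    have nr: "norm (of_real r * circ t) = r" for t using r by (simp add: norm_mult)
    have pb: "?p t \<in> ball 0 1" for t using nr r by (intro ball_axis) simp
    have r2: "0 \<le> r\<^sup>2" "r\<^sup>2 < 1" using r by (auto simp: power_less_one_iff abs_less_iff)
    have hval: "h (?p t) = pser u (of_real r * circ t)" for t
      unfolding d(2) u_def by (rule psum_at_axis[OF d(1)]) (use nr r in simp)
    have Gval: "G (?p t) = (\<Sum>e\<in>E. (cmod (pser (g e) (of_real r * circ t)))\<^sup>2)" for t
      by (rule G_axis) (use nr r in simp)
    define S where "S = (\<Sum>e\<in>E. \<Sum>n. (cmod (g e n))\<^sup>2 * r ^ (2 * n))"
    have "(cmod (u 0))\<^sup>2 = (\<Sum>n<1. (cmod (u n))\<^sup>2 * r ^ (2 * n))" by simp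
    also have "\<dots> \<le> (\<Sum>n. (cmod (u n))\<^sup>2 * r ^ (2 * n))"
      using circ_mean_pser(2)[OF uH r] r by (intro sum_le_suminf) auto
    also have "\<dots> \<le> (hilb.nrm h)\<^sup>2 * (kdiag (r\<^sup>2) * (1 - S))"
    proof (rule has_integral_le)
      show "((\<lambda>t. (cmod (h (?p t)))\<^sup>2) has_integral (\<Sum>n. (cmod (u n))\<^sup>2 * r ^ (2 * n))) {0..1}"
        unfolding hval by (rule circ_mean_pser(1)[OF uH r])
      have "((\<lambda>t. 1 - (\<Sum>e\<in>E. (cmod (pser (g e) (of_real r * circ t)))\<^sup>2)) has_integral (1 - S)) {0..1}"
        unfolding S_def
        using has_integral_const_real[of "1::real" 0 1]
        by (intro has_integral_diff has_integral_sum E circ_mean_pser(1)[OF g_hardy r]) simp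
      then show "((\<lambda>t. (hilb.nrm h)\<^sup>2 * (kdiag (r\<^sup>2) * (1 - G (?p t)))) has_integral (hilb.nrm h)\<^sup>2 * (kdiag (r\<^sup>2) * (1 - S))) {0..1}"
        unfolding Gval by (intro has_integral_mult_right)
      show "(cmod (h (?p t)))\<^sup>2 \<le> (hilb.nrm h)\<^sup>2 * (kdiag (r\<^sup>2) * (1 - G (?p t)))" for t
        using complement_eval_bound[OF pb hD perp, of t] nr r by (simp add: norm_mult)
    qed
    also have "\<dots> \<le> (hilb.nrm h)\<^sup>2 * (kdiag (r\<^sup>2) * ((1 - r\<^sup>2) * C))"
    proof (intro mult_left_mono)
      have "1 - S \<le> (\<Sum>e\<in>E. nsq (g e)) - S" using inner by simp
      also have "\<dots> = (\<Sum>e\<in>E. \<Sum>n. (cmod (g e n))\<^sup>2 - (cmod (g e n))\<^sup>2 * r ^ (2 * n))"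
        unfolding S_def nsq_def sum_subtractf[symmetric]
        using g_hardy circ_mean_pser(2)[OF g_hardy r] by (intro sum.cong refl suminf_diff) (auto simp: hardy_iff)
      also have "\<dots> \<le> (\<Sum>e\<in>E. \<Sum>n. (1 - r\<^sup>2) * ((real n + 1) * (cmod (g e n))\<^sup>2))"
      proof (intro sum_mono suminf_le)
        fix e n assume e: "e \<in> E"
        have "1 + real n * (r\<^sup>2 - 1) \<le> (1 + (r\<^sup>2 - 1)) ^ n" by (rule Bernoulli_inequality) (use r2 in simp)
        then have "1 - (r\<^sup>2) ^ n \<le> real n * (1 - r\<^sup>2)" by (simp add: algebra_simps)
        then have "1 - r ^ (2 * n) \<le> real n * (1 - r\<^sup>2)" by (simp only: power_mult)
        also have "\<dots> \<le> (real n + 1) * (1 - r\<^sup>2)" using r2 by (intro mult_right_mono) auto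
        finally have "(cmod (g e n))\<^sup>2 * (1 - r ^ (2 * n)) \<le> (cmod (g e n))\<^sup>2 * ((real n + 1) * (1 - r\<^sup>2))"
          by (rule mult_left_mono) simp
        then show "(cmod (g e n))\<^sup>2 - (cmod (g e n))\<^sup>2 * r ^ (2 * n) \<le> (1 - r\<^sup>2) * ((real n + 1) * (cmod (g e n))\<^sup>2)"
          by (simp add: algebra_simps)
        show "summable (\<lambda>n. (cmod (g e n))\<^sup>2 - (cmod (g e n))\<^sup>2 * r ^ (2 * n))"
          using g_hardy[OF e] circ_mean_pser(2)[OF g_hardy[OF e] r] by (intro summable_diff) (auto simp: hardy_iff)
        show "summable (\<lambda>n. (1 - r\<^sup>2) * ((real n + 1) * (cmod (g e n))\<^sup>2))"
          by (intro summable_mult slice_summable \<phi> e)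
      qed
      also have "\<dots> = (1 - r\<^sup>2) * C"
        unfolding C_def sum_distrib_left by (intro sum.cong refl suminf_mult slice_summable \<phi>)
      finally show "1 - S \<le> (1 - r\<^sup>2) * C" .
    qed (use kdiag_pos[OF r2] in auto)
    finally show ?thesis using u0 by (simp add: norm_mult power2_eq_square norm_power)
  qed
  have "h = 0"
  proof (rule ccontr)
    assume "h \<noteq> 0"
    then have np: "(hilb.nrm h)\<^sup>2 > 0" using hilb.nrm_eq_0[OF hD] by simp
    have le: "(hilb.nrm h)\<^sup>2 \<le> C * (1 / (real N + 1))" for N
    proof -
      define r where "r m = 1 - 1 / (real m + 1)" for m :: nat
      have r: "0 \<le> r m" "r m < 1" for m by (auto simp: r_def field_simps)
      have rl: "r \<longlonglongrightarrow> 1"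
      proof -
        have "(\<lambda>m. 1 - 1 / (real m + 1)) \<longlonglongrightarrow> 1 - 0"
          using LIMSEQ_ignore_initial_segment[OF lim_1_over_n, of 1] by (intro tendsto_intros) (simp add: add_ac)
        then show ?thesis by (simp add: r_def[abs_def])
      qed
      have "(\<lambda>m. (real N * (1 - (r m)\<^sup>2) + 1 / (real N + 1)) * C) \<longlonglongrightarrow> (real N * (1 - 1\<^sup>2) + 1 / (real N + 1)) * C"
        by (intro tendsto_intros rl)
      moreover have "(hilb.nrm h)\<^sup>2 \<le> (real N * (1 - (r m)\<^sup>2) + 1 / (real N + 1)) * C" for m
      proof -
        have r2: "0 \<le> (r m)\<^sup>2" "(r m)\<^sup>2 < 1" using r[of m] by (auto simp: power_less_one_iff abs_less_iff)
        have "(hilb.nrm h)\<^sup>2 \<le> kdiag ((r m)\<^sup>2) * ((1 - (r m)\<^sup>2) * C)"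
          using step[OF r, of m] np by (simp only: mult_le_cancel_left_pos)
        also have "\<dots> = (kdiag ((r m)\<^sup>2) * (1 - (r m)\<^sup>2)) * C" by simp
        also have "\<dots> \<le> (real N * (1 - (r m)\<^sup>2) + 1 / (real N + 1)) * C"
          by (rule mult_right_mono[OF kdiag_upper[OF r2] C0])
        finally show ?thesis .
      qed
      ultimately have "(hilb.nrm h)\<^sup>2 \<le> (real N * (1 - 1\<^sup>2) + 1 / (real N + 1)) * C"
        by (intro tendsto_lowerbound[of _ _ sequentially]) (auto intro: always_eventually)
      then show ?thesis by simp
    qed
    have "(\<lambda>N. C * (1 / (real N + 1))) \<longlonglongrightarrow> C * 0"
      using LIMSEQ_ignore_initial_segment[OF lim_1_over_n, of 1] by (intro tendsto_intros) (simp add: add_ac)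
    then have "(hilb.nrm h)\<^sup>2 \<le> C * 0"
      by (rule tendsto_lowerbound) (use le in \<open>auto intro!: always_eventually\<close>)
    then show False using np by simp
  qed
  then have "kfun 0 = k" by (simp add: h_def)
  then show ?thesis using k(1) by simp
qed

end

section \<open>The defect operator and the kernel of a submodule\<close>

context dirichlet_module
begin

lemma positive_self_adjoint:
  assumes M: "M \<subseteq> D" "cfun.subspace M" and T: "positive_op_on ip M T" and f: "f \<in> M" and g: "g \<in> M"
  shows "ip (T f) g = ip f (T g)"
proof -
  have TM: "T h \<in> M" if "h \<in> M" for h using T that by (auto simp: positive_op_on_def bounded_op_on_def)
  have Tadd: "T (h + k) = T h + T k" if "h \<in> M" "k \<in> M" for h k using T that unfolding positive_op_on_def bounded_op_on_def by blast
  have Tsc: "T (\<lambda>x. c * h x) = (\<lambda>x. c * T h x)" if "h \<in> M" for c h using T that unfolding positive_op_on_def bounded_op_on_def by blast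
  have real: "Im (ip (T h) h) = 0" if "h \<in> M" for h
    using T that unfolding positive_op_on_def by (auto simp: complex_nonneg_Reals_iff)
  have H: "h \<in> D" if "h \<in> M" for h using that M by auto
  have ig: "(\<lambda>x. \<i> * g x) \<in> M" by (rule cfun.subspace_scale[OF M(2) g])
  have expand: "ip (T (f + h)) (f + h) = ip (T f) f + ip (T f) h + ip (T h) f + ip (T h) h" if h: "h \<in> M" for h
  proof -
    have "ip (T (f + h)) (f + h) = ip (T f) (f + h) + ip (T h) (f + h)"
      unfolding Tadd[OF f h] by (rule ip_add) (use H TM f h in auto)
    then show ?thesis
      using hilb.add_right[OF H[OF f] H[OF h] H[OF TM[OF f]]] hilb.add_right[OF H[OF f] H[OF h] H[OF TM[OF h]]] by simp
  qed
  have 1: "Im (ip (T f) g + ip (T g) f) = 0"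
    using expand[OF g] real[OF f] real[OF g] real[OF cfun.subspace_add[OF M(2) f g]] by simp
  have a: "ip (T f) (\<lambda>x. \<i> * g x) = - \<i> * ip (T f) g" using hilb.scale_right[OF H[OF g] H[OF TM[OF f]], of \<i>] by simp
  have b: "ip (T (\<lambda>x. \<i> * g x)) f = \<i> * ip (T g) f"
    unfolding Tsc[OF g] by (rule ip_scale[OF H[OF TM[OF g]] H[OF f]])
  have 2: "Im (- \<i> * ip (T f) g + \<i> * ip (T g) f) = 0"
    using expand[OF ig] real[OF f] real[OF ig] real[OF cfun.subspace_add[OF M(2) f ig]] unfolding a b by simp
  have "ip f (T g) = cnj (ip (T g) f)" by (rule ip_commute[OF H[OF TM[OF g]] H[OF f]])
  then show ?thesis using 1 2 by (simp add: complex_eq_iff)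
qed

text \<open>
  \<open>K (1 - (1 - 1/K)) = 1\<close>, now for functions on the ball instead of formal power series.
\<close>
lemma dirichlet_b_kernel:
  assumes z: "z \<in> ball 0 1" and w: "w \<in> ball 0 1"
  shows "dirichlet_kernel z w * (1 - (\<Sum>n. of_real (dirichlet_b n) * hdot z w ^ n)) = (1 :: complex)"
proof -
  let ?u = "hdot z w"
  have b: "\<bar>dirichlet_b n\<bar> \<le> 1" for n using dirichlet_b_nonneg[of n] dirichlet_b_le_1[of n] by simp
  have s1: "summable (\<lambda>n. norm (of_real (dirichlet_b n) * ?u ^ n))" by (rule hdot_series(3)[OF z w b])
  have s2: "summable (\<lambda>n. norm (of_real (dir_a n) * ?u ^ n))" by (rule hdot_series(3)[OF z w]) simp
  have K: "dirichlet_kernel z w = (\<Sum>n. of_real (dir_a n) * ?u ^ n)" by (simp add: dirichlet_kernel_def)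
  have "(\<Sum>n. of_real (dirichlet_b n) * ?u ^ n) * dirichlet_kernel z w =
      (\<Sum>n. \<Sum>j\<le>n. (of_real (dirichlet_b j) * ?u ^ j) * (of_real (dir_a (n - j)) * ?u ^ (n - j)))"
    unfolding K by (rule Cauchy_product[OF s1 s2])
  also have "(\<lambda>n. \<Sum>j\<le>n. (of_real (dirichlet_b j) * ?u ^ j) * (of_real (dir_a (n - j)) * ?u ^ (n - j))) =
      (\<lambda>n. of_real (dir_a n) * ?u ^ n - (if n = 0 then 1 else 0))"
  proof (rule ext)
    fix n
    have "(\<Sum>j\<le>n. (of_real (dirichlet_b j) * ?u ^ j) * (of_real (dir_a (n - j)) * ?u ^ (n - j))) =
        (\<Sum>j\<le>n. of_real (dirichlet_b j * dir_a (n - j)) * ?u ^ n)"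
    proof (intro sum.cong refl)
      fix j assume "j \<in> {..n}"
      then have "?u ^ n = ?u ^ j * ?u ^ (n - j)" by (simp flip: power_add)
      then show "(of_real (dirichlet_b j) * ?u ^ j) * (of_real (dir_a (n - j)) * ?u ^ (n - j)) =
        of_real (dirichlet_b j * dir_a (n - j)) * ?u ^ n" by (simp add: mult_ac)
    qed
    also have "\<dots> = of_real (\<Sum>j\<le>n. dirichlet_b j * dir_a (n - j)) * ?u ^ n"
      by (simp only: of_real_sum sum_distrib_right)
    also have "\<dots> = of_real (dir_a n) * ?u ^ n - (if n = 0 then 1 else 0)"
      unfolding dirichlet_b_conv by (simp add: left_diff_distrib)
    finally show "(\<Sum>j\<le>n. (of_real (dirichlet_b j) * ?u ^ j) * (of_real (dir_a (n - j)) * ?u ^ (n - j))) =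
      of_real (dir_a n) * ?u ^ n - (if n = 0 then 1 else 0)" .
  qed
  also have "(\<Sum>n. of_real (dir_a n) * ?u ^ n - (if n = 0 then 1 else 0)) = dirichlet_kernel z w - 1"
  proof -
    have "(\<lambda>n. if n = 0 then 1 else 0 :: complex) sums 1" using sums_single[of 0 "\<lambda>_. 1 :: complex"] by simp
    moreover have "(\<lambda>n. of_real (dir_a n) * ?u ^ n) sums dirichlet_kernel z w"
      unfolding K by (rule summable_sums[OF summable_norm_cancel[OF s2]])
    ultimately have "(\<lambda>n. of_real (dir_a n) * ?u ^ n - (if n = 0 then 1 else 0)) sums (dirichlet_kernel z w - 1)"
      by (intro sums_diff)
    then show ?thesis by (rule sums_unique[symmetric])
  qed
  finally show ?thesis by (simp add: algebra_simps)
qed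

text \<open>
  The kernel element \<open>k\<close> at \<open>w\<close> is an eigenvector of all \<open>(R\<^sup>\<alpha>)\<^sup>*\<close>, so the defect identity evaluated at \<open>w\<close>
  sums to \<open>(\<Delta>\<^sup>2 k)(w) = k(w) / K(w,w)\<close>. The left side is \<open>\<parallel>\<Delta> k\<parallel>\<^sup>2\<close>, and Parseval's identity in the range of
  \<open>\<Delta>\<close> writes it as \<open>\<Sum> |\<langle>\<Delta> k, e\<rangle>|\<^sup>2 = \<Sum> |(\<Delta> e)(w)|\<^sup>2\<close>.
\<close>
lemma finite_defect_kernel:
  assumes M: "poly_submodule D ip M" and fd: "finite_defect ip M"
  shows "\<exists>(E :: (complex ^ 'd \<Rightarrow> complex) set) \<phi>. finite E \<and> \<phi> ` E \<subseteq> D \<and>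
     (\<forall>z\<in>ball 0 1. \<exists>k\<in>M. (\<forall>f\<in>M. ip f k = f z) \<and>
      k z = dirichlet_kernel z z * of_real (\<Sum>e\<in>E. (cmod (\<phi> e z))\<^sup>2))"
proof -
  have MD: "M \<subseteq> D" "cfun.subspace M" using M by (auto simp: poly_submodule_def)
  have HM: "h \<in> D" if "h \<in> M" for h using that MD by auto
  obtain \<Delta> where \<Delta>: "is_defect_operator ip M \<Delta>" "finite_rank_on M \<Delta>" using fd by (auto simp: finite_defect_def)
  have pos: "positive_op_on ip M \<Delta>" using \<Delta>(1) by (simp add: is_defect_operator_def)
  have \<Delta>M: "\<Delta> h \<in> M" if "h \<in> M" for h using pos that by (auto simp: positive_op_on_def bounded_op_on_def)
  have \<Delta>add: "\<Delta> (h + k) = \<Delta> h + \<Delta> k" if "h \<in> M" "k \<in> M" for h k using pos that unfolding positive_op_on_def bounded_op_on_def by blast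
  have \<Delta>sc: "\<Delta> (\<lambda>x. c * h x) = (\<lambda>x. c * \<Delta> h x)" if "h \<in> M" for c h using pos that unfolding positive_op_on_def bounded_op_on_def by blast
  define R where "R = \<Delta> ` M"
  have R: "cfun.subspace R"
  proof (rule cfun.subspaceI)
    have M0: "0 \<in> M" by (rule cfun.subspace_0[OF MD(2)])
    have eq: "(\<lambda>x. 0 * (0 :: complex ^ 'd \<Rightarrow> complex) x) = 0" by (rule ext) simp
    have "\<Delta> 0 = (\<lambda>x. 0 * \<Delta> 0 x)" using \<Delta>sc[OF M0, of 0] unfolding eq .
    also have "\<dots> = 0" by (rule ext) simp
    finally have "\<Delta> 0 = 0" .
    then show "0 \<in> R" unfolding R_def using M0 by (rule image_eqI[OF sym])
  next
    fix x y assume "x \<in> R" "y \<in> R"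
    then obtain a b where ab: "a \<in> M" "b \<in> M" "x = \<Delta> a" "y = \<Delta> b" by (auto simp: R_def)
    show "x + y \<in> R" unfolding R_def ab \<Delta>add[OF ab(1,2), symmetric] by (intro imageI cfun.subspace_add[OF MD(2)] ab)
  next
    fix c x assume "x \<in> R"
    then obtain a where a: "a \<in> M" "x = \<Delta> a" by (auto simp: R_def)
    show "(\<lambda>u. c * x u) \<in> R" unfolding R_def a \<Delta>sc[OF a(1), symmetric] by (intro imageI cfun.subspace_scale[OF MD(2)] a)
  qed
  have RM: "R \<subseteq> M" using \<Delta>M by (auto simp: R_def)
  obtain B where B: "finite B" "R \<subseteq> cfun.span B" using \<Delta>(2) by (auto simp: finite_rank_on_def R_def)
  obtain E where E: "finite E" "E \<subseteq> R" "\<And>r. r \<in> R \<Longrightarrow> (hilb.nrm r)\<^sup>2 = (\<Sum>e\<in>E. (cmod (ip r e))\<^sup>2)"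
    using hilb.finite_dim_parseval[OF R _ B] RM MD by blast
  have EM: "e \<in> M" if "e \<in> E" for e using that E RM by auto
  have ker: "\<exists>k\<in>M. (\<forall>f\<in>M. ip f k = f w) \<and> k w = dirichlet_kernel w w * of_real (\<Sum>e\<in>E. (cmod (\<Delta> e w))\<^sup>2)"
    if w: "w \<in> ball 0 1" for w
  proof -
    obtain k where k: "k \<in> M" "\<And>m. m \<in> M \<Longrightarrow> ip (kfun w - k) m = 0"
      using hilb.projection_exists[OF submodule_closed[OF M] kfun_mem[OF w]] by blast
    have kD: "k \<in> D" using HM k by blast
    have kfun: "kfun w \<in> D" by (rule kfun_mem[OF w])
    have rep: "ip f k = f w" if f: "f \<in> M" for f
    proof -
      have "ip f (kfun w - k) = 0"
        using hilb.commute[OF hilb.mem_diff[OF kfun kD] HM[OF f]] k(2)[OF f] by simp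
      then show ?thesis using hilb.diff_right[OF kfun kD HM[OF f]] ip_kfun[OF HM[OF f] w] by simp
    qed
    have adj: "adjoint_on ip M (\<lambda>g. mi_monom \<alpha> * g) k = (\<lambda>x. cnj (mi_monom \<alpha> w) * k x)" for \<alpha>
      unfolding adjoint_on_def
    proof (rule the_equality)
      let ?h = "\<lambda>x. cnj (mi_monom \<alpha> w) * k x"
      have hM: "?h \<in> M" by (rule cfun.subspace_scale[OF MD(2) k(1)])
      have *: "ip (mi_monom \<alpha> * f) k = ip f ?h" if f: "f \<in> M" for f
      proof -
        have "mi_monom \<alpha> * f \<in> M" using M f mi_monom_poly[of \<alpha>] unfolding poly_submodule_def by blast
        then have "ip (mi_monom \<alpha> * f) k = mi_monom \<alpha> w * f w" using rep by simp
        also have "\<dots> = ip f ?h" using hilb.scale_right[OF kD HM[OF f], of "cnj (mi_monom \<alpha> w)"] rep[OF f] by simp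
        finally show ?thesis .
      qed
      then show "?h \<in> M \<and> (\<forall>f\<in>M. ip (mi_monom \<alpha> * f) k = ip f ?h)" using hM by blast
      fix h assume h: "h \<in> M \<and> (\<forall>f\<in>M. ip (mi_monom \<alpha> * f) k = ip f h)"
      have dM: "h - ?h \<in> M" using h hM by (intro cfun.subspace_diff[OF MD(2)]) auto
      have "ip (h - ?h) (h - ?h) = ip (h - ?h) h - ip (h - ?h) ?h"
        by (rule hilb.diff_right) (use h hM dM HM in auto)
      also have "\<dots> = 0" using h * dM by simp
      finally have "h - ?h = 0" using ip_pos[OF HM[OF dM]] by force
      then show "h = ?h" by simp
    qed
    have sumk: "ip_has_sum ip (\<lambda>\<alpha> x. of_real (dirichlet_b_mi \<alpha>) * (mi_monom \<alpha> * (\<lambda>x. cnj (mi_monom \<alpha> w) * k x)) x)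
        (k - \<Delta> (\<Delta> k)) (- {0})"
      using \<Delta>(1) k(1) unfolding is_defect_operator_def adj[symmetric] by blast
    let ?t = "\<lambda>\<alpha> x. of_real (dirichlet_b_mi \<alpha>) * (mi_monom \<alpha> * (\<lambda>x. cnj (mi_monom \<alpha> w) * k x)) x"
    have "((\<lambda>F. sum ?t F w) \<longlongrightarrow> (k - \<Delta> (\<Delta> k)) w) (finite_subsets_at_top (- {0}))"
    proof (rule tendsto_pointwise[where f = "sum ?t"])
      show "ip_tendsto ip (sum ?t) (k - \<Delta> (\<Delta> k)) (finite_subsets_at_top (- {0}))"
        using sumk unfolding ip_has_sum_def .
      show "sum ?t F \<in> D" for F
        by (intro hilb.mem_sum hilb.mem_scale monom_mult_mem kD)
      show "k - \<Delta> (\<Delta> k) \<in> D" using HM \<Delta>M k(1) by auto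
    qed
    then have "((\<lambda>\<alpha>. ?t \<alpha> w) has_sum (k - \<Delta> (\<Delta> k)) w) (- {0})"
      unfolding has_sum_def by (simp only: sum_fun_apply)
    moreover have "((\<lambda>\<alpha>. ?t \<alpha> w) has_sum ((\<Sum>n. of_real (dirichlet_b n) * hdot w w ^ n) * k w)) (- {0})"
    proof -
      have b: "\<bar>dirichlet_b n\<bar> \<le> 1" for n using dirichlet_b_nonneg[of n] dirichlet_b_le_1[of n] by simp
      from has_sum_cmult_left[where c = "k w", OF hdot_series(2)[OF w w b]]
      show ?thesis
        by (rule has_sum_cong_neutral[THEN iffD1, rotated 3])
          (auto simp: dirichlet_b_mi_def multinom_def mult_ac)
    qed
    ultimately have "(k - \<Delta> (\<Delta> k)) w = (\<Sum>n. of_real (dirichlet_b n) * hdot w w ^ n) * k w"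
      by (rule has_sum_unique)
    then have "\<Delta> (\<Delta> k) w = (1 - (\<Sum>n. of_real (dirichlet_b n) * hdot w w ^ n)) * k w" by (simp add: algebra_simps)
    then have "dirichlet_kernel w w * \<Delta> (\<Delta> k) w =
        (dirichlet_kernel w w * (1 - (\<Sum>n. of_real (dirichlet_b n) * hdot w w ^ n))) * k w" by (simp add: mult.assoc)
    then have kw: "k w = dirichlet_kernel w w * \<Delta> (\<Delta> k) w" unfolding dirichlet_b_kernel[OF w w] by simp
    have sa: "ip (\<Delta> a) b = ip a (\<Delta> b)" if "a \<in> M" "b \<in> M" for a b
      by (rule positive_self_adjoint[OF MD pos that])
    have "\<Delta> (\<Delta> k) w = ip (\<Delta> (\<Delta> k)) k" using rep[OF \<Delta>M[OF \<Delta>M[OF k(1)]]] by simp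
    also have "\<dots> = ip (\<Delta> k) (\<Delta> k)" by (rule sa[OF \<Delta>M[OF k(1)] k(1)])
    also have "\<dots> = of_real ((hilb.nrm (\<Delta> k))\<^sup>2)" by (rule hilb.ip_self[OF HM[OF \<Delta>M[OF k(1)]]])
    also have "(hilb.nrm (\<Delta> k))\<^sup>2 = (\<Sum>e\<in>E. (cmod (ip (\<Delta> k) e))\<^sup>2)" by (rule E(3)) (use k in \<open>auto simp: R_def\<close>)
    also have "\<dots> = (\<Sum>e\<in>E. (cmod (\<Delta> e w))\<^sup>2)"
    proof (intro sum.cong refl)
      fix e assume e: "e \<in> E"
      have "ip (\<Delta> k) e = ip k (\<Delta> e)" by (rule sa[OF k(1) EM[OF e]])
      also have "\<dots> = cnj (\<Delta> e w)"
        using hilb.commute[OF HM[OF \<Delta>M[OF EM[OF e]]] kD] rep[OF \<Delta>M[OF EM[OF e]]] by simp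
      finally show "(cmod (ip (\<Delta> k) e))\<^sup>2 = (cmod (\<Delta> e w))\<^sup>2" by simp
    qed
    finally show ?thesis using k(1) rep kw by auto
  qed
  show ?thesis
  proof (rule exI[of _ E], rule exI[of _ \<Delta>], intro conjI)
    show "finite E" by (rule E(1))
    show "\<Delta> ` E \<subseteq> D" using \<Delta>M EM HM by auto
    show "\<forall>z\<in>ball 0 1. \<exists>k\<in>M. (\<forall>f\<in>M. ip f k = f z) \<and>
      k z = dirichlet_kernel z z * of_real (\<Sum>e\<in>E. (cmod (\<Delta> e z))\<^sup>2)"
      using ker by blast
  qed
qed

end

section \<open>Unitary invariance\<close>

lemma hdot_commute: "hdot y x = cnj (hdot x (y :: complex ^ 'd::finite))"
  by (simp add: hdot_def mult.commute)
lemma hdot_scale_left: "hdot (a *s x) z = a * hdot x (z :: complex ^ 'd::finite)"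
  by (simp add: hdot_def sum_distrib_left mult.assoc)
lemma hdot_diff_left: "hdot (x - y) z = hdot x z - hdot (y :: complex ^ 'd::finite) z"
  by (simp add: hdot_def left_diff_distrib sum_subtractf)
lemma hdot_diff_right: "hdot z (x - y) = hdot z x - hdot z (y :: complex ^ 'd::finite)"
  by (simp add: hdot_def right_diff_distrib sum_subtractf)
lemma hdot_scale_right: "hdot z (a *s x) = cnj a * hdot z (x :: complex ^ 'd::finite)"
  by (simp add: hdot_def sum_distrib_left mult_ac)

lemma hdot_axis_left: "hdot (axis i x) w = x * cnj ((w :: complex ^ 'd::finite) $ i)"
proof -
  have "hdot (axis i x) w = (\<Sum>j\<in>{i}. x * cnj (w $ j))"
    unfolding hdot_def by (rule sum.mono_neutral_cong_right) (auto simp: axis_def)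
  then show ?thesis by simp
qed

definition householder :: "complex ^ 'd::finite \<Rightarrow> complex ^ 'd \<Rightarrow> complex ^ 'd" where
  "householder v z = z - (2 / hdot v v * hdot z v) *s v"

text \<open>
  For \<open>hdot v v = 0\<close> the map is the identity, by the convention for division by zero.
\<close>
lemma householder_unitary: "hdot (householder v z) (householder v w) = hdot z (w :: complex ^ 'd::finite)"
proof (cases "hdot v v = 0")
  case True then show ?thesis by (simp add: householder_def)
next
  case False
  have "cnj (hdot v v) = hdot v v" by (simp add: hdot_self)
  then show ?thesis using False hdot_commute[of v w]
    by (simp add: householder_def hdot_diff_left hdot_diff_right hdot_scale_left hdot_scale_right field_simps)
qed

lemma householder_involution: "householder v (householder v z) = (z :: complex ^ 'd::finite)"
proof (cases "hdot v v = 0")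
  case True then show ?thesis by (simp add: householder_def)
next
  case False
  have "hdot (householder v z) v = - hdot z v"
    using False by (simp add: householder_def hdot_diff_left hdot_scale_left)
  then have "householder v (householder v z) = householder v z + (2 / hdot v v * hdot z v) *s v"
    unfolding householder_def[of v "householder v z"] by simp
  then show ?thesis by (simp add: householder_def)
qed

lemma householder_component:
  "householder v z $ i = (\<Sum>j\<in>UNIV. ((if j = i then 1 else 0) - 2 / hdot v v * cnj (v $ j) * v $ i) * (z :: complex ^ 'd::finite) $ j)"
proof -
  define c where "c = 2 / hdot v v"
  have "(\<Sum>j\<in>UNIV. ((if j = i then 1 else 0) - c * cnj (v $ j) * v $ i) * z $ j) =
    (\<Sum>j\<in>UNIV. (if j = i then z $ j else 0)) - (\<Sum>j\<in>UNIV. c * (z $ j * cnj (v $ j)) * v $ i)"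
    unfolding sum_subtractf[symmetric] by (intro sum.cong refl) (auto simp: left_diff_distrib)
  also have "\<dots> = z $ i - c * hdot z v * v $ i"
    by (simp add: hdot_def sum_distrib_left sum_distrib_right mult_ac)
  finally show ?thesis by (simp add: householder_def c_def)
qed

text \<open>
  The reflection in the hyperplane orthogonal to \<open>a - b\<close> exchanges \<open>a\<close> and \<open>b\<close> if they have equal norms and
  real inner product. The factor \<open>\<mu>\<close> makes the inner product of \<open>\<mu> z\<close> with the \<open>i\<close>-th axis real, and is
  undone at the end by linearity.
\<close>
lemma householder_reaches:
  fixes z :: "complex ^ 'd::finite"
  shows "\<exists>v x. householder v (axis i x) = z"
proof -
  define \<mu> where "\<mu> = (if z $ i = 0 then 1 else cnj (z $ i) / of_real (cmod (z $ i)))"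
  have mu: "cmod \<mu> = 1" by (auto simp: \<mu>_def norm_divide)
  then have mm: "cnj \<mu> * \<mu> = 1" using complex_norm_square[of \<mu>] by (simp add: mult.commute)
  define N where "N = norm z"
  define v where "v = axis i (of_real N) - \<mu> *s z"
  have zi: "\<mu> * z $ i = of_real (cmod (z $ i))"
    by (auto simp: \<mu>_def complex_norm_square[symmetric] power2_eq_square mult.commute[of "cnj _"] simp del: of_real_power)
  have zz: "hdot z z = of_real (N\<^sup>2)" by (simp add: hdot_self N_def)
  have zz': "hdot (\<mu> *s z) (\<mu> *s z) = of_real (N\<^sup>2)"
    unfolding hdot_scale_left hdot_scale_right zz using mm by (simp add: mult.assoc[symmetric] mult.commute[of \<mu>])
  have az: "hdot (axis i (of_real N)) (\<mu> *s z) = of_real (N * cmod (z $ i))"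
    unfolding hdot_axis_left using arg_cong[OF zi, of cnj] by simp
  have za: "hdot (\<mu> *s z) (axis i (of_real N)) = of_real (N * cmod (z $ i))"
    unfolding hdot_commute[of "\<mu> *s z"] az by simp
  have aa: "hdot (axis i (of_real N)) (axis i (of_real N) :: complex ^ 'd) = of_real (N\<^sup>2)"
    by (simp add: hdot_axis_left power2_eq_square)
  have vv: "hdot v v = 2 * of_real (N\<^sup>2 - N * cmod (z $ i))"
    unfolding v_def hdot_diff_left hdot_diff_right zz' az za aa by simp
  have av: "hdot (axis i (of_real N)) v = of_real (N\<^sup>2 - N * cmod (z $ i))"
    unfolding v_def hdot_diff_right az aa by simp
  have "householder v (axis i (of_real N)) = \<mu> *s z"
  proof (cases "hdot v v = 0")
    case True
    then have "norm v = 0" by (simp add: hdot_self)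
    then have "axis i (of_real N) = \<mu> *s z" by (simp add: v_def)
    then show ?thesis using True by (simp add: householder_def)
  next
    case False
    then have "2 / hdot v v * hdot (axis i (of_real N)) v = 1" unfolding vv av by (simp del: of_real_diff of_real_mult)
    then show ?thesis by (simp add: householder_def) (simp add: v_def)
  qed
  then have "householder v (cnj \<mu> *s axis i (of_real N)) = cnj \<mu> *s (\<mu> *s z)"
    by (simp add: householder_def hdot_scale_left vector_ssub_ldistrib[symmetric] vec_eq_iff algebra_simps)
  also have "cnj \<mu> *s (\<mu> *s z) = z" using mm by (simp add: vec_eq_iff mult.assoc[symmetric])
  also have "cnj \<mu> *s axis i (of_real N) = (axis i (cnj \<mu> * of_real N) :: complex ^ 'd)"
    by (simp add: vec_eq_iff axis_def)
  finally show ?thesis by blast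
qed

lemma householder_norm: "norm (householder v z) = norm (z :: complex ^ 'd::finite)"
proof -
  have "(of_real ((norm (householder v z))\<^sup>2) :: complex) = of_real ((norm z)\<^sup>2)"
    using householder_unitary[of v z z] unfolding hdot_self .
  then have "(norm (householder v z))\<^sup>2 = (norm z)\<^sup>2" by (simp only: of_real_eq_iff)
  then show ?thesis by (simp add: power2_eq_iff_nonneg)
qed

context dirichlet_module
begin

text \<open>
  Composition with a unitary reflection yields a space with the same kernel, hence the same space.
\<close>
lemma compose_householder:
  fixes v :: "complex ^ 'd"
  defines "C \<equiv> \<lambda>f :: complex ^ 'd \<Rightarrow> complex. \<lambda>z. f (householder v z)"
  shows "f \<in> D \<Longrightarrow> C f \<in> D" and "f \<in> D \<Longrightarrow> g \<in> D \<Longrightarrow> ip (C f) (C g) = ip f g"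
proof -
  have CC: "C (C f) = f" for f by (simp add: C_def householder_involution)
  have ball: "householder v z \<in> ball 0 1 \<longleftrightarrow> z \<in> ball 0 1" for z by (simp add: householder_norm)
  define D' where "D' = C ` D"
  define ip' where "ip' f g = ip (C f) (C g)" for f g
  have D'_iff: "f \<in> D' \<longleftrightarrow> C f \<in> D" for f unfolding D'_def using CC by (metis image_iff)
  have Cadd: "C (f + g) = C f + C g" and Cdiff: "C (f - g) = C f - C g" and Csc: "C (\<lambda>x. a * f x) = (\<lambda>x. a * C f x)" and C0: "C 0 = 0" for f g a
    by (auto simp: C_def fun_eq_iff)
  have nrm': "ip_norm ip' f = hilb.nrm (C f)" for f by (simp add: ip_norm_def ip'_def)
  have Ckf: "C (kfun (householder v w)) = kfun w" for w
    unfolding C_def kfun_def using ball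
    by (auto simp: fun_eq_iff dirichlet_kernel_def householder_unitary simp del: mem_ball)
  have "rkhs (ball 0 1) dirichlet_kernel D' ip'"
  proof
    show "cfun.subspace D'"
    proof (rule cfun.subspaceI)
      show "0 \<in> D'" unfolding D'_iff C0 by (rule hilb.mem_0)
    next
      fix x y assume "x \<in> D'" "y \<in> D'" then show "x + y \<in> D'" unfolding D'_iff Cadd by (rule hilb.mem_add)
    next
      fix c x assume "x \<in> D'" then show "(\<lambda>u. c * x u) \<in> D'" unfolding D'_iff Csc by (rule hilb.mem_scale)
    qed
  next
    fix f and x :: "complex ^ 'd" assume f: "f \<in> D'" and x: "x \<notin> ball 0 1"
    have "householder v x \<notin> ball 0 1" using x ball by blast
    then have "C f (householder v x) = 0" using f unfolding D'_iff by (intro vanishes_outside)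
    then show "f x = 0" by (simp add: C_def householder_involution)
  next
    fix f g h assume "f \<in> D'" "g \<in> D'" "h \<in> D'"
    then show "ip' (f + g) h = ip' f h + ip' g h" unfolding D'_iff ip'_def Cadd by (rule ip_add)
  next
    fix c f g assume "f \<in> D'" "g \<in> D'"
    then show "ip' (\<lambda>x. c * f x) g = c * ip' f g" unfolding D'_iff ip'_def Csc by (rule ip_scale)
  next
    fix f g assume "f \<in> D'" "g \<in> D'"
    then show "ip' g f = cnj (ip' f g)" unfolding D'_iff ip'_def by (rule ip_commute)
  next
    fix f assume f: "f \<in> D'" "f \<noteq> 0"
    have "C f \<noteq> 0" using f(2) CC[of f] C0 by metis
    then show "0 < Re (ip' f f)" using f(1) unfolding D'_iff ip'_def by (intro ip_pos)
  next
    fix f :: "nat \<Rightarrow> complex ^ 'd \<Rightarrow> complex"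
    assume f: "\<And>n. f n \<in> D'" and cau: "\<And>e. 0 < e \<Longrightarrow> \<exists>N. \<forall>m\<ge>N. \<forall>n\<ge>N. ip_norm ip' (f m - f n) < e"
    have "C (f n) \<in> D" for n using f unfolding D'_iff .
    then obtain g where g: "g \<in> D" "ip_tendsto ip (\<lambda>n. C (f n)) g sequentially"
      using complete[of "\<lambda>n. C (f n)"] cau unfolding nrm' Cdiff by blast
    have "C g \<in> D'" unfolding D'_iff CC by (rule g(1))
    moreover have "ip_tendsto ip' f (C g) sequentially"
      using g(2) unfolding ip_tendsto_def nrm' Cdiff CC .
    ultimately show "\<exists>g\<in>D'. ip_tendsto ip' f g sequentially" by blast
  next
    fix w :: "complex ^ 'd" assume w: "w \<in> ball 0 1"
    have "C (kfun w) = kfun (householder v w)" using Ckf[of "householder v w"] by (simp add: householder_involution)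
    then have "C (kfun w) \<in> D" using kfun_mem[of "householder v w"] w unfolding ball by simp
    then show "(\<lambda>z. if z \<in> ball 0 1 then dirichlet_kernel z w else 0) \<in> D'" unfolding D'_iff kfun_def .
  next
    fix f and w :: "complex ^ 'd" assume f: "f \<in> D'" and w: "w \<in> ball 0 1"
    have "C (kfun w) = kfun (householder v w)" using Ckf[of "householder v w"] by (simp add: householder_involution)
    then have "ip' f (kfun w) = C f (householder v w)"
      unfolding ip'_def using ip_kfun[of "C f" "householder v w"] f w unfolding D'_iff ball by simp
    then show "ip' f (\<lambda>z. if z \<in> ball 0 1 then dirichlet_kernel z w else 0) = f w"
      unfolding kfun_def by (simp add: C_def householder_involution)
  qed
  note un = rkhs_unique[OF rkhs_axioms this]
  show "C f \<in> D" if "f \<in> D" using that un(1) D'_iff by metis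
  show "ip (C f) (C g) = ip f g" if "f \<in> D" "g \<in> D" using un(2)[OF that] by (simp add: ip'_def)
qed

text \<open>
  Rotate a point where \<open>M\<close> does not vanish onto the \<open>i\<close>-th axis, apply \<open>constants_in_M\<close> to the rotated
  space \<open>M'\<close>, and rotate back; constants are invariant.
\<close>
theorem finite_defect_submodule_is_whole:
  assumes M: "poly_submodule D ip M" "M \<noteq> {0}" and fd: "finite_defect ip M"
  shows "M = D"
proof -
  have MD: "M \<subseteq> D" "cfun.subspace M" using M by (auto simp: poly_submodule_def)
  obtain E :: "(complex ^ 'd \<Rightarrow> complex) set" and \<phi> where E: "finite E" "\<phi> ` E \<subseteq> D"
    and ker: "\<forall>z\<in>ball 0 1. \<exists>k\<in>M. (\<forall>f\<in>M. ip f k = f z) \<and>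
      k z = dirichlet_kernel z z * of_real (\<Sum>e\<in>E. (cmod (\<phi> e z))\<^sup>2)"
    using finite_defect_kernel[OF M(1) fd] by (elim exE conjE)
  obtain f z0 where f: "f \<in> M" "f z0 \<noteq> 0"
  proof -
    have "0 \<in> M" by (rule cfun.subspace_0[OF MD(2)])
    then obtain f where f: "f \<in> M" "f \<noteq> 0" using M(2) by blast
    then have "\<exists>z. f z \<noteq> 0" by (auto simp: fun_eq_iff)
    then show ?thesis using that f(1) by blast
  qed
  have z0: "z0 \<in> ball 0 1" using vanishes_outside[of f z0] f MD by auto
  define i :: 'd where "i = undefined"
  obtain v x where vx: "householder v (axis i x) = z0" using householder_reaches by blast
  have x: "norm x < 1" using householder_norm[of v "axis i x"] z0 unfolding vx by simp
  define C where "C f = (\<lambda>z. f (householder v z))" for f :: "complex ^ 'd \<Rightarrow> complex"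
  note CD = compose_householder(1)[of _ v, folded C_def] and Cip = compose_householder(2)[of _ _ v, folded C_def]
  have ball: "householder v z \<in> ball 0 1 \<longleftrightarrow> z \<in> ball 0 1" for z by (simp add: householder_norm)
  define M' where "M' = C ` M"
  have "\<exists>c. c \<in> wl2 wt \<and> C (\<phi> e) = psum c" if "e \<in> E" for e
  proof -
    have "C (\<phi> e) \<in> D" using E(2) that by (intro CD) auto
    then show ?thesis using obtain_coeffs by metis
  qed
  then obtain c where c: "\<And>e. e \<in> E \<Longrightarrow> c e \<in> wl2 wt" "\<And>e. e \<in> E \<Longrightarrow> C (\<phi> e) = psum (c e)" by metis
  have "kernel_factor D ip M' i E c"
  proof
    show "M' \<subseteq> D" using CD MD by (auto simp: M'_def)
    show "cfun.subspace M'"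
    proof (rule cfun.subspaceI)
      have "C 0 = 0" by (auto simp: C_def fun_eq_iff)
      then show "0 \<in> M'" unfolding M'_def using cfun.subspace_0[OF MD(2)] by (rule image_eqI[OF sym])
    next
      fix a b assume "a \<in> M'" "b \<in> M'"
      then obtain p q where pq: "p \<in> M" "q \<in> M" "a = C p" "b = C q" by (auto simp: M'_def)
      have "a + b = C (p + q)" by (auto simp: pq C_def fun_eq_iff)
      then show "a + b \<in> M'" unfolding M'_def using cfun.subspace_add[OF MD(2) pq(1,2)] by (rule image_eqI)
    next
      fix s a assume "a \<in> M'"
      then obtain p where p: "p \<in> M" "a = C p" by (auto simp: M'_def)
      have "(\<lambda>u. s * a u) = C (\<lambda>u. s * p u)" by (auto simp: p C_def)
      then show "(\<lambda>u. s * a u) \<in> M'" unfolding M'_def using cfun.subspace_scale[OF MD(2) p(1)] by (rule image_eqI)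
    qed
    show "mi_monom (axis i 1) * a \<in> M'" if "a \<in> M'" for a
    proof -
      obtain p where p: "p \<in> M" "a = C p" using \<open>a \<in> M'\<close> by (auto simp: M'_def)
      define l where "l j = (if j = i then 1 else 0) - 2 / hdot v v * cnj (v $ j) * v $ i" for j
      define q where "q = (\<lambda>z. householder v z $ i)"
      have "q \<in> polynomials"
      proof -
        have "q = (\<lambda>z. \<Sum>\<alpha>\<in>(\<lambda>j. axis j 1) ` UNIV. l (inv (\<lambda>j. axis j 1) \<alpha>) * mi_monom \<alpha> z)"
        proof (rule ext)
          fix z :: "complex ^ 'd"
          have inj: "inj (\<lambda>j. axis j 1 :: nat ^ 'd)" by (auto intro!: injI simp: axis_eq_axis)
          have "(\<Sum>\<alpha>\<in>(\<lambda>j. axis j 1) ` UNIV. l (inv (\<lambda>j. axis j 1) \<alpha>) * mi_monom \<alpha> z) = (\<Sum>j\<in>UNIV. l j * z $ j)"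
            by (subst sum.reindex[OF inj]) (simp only: o_def inv_f_f[OF inj] mi_monom_axis power_one_right)
          then show "q z = (\<Sum>\<alpha>\<in>(\<lambda>j. axis j 1) ` UNIV. l (inv (\<lambda>j. axis j 1) \<alpha>) * mi_monom \<alpha> z)"
            unfolding q_def l_def householder_component by simp
        qed
        moreover have "finite ((\<lambda>j. axis j 1 :: nat ^ 'd) ` UNIV)" by simp
        ultimately show ?thesis
          unfolding polynomials_def mem_Collect_eq
          by (intro exI[of _ "(\<lambda>j. axis j 1 :: nat ^ 'd) ` UNIV"] exI[of _ "\<lambda>\<alpha>. l (inv (\<lambda>j. axis j 1) \<alpha>)"] conjI)
      qed
      then have "q * p \<in> M" using M(1) p(1) unfolding poly_submodule_def by blast
      moreover have "mi_monom (axis i 1) * a = C (q * p)"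
        by (auto simp: p C_def q_def fun_eq_iff householder_involution)
      ultimately show ?thesis unfolding M'_def by (intro image_eqI)
    qed
    show "finite E" by (rule E(1))
    show "c e \<in> wl2 wt" if "e \<in> E" for e by (rule c(1)[OF that])
    fix z :: "complex ^ 'd" assume z: "z \<in> ball 0 1"
    obtain k where k: "k \<in> M" "\<And>f. f \<in> M \<Longrightarrow> ip f k = f (householder v z)"
      "k (householder v z) = dirichlet_kernel (householder v z) (householder v z) * of_real (\<Sum>e\<in>E. (cmod (\<phi> e (householder v z)))\<^sup>2)"
      using bspec[OF ker, of "householder v z"] z unfolding ball by blast
    show "\<exists>k\<in>M'. (\<forall>f\<in>M'. ip f k = f z) \<and> k z = dirichlet_kernel z z * of_real (\<Sum>e\<in>E. (cmod (psum (c e) z))\<^sup>2)"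
    proof (intro bexI conjI ballI)
      show "C k \<in> M'" unfolding M'_def using k(1) by simp
      show "ip a (C k) = a z" if "a \<in> M'" for a
      proof -
        obtain p where p: "p \<in> M" "a = C p" using \<open>a \<in> M'\<close> by (auto simp: M'_def)
        then show ?thesis using Cip[of p k] k(1) k(2)[of p] MD by (auto simp: C_def)
      qed
      have "dirichlet_kernel (householder v z) (householder v z) = dirichlet_kernel z z"
        by (simp add: dirichlet_kernel_def householder_unitary)
      moreover have "\<phi> e (householder v z) = psum (c e) z" if "e \<in> E" for e
        using fun_cong[OF c(2)[OF that], of z] by (simp add: C_def)
      ultimately show "C k z = dirichlet_kernel z z * of_real (\<Sum>e\<in>E. (cmod (psum (c e) z))\<^sup>2)"
        unfolding C_def k(3) by simp
    qed
  qed
  then interpret KF: kernel_factor D ip M' i E c .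
  have "kfun 0 \<in> M'"
  proof (rule KF.constants_in_M)
    show "C f \<in> M'" using f by (simp add: M'_def)
    show "C f (axis i x) \<noteq> 0" using f by (simp add: C_def vx)
  qed (rule x)
  then obtain h where h: "h \<in> M" "kfun 0 = C h" by (auto simp: M'_def)
  have "h z = kfun 0 z" for z
  proof -
    have "kfun 0 (householder v z) = h z" unfolding h(2) by (simp add: C_def householder_involution)
    moreover have "hdot y 0 = 0" for y :: "complex ^ 'd" by (simp add: hdot_def)
    then have "kfun 0 (householder v z) = kfun 0 z"
      unfolding kfun_def dirichlet_kernel_def ball by simp
    ultimately show ?thesis by simp
  qed
  then have "h = kfun 0" by auto
  then show ?thesis using submodule_with_constants[OF M(1)] h(1) by simp
qed

end

theorem corollary1p4:
  fixes D :: "(complex ^ 'd \<Rightarrow> complex) set"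
    and ip :: "(complex ^ 'd \<Rightarrow> complex) \<Rightarrow> (complex ^ 'd \<Rightarrow> complex) \<Rightarrow> complex"
  assumes "CARD('d) \<ge> 2"
    and "rkhs (ball 0 1) dirichlet_kernel D ip"
  shows "{M. poly_submodule D ip M \<and> M \<noteq> {0} \<and> finite_defect ip M} = {D}"
proof -
  interpret dirichlet_module D ip
    using assms(2) by (simp add: dirichlet_module_def)
  have "kfun 0 \<in> D" by (rule kfun_mem) simp
  moreover have "kfun 0 \<noteq> 0" using kfun_0_0 by (metis zero_fun_apply zero_neq_one)
  ultimately have "D \<noteq> {0}" by blast
  then show ?thesis
    using whole_submodule whole_finite_defect finite_defect_submodule_is_whole by blast
qed

end
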